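(* Fix $\gamma\in(0,\infty)$ and $M\in(0,\infty)$. Then the process $u\mapsto L^{\rm resc,h}_n(u)$ defined in the context is tight in the space $\mathcal{C}([-M,M])$ of continuous functions on $[-M,M]$ (with the supremum norm), as $n\to\infty$.
   Context: Let $\omega_{i,j}$, $i,j\ge1$, be i.i.d. exponential random variables with parameter $1$, and $\omega_{i,j}=0$ if $i\le0$ or $j\le0$. For $(m,n)\in\mathbb{Z}^2$ let $L_{(0,0)\to(m,n)}$ be the maximum, over up-right paths $\pi=(\pi(0),\dots,\pi(\ell))$ in $\mathbb{Z}^2$ (steps $(1,0)$ or $(0,1)$) from $(0,0)$ to $(m,n)$, of $\sum_{k=1}^{\ell}\omega_{\pi(k)}$. Set $\beta_1=2(1+\gamma)^{2/3}\gamma^{4/3}$, $\beta_2=(1+\gamma)^{4/3}\gamma^{-1/3}$ and $$L^{\rm resc,h}_n(u)=\frac{L_{(0,0)\to(\gamma^2n+\beta_1un^{2/3},\,n)}-n\big(1+\sqrt{\gamma^2+\beta_1un^{-1/3}}\big)^2}{\beta_2n^{1/3}},$$ where coordinates are taken with integer parts and the process is regarded as a continuous function of $u$ (by linear interpolation). *)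

theory Defs
  imports "HOL-Probability.Probability"
begin

definition up_right_path :: "(nat \<Rightarrow> int \<times> int) \<Rightarrow> nat \<Rightarrow> int \<times> int \<Rightarrow> int \<times> int \<Rightarrow> bool" where
  "up_right_path p l a b \<longleftrightarrow> p 0 = a \<and> p l = b \<and>
     (\<forall>k<l. p (Suc k) = p k + (1, 0) \<or> p (Suc k) = p k + (0, 1))"

definition lpp_weight :: "(nat \<Rightarrow> nat \<Rightarrow> real) \<Rightarrow> int \<times> int \<Rightarrow> real" where
  "lpp_weight w z = (if fst z \<ge> 1 \<and> snd z \<ge> 1 then w (nat (fst z)) (nat (snd z)) else 0)"

definition lpp :: "(nat \<Rightarrow> nat \<Rightarrow> real) \<Rightarrow> int \<times> int \<Rightarrow> int \<times> int \<Rightarrow> real" where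
  "lpp w a b = Sup {(\<Sum>k\<in>{1..l}. lpp_weight w (p k)) | p l. up_right_path p l a b}"

definition beta1 :: "real \<Rightarrow> real" where
  "beta1 \<gamma> = 2 * (1 + \<gamma>) powr (2/3) * \<gamma> powr (4/3)"

definition beta2 :: "real \<Rightarrow> real" where
  "beta2 \<gamma> = (1 + \<gamma>) powr (4/3) * \<gamma> powr (-1/3)"

definition xcoord :: "real \<Rightarrow> nat \<Rightarrow> real \<Rightarrow> real" where
  "xcoord \<gamma> n u = \<gamma>^2 * real n + beta1 \<gamma> * u * real n powr (2/3)"

definition Lresc_raw :: "real \<Rightarrow> (nat \<Rightarrow> nat \<Rightarrow> real) \<Rightarrow> nat \<Rightarrow> real \<Rightarrow> real" where
  "Lresc_raw \<gamma> w n u =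
     (lpp w (0, 0) (\<lfloor>xcoord \<gamma> n u\<rfloor>, int n)
       - real n * (1 + sqrt (\<gamma>^2 + beta1 \<gamma> * u * real n powr (-1/3)))^2)
     / (beta2 \<gamma> * real n powr (1/3))"

text \<open>Grid point u_k at which the first coordinate equals the integer k.\<close>
definition ugrid :: "real \<Rightarrow> nat \<Rightarrow> int \<Rightarrow> real" where
  "ugrid \<gamma> n k = (real_of_int k - \<gamma>^2 * real n) / (beta1 \<gamma> * real n powr (2/3))"

definition Lresc :: "real \<Rightarrow> (nat \<Rightarrow> nat \<Rightarrow> real) \<Rightarrow> nat \<Rightarrow> real \<Rightarrow> real" where
  "Lresc \<gamma> w n u =
     (let x = xcoord \<gamma> n u; k = \<lfloor>x\<rfloor>; \<theta> = x - real_of_int k in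
       (1 - \<theta>) * Lresc_raw \<gamma> w n (ugrid \<gamma> n k) + \<theta> * Lresc_raw \<gamma> w n (ugrid \<gamma> n (k + 1)))"

end

theory Submission
  imports Defs "HOL-Real_Asymp.Real_Asymp" "HOL-Complex_Analysis.Great_Picard"
begin

text \<open>Put weights of rate \<open>w\<close> on the horizontal and of rate \<open>1 - z\<close> on the vertical axis. For \<open>w = z\<close> the
  Burke property makes the increments along every row i.i.d.; tilting the vertical axis then gives, for
  arbitrary \<open>w\<close> and \<open>z\<close>, the exact exponential moment
  \<open>E exp ((w - z) L(m, n)) = (w / z)^m ((1 - z) / (1 - w))^n\<close> of Emrah, Janjigian and Seppalainen.
  With parameters within \<open>O(n^(-1/3))\<close> of the critical one it bounds the upper tail of the stationary
  passage time, whose mean is explicit, so its fluctuations are \<open>O(n^(1/3))\<close> in mean. Together these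
  force the optimal path of the stationary model off the critical parameter to leave along one
  prescribed axis with high probability.

  On that event monotonicity in the boundary weights sandwiches the increments of the bulk passage
  times between two random walks whose drifts differ by \<open>O(n^(-1/3))\<close>; this is the modulus of
  continuity. The lower tail at one point follows by comparing the bulk with the critical stationary
  model: after reversing the box, the gain from the boundary is a difference of two such walks over
  the \<open>O(n^(2/3))\<close> sites at which the path can exit. Tightness is then the theorem of Arzela and Ascoli.\<close>


section \<open>Last-passage percolation with boundary weights\<close>

text \<open>Exponential moments control an upper tail only. The lower tail comes from centring: a
  variable of mean zero has mean absolute value equal to twice the mean of its positive part, so the
  explicit mean makes a one-sided bound two-sided. Markov's inequality then gives decay of order 1 /
  y only, which suffices for tightness.

  The constants are chosen in a forced order. At distance \<open>a\<close> from the critical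
  parameter the stationary mean exceeds its minimum by order \<open>s * a ^ 2\<close>, with s of
  order n, while a moment parameter \<open>\<tau> * a\<close> yields fluctuations of order
  \<open>1 / (\<tau> * a) + \<tau> * s * a ^ 2\<close>. Hence \<open>\<tau>\<close> is made small
  first and \<open>s * a ^ 3\<close> large afterwards.

  Two obstacles are not about percolation. The given space need not carry weights on the axes, so
  events about bulk passage times are moved by law to a product space that does. And the compact set
  has to serve every n, whereas the estimates hold for large n; the finitely many others are covered
  because a single random continuous function is tight.\<close>

text \<open>Rates \<open>w\<close> and \<open>1 - z\<close> on the horizontal and the vertical axis correspond to \<open>p = 1 / w\<close> and
  \<open>q = 1 / (1 - z)\<close> for a field of rate 1 weights; \<open>w = z\<close> is the stationary model, and \<open>p = q = 0\<close> is the
  passage time of the theorem. The weight \<open>W 0 0\<close> is never used.\<close>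

fun bl :: "real \<Rightarrow> real \<Rightarrow> (nat \<Rightarrow> nat \<Rightarrow> real) \<Rightarrow> nat \<Rightarrow> nat \<Rightarrow> real" where
  "bl p q W 0 0 = 0"
| "bl p q W (Suc i) 0 = bl p q W i 0 + p * W (Suc i) 0"
| "bl p q W 0 (Suc j) = bl p q W 0 j + q * W 0 (Suc j)"
| "bl p q W (Suc i) (Suc j) = W (Suc i) (Suc j) + max (bl p q W i (Suc j)) (bl p q W (Suc i) j)"

lemma bl_row_0: "bl p q W i 0 = (\<Sum>k=1..i. p * W k 0)"
  by (induction i) auto

lemma bl_col_0: "bl p q W 0 j = (\<Sum>k=1..j. q * W 0 k)"
  by (induction j) auto

text \<open>The disjunctions let the two fields differ on the axes once both factors vanish; this is
  how bulk passage times are freed from the axis weights.\<close>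

lemma bl_cong:
  assumes "\<And>k l. k \<le> i \<Longrightarrow> l \<le> j \<Longrightarrow> (k \<noteq> 0 \<or> p \<noteq> 0 \<or> q \<noteq> 0) \<Longrightarrow> (l \<noteq> 0 \<or> p \<noteq> 0 \<or> q \<noteq> 0) \<Longrightarrow> W k l = W' k l"
  shows "bl p q W i j = bl p q W' i j"
  using assms
proof (induction p q W i j rule: bl.induct)
  case (2 p q W i)
  then show ?case by (cases "p = 0") auto
next
  case (3 p q W j)
  then show ?case by (cases "q = 0") auto
qed auto

lemma bl_transpose: "bl q p (\<lambda>i j. W j i) j i = bl p q W i j"
  by (induction p q W i j rule: bl.induct) (auto simp: max.commute)

text \<open>At a new corner the horizontal increment is the weight plus the positive part of
  (horizontal increment below minus vertical increment to the left), and symmetrically for the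
  vertical one. Each is increasing in one old increment and decreasing in the other, so the two
  opposite monotonicities have to go through a single induction.\<close>

lemma bl_increment_mono:
  assumes W: "\<And>i j. 0 \<le> W i j" and "p \<le> p'" "q' \<le> q"
  shows "bl p q W (Suc i) j - bl p q W i j \<le> bl p' q' W (Suc i) j - bl p' q' W i j \<and>
         bl p' q' W i (Suc j) - bl p' q' W i j \<le> bl p q W i (Suc j) - bl p q W i j"
proof (induction "i + j" arbitrary: i j rule: less_induct)
  case less
  have "bl p q W (Suc i) j - bl p q W i j \<le> bl p' q' W (Suc i) j - bl p' q' W i j"
  proof (cases j)
    case 0
    then show ?thesis using assms by (auto intro: mult_right_mono)
  next
    case (Suc l)
    with less[of i l] show ?thesis by auto
  qed
  moreover have "bl p' q' W i (Suc j) - bl p' q' W i j \<le> bl p q W i (Suc j) - bl p q W i j"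
  proof (cases i)
    case 0
    then show ?thesis using assms by (auto intro: mult_right_mono)
  next
    case (Suc l)
    with less[of l j] show ?thesis by auto
  qed
  ultimately show ?case by blast
qed

lemma bl_row_increment_mono:
  assumes W: "\<And>i j. 0 \<le> W i j" and "p \<le> p'" "q' \<le> q" and "i \<le> i'"
  shows "bl p q W i' j - bl p q W i j \<le> bl p' q' W i' j - bl p' q' W i j"
  using \<open>i \<le> i'\<close>
proof (induction rule: dec_induct)
  case (step k)
  then show ?case using bl_increment_mono[of W p p' q' q k j, OF assms(1-3)] by linarith
qed simp

lemma bl_step_mono:
  assumes W: "\<And>i j. 0 \<le> W i j" and "0 \<le> p" "0 \<le> q"
  shows "bl p q W i j \<le> bl p q W (Suc i) j" "bl p q W i j \<le> bl p q W i (Suc j)"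
proof -
  show "bl p q W i j \<le> bl p q W (Suc i) j"
    using assms by (cases j) (auto intro: order_trans[OF max.cobounded1] simp: add_increasing)
  show "bl p q W i j \<le> bl p q W i (Suc j)"
    using assms by (cases i) (auto simp: add_increasing)
qed

lemma bl_mono:
  assumes W: "\<And>i j. 0 \<le> W i j" and "0 \<le> p" "0 \<le> q" and "i \<le> i'" "j \<le> j'"
  shows "bl p q W i j \<le> bl p q W i' j'"
proof -
  have "bl p q W i j \<le> bl p q W i' j"
    using \<open>i \<le> i'\<close> by (induction rule: dec_induct) (auto intro: order_trans bl_step_mono assms)
  also have "\<dots> \<le> bl p q W i' j'"
    using \<open>j \<le> j'\<close> by (induction rule: dec_induct) (auto intro: order_trans bl_step_mono assms)
  finally show ?thesis .
qed

lemma bl_nonneg: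
  assumes W: "\<And>i j. 0 \<le> W i j" and "0 \<le> p" "0 \<le> q"
  shows "0 \<le> bl p q W i j"
  using bl_mono[of W p q 0 i 0 j] assms by simp

lemma bl_mono_boundary:
  assumes W: "\<And>i j. 0 \<le> W i j" and "p \<le> p'" "q \<le> q'"
  shows "bl p q W i j \<le> bl p' q' W i j"
  using assms
proof (induction p q W i j rule: bl.induct)
  case (2 p q W i)
  then show ?case by (auto intro!: add_mono mult_right_mono)
next
  case (3 p q W j)
  then show ?case by (auto intro!: add_mono mult_right_mono)
next
  case (4 p q W i j)
  then show ?case by (auto simp: max.coboundedI1 max.coboundedI2)
qed auto

text \<open>An up-right path collects weights from at most one axis; giving the other axis the
  factor 0 keeps the value of such a path and can only lower the rest. Comparing the two one-sided
  models therefore decides along which axis an optimal path leaves.\<close>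

lemma bl_eq_max:
  assumes W: "\<And>i j. 0 \<le> W i j" and "0 \<le> p" "0 \<le> q"
  shows "bl p q W i j = max (bl p 0 W i j) (bl 0 q W i j)"
  using assms
proof (induction p q W i j rule: bl.induct)
  case (2 p q W i)
  have "0 \<le> bl p 0 W (Suc i) 0" using 2 by (intro bl_nonneg) auto
  moreover have "bl 0 q W (Suc i) 0 = 0" by (simp add: bl_row_0)
  moreover have "bl p q W (Suc i) 0 = bl p 0 W (Suc i) 0" by (simp add: bl_row_0)
  ultimately show ?case by (simp only: max_def) auto
next
  case (3 p q W j)
  have "0 \<le> bl 0 q W 0 (Suc j)" using 3 by (intro bl_nonneg) auto
  moreover have "bl p 0 W 0 (Suc j) = 0" by (simp add: bl_col_0)
  moreover have "bl p q W 0 (Suc j) = bl 0 q W 0 (Suc j)" by (simp add: bl_col_0)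
  ultimately show ?case by (simp only: max_def) auto
next
  case (4 p q W i j)
  then show ?case by (auto simp: max_def)
qed auto

text \<open>If leaving along the horizontal axis is optimal at column \<open>i0\<close>, it stays so
  to the right, because the horizontal model has the larger row increments. There the full model
  agrees with the one without vertical weights, whose increments dominate those of the bulk.\<close>

lemma bl_increment_le_of_horizontal_exit:
  assumes W: "\<And>i j. 0 \<le> W i j" and pq: "0 \<le> p" "0 \<le> q"
    and exit: "bl 0 q W i0 j \<le> bl p 0 W i0 j" and "i0 \<le> i" "i \<le> i'"
  shows "bl 0 0 W i' j - bl 0 0 W i j \<le> bl p q W i' j - bl p q W i j"
proof -
  have *: "bl p q W k j = bl p 0 W k j" if "i0 \<le> k" for k
  proof -
    have "bl 0 q W k j - bl 0 q W i0 j \<le> bl p 0 W k j - bl p 0 W i0 j"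
      using that pq by (intro bl_row_increment_mono W) auto
    with exit have "bl 0 q W k j \<le> bl p 0 W k j" by linarith
    then show ?thesis by (subst bl_eq_max) (use W pq in auto)
  qed
  have "bl 0 0 W i' j - bl 0 0 W i j \<le> bl p 0 W i' j - bl p 0 W i j"
    using assms by (intro bl_row_increment_mono) auto
  with *[of i] *[of i'] assms show ?thesis by auto
qed

text \<open>The mirror image: an optimal vertical exit at \<open>i1\<close> persists to the
  left.\<close>

lemma bl_increment_ge_of_vertical_exit:
  assumes W: "\<And>i j. 0 \<le> W i j" and pq: "0 \<le> p" "0 \<le> q"
    and exit: "bl p 0 W i1 j \<le> bl 0 q W i1 j" and "i \<le> i'" "i' \<le> i1"
  shows "bl p q W i' j - bl p q W i j \<le> bl 0 0 W i' j - bl 0 0 W i j"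
proof -
  have *: "bl p q W k j = bl 0 q W k j" if "k \<le> i1" for k
  proof -
    have "bl 0 q W i1 j - bl 0 q W k j \<le> bl p 0 W i1 j - bl p 0 W k j"
      using that pq by (intro bl_row_increment_mono W) auto
    with exit have "bl p 0 W k j \<le> bl 0 q W k j" by linarith
    then show ?thesis by (subst bl_eq_max) (use W pq in auto)
  qed
  have "bl 0 q W i' j - bl 0 q W i j \<le> bl 0 0 W i' j - bl 0 0 W i j"
    using assms by (intro bl_row_increment_mono) auto
  with *[of i] *[of i'] assms show ?thesis by auto
qed

section \<open>Reversed passage times and exit points\<close>

text \<open>Sites outside the box stay fixed, so the index map is an involution of the whole
  quadrant: reversal preserves the law of the field, and the axes keep weights independent of those
  in the box.\<close>

definition box_reverse :: "nat \<Rightarrow> nat \<Rightarrow> (nat \<Rightarrow> nat \<Rightarrow> 'b) \<Rightarrow> nat \<Rightarrow> nat \<Rightarrow> 'b" where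
  "box_reverse m n W i j =
     (if 1 \<le> i \<and> i \<le> m \<and> 1 \<le> j \<and> j \<le> n then W (m + 1 - i) (n + 1 - j) else W i j)"

text \<open>The passage time from \<open>(i, j)\<close> to \<open>(m, n)\<close>, both endpoints included.\<close>

definition bl_to :: "nat \<Rightarrow> nat \<Rightarrow> (nat \<Rightarrow> nat \<Rightarrow> real) \<Rightarrow> nat \<Rightarrow> nat \<Rightarrow> real" where
  "bl_to m n W i j = bl 0 0 (box_reverse m n W) (m + 1 - i) (n + 1 - j)"

lemma bl_to_rec:
  assumes "1 \<le> i" "i \<le> m" "1 \<le> j" "j \<le> n"
  shows "bl_to m n W i j = W i j + max (bl_to m n W (Suc i) j) (bl_to m n W i (Suc j))"
proof -
  obtain a where a: "m + 1 - i = Suc a" "m - i = a" using assms by (cases "m + 1 - i") auto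
  obtain b where b: "n + 1 - j = Suc b" "n - j = b" using assms by (cases "n + 1 - j") auto
  have "box_reverse m n W (Suc a) (Suc b) = W i j"
    using assms a b by (auto simp: box_reverse_def)
  then show ?thesis using a b by (simp add: bl_to_def)
qed

lemma bl_to_outside: "bl_to m n W (Suc m) j = 0" "bl_to m n W i (Suc n) = 0"
  by (simp_all add: bl_to_def bl_row_0 bl_col_0)

text \<open>Superadditivity under concatenation at (i, j): both pieces count \<open>W i j\<close>,
  hence the subtraction. The induction moves (i, j) towards the corner along whichever step
  \<open>bl_to\<close> takes.\<close>

lemma bl_plus_bl_to_le:
  assumes W: "\<And>i j. 0 \<le> W i j" and pq: "0 \<le> p" "0 \<le> q"
    and "1 \<le> i" "i \<le> m" "1 \<le> j" "j \<le> n"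
  shows "bl p q W i j - W i j + bl_to m n W i j \<le> bl p q W m n"
  using assms(4-)
proof (induction "(m - i) + (n - j)" arbitrary: i j rule: less_induct)
  case less
  have step: "W k l \<le> bl p q W k l - bl p q W (k - 1) l" "W k l \<le> bl p q W k l - bl p q W k (l - 1)"
    if "1 \<le> k" "1 \<le> l" for k l
    using that by (cases k; cases l; simp)+
  have "bl p q W i j + bl_to m n W (Suc i) j \<le> bl p q W m n"
  proof (cases "i = m")
    case True
    then show ?thesis using bl_mono[of W p q i m j n] W pq less.prems by (simp add: bl_to_outside)
  next
    case False
    then have "bl p q W (Suc i) j - W (Suc i) j + bl_to m n W (Suc i) j \<le> bl p q W m n"
      using less.prems by (intro less.hyps) auto
    with less.prems step(1)[of "Suc i" j] show ?thesis by auto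
  qed
  moreover have "bl p q W i j + bl_to m n W i (Suc j) \<le> bl p q W m n"
  proof (cases "j = n")
    case True
    then show ?thesis using bl_mono[of W p q i m j n] W pq less.prems by (simp add: bl_to_outside)
  next
    case False
    then have "bl p q W i (Suc j) - W i (Suc j) + bl_to m n W i (Suc j) \<le> bl p q W m n"
      using less.prems by (intro less.hyps) auto
    with less.prems step(2)[of i "Suc j"] show ?thesis by auto
  qed
  ultimately show ?case using bl_to_rec[of i m j n W] less.prems by auto
qed

lemma bl_axis_plus_bl_to_le:
  assumes W: "\<And>i j. 0 \<le> W i j" and pq: "0 \<le> p" "0 \<le> q" and "1 \<le> k" "k \<le> m" "1 \<le> n"
  shows "bl p q W k 0 + bl_to m n W k 1 \<le> bl p q W m n"
proof -
  have "bl p q W k 0 \<le> bl p q W k 1 - W k 1"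
    using \<open>1 \<le> k\<close> by (cases k) auto
  with bl_plus_bl_to_le[of W p q k m 1 n] assms show ?thesis by auto
qed

text \<open>The witness is the column at which an optimal path leaves the horizontal axis; it is
  found by tracing the path back from (m, n).\<close>

lemma horizontal_exit_decomposition:
  assumes W: "\<And>i j. 0 \<le> W i j" and p: "0 \<le> p" and mn: "1 \<le> m" "1 \<le> n"
  shows "\<exists>k\<in>{1..m}. bl p 0 W m n \<le> bl p 0 W k 0 + bl_to m n W k 1"
proof -
  have "\<exists>k\<in>{1..m}. bl p 0 W i j - W i j + bl_to m n W i j \<le> bl p 0 W k 0 + bl_to m n W k 1"
    if "1 \<le> i" "i \<le> m" "1 \<le> j" "j \<le> n" for i j
    using that
  proof (induction "i + j" arbitrary: i j rule: less_induct)
    case less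
    obtain a b where ab: "i = Suc a" "j = Suc b" using less.prems by (cases i; cases j) auto
    have down: "\<exists>k\<in>{1..m}. bl p 0 W i b + bl_to m n W i j \<le> bl p 0 W k 0 + bl_to m n W k 1"
    proof (cases "b = 0")
      case True
      then show ?thesis using ab less.prems by (intro bexI[of _ i]) auto
    next
      case False
      have "bl_to m n W i j \<le> bl_to m n W i b - W i b"
        using bl_to_rec[of i m b n W] less.prems ab False by auto
      with less.hyps[of i b] less.prems ab False show ?thesis by force
    qed
    have left: "\<exists>k\<in>{1..m}. bl p 0 W a j + bl_to m n W i j \<le> bl p 0 W k 0 + bl_to m n W k 1"
    proof (cases "a = 0")
      case True
      \<comment> \<open>Column 0 has factor 0 here, so arriving from it is never better than
        arriving from below.\<close>
      have "bl p 0 W a j \<le> bl p 0 W i b"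
        using True p W bl_nonneg[of W p 0 i b] by (simp add: bl_col_0)
      with down show ?thesis by force
    next
      case False
      have "bl_to m n W i j \<le> bl_to m n W a j - W a j"
        using bl_to_rec[of a m j n W] less.prems ab False by auto
      with less.hyps[of a j] less.prems ab False show ?thesis by force
    qed
    show ?case using down left ab by (auto simp: max_def)
  qed
  from this[of m n] show ?thesis using mn bl_to_rec[of m m n n W] by (auto simp: bl_to_outside)
qed

text \<open>Moving the origin to (k, 0) leaves the passage times to the corner unchanged; this
  serves exit points beyond a given column.\<close>

lemma bl_to_shift:
  assumes "k \<le> m" "1 \<le> i" "1 \<le> j"
  shows "bl_to (m - k) n (\<lambda>i j. W (i + k) j) i j = bl_to m n W (i + k) j"
proof -
  have "bl 0 0 (box_reverse (m - k) n (\<lambda>i j. W (i + k) j)) (m - k + 1 - i) (n + 1 - j) =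
    bl 0 0 (box_reverse m n W) (m - k + 1 - i) (n + 1 - j)"
    using assms by (intro bl_cong) (auto simp: box_reverse_def intro!: arg_cong2[where f=W])
  then show ?thesis using assms by (simp add: bl_to_def add.commute)
qed

section \<open>Lattice paths and the recursion\<close>

text \<open>Prefixes carry the induction; they also show that a path from the origin never reaches a
  negative coordinate.\<close>

lemma up_right_path_prefix_le_bl:
  assumes path: "up_right_path p l (0, 0) b" and "k \<le> l"
  shows "\<exists>i j. p k = (int i, int j) \<and> (\<Sum>r\<in>{1..k}. lpp_weight W (p r)) \<le> bl 0 0 W i j"
  using \<open>k \<le> l\<close>
proof (induction k)
  case 0
  then show ?case using path by (intro exI[of _ 0]) (auto simp: up_right_path_def)
next
  case (Suc k)
  then obtain i j where ij: "p k = (int i, int j)" "(\<Sum>r\<in>{1..k}. lpp_weight W (p r)) \<le> bl 0 0 W i j"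
    by auto
  have "p (Suc k) = p k + (1, 0) \<or> p (Suc k) = p k + (0, 1)"
    using path Suc.prems by (auto simp: up_right_path_def)
  then consider "p (Suc k) = (int (Suc i), int j)" | "p (Suc k) = (int i, int (Suc j))"
    using ij by (auto simp: add.commute)
  then show ?case
  proof cases
    case 1
    have "(\<Sum>r\<in>{1..Suc k}. lpp_weight W (p r)) \<le> bl 0 0 W (Suc i) j"
      using ij 1 by (cases j) (auto simp: lpp_weight_def nat_add_distrib)
    with 1 show ?thesis by blast
  next
    case 2
    have "(\<Sum>r\<in>{1..Suc k}. lpp_weight W (p r)) \<le> bl 0 0 W i (Suc j)"
      using ij 2 by (cases i) (auto simp: lpp_weight_def nat_add_distrib)
    with 2 show ?thesis by blast
  qed
qed

lemma up_right_path_extend: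
  assumes "up_right_path p l a b" and "c = b + (1, 0) \<or> c = b + (0, 1)"
  shows "up_right_path (p(Suc l := c)) (Suc l) a c \<and>
    (\<Sum>r\<in>{1..Suc l}. lpp_weight W ((p(Suc l := c)) r)) = (\<Sum>r\<in>{1..l}. lpp_weight W (p r)) + lpp_weight W c"
  using assms by (auto simp: up_right_path_def less_Suc_eq)

lemma up_right_path_attaining_bl:
  "\<exists>p l. up_right_path p l (0, 0) (int m, int n) \<and> (\<Sum>r\<in>{1..l}. lpp_weight W (p r)) = bl 0 0 W m n"
proof (induction "0::real" "0::real" W m n rule: bl.induct)
  case (1 W)
  show ?case by (intro exI[of _ "\<lambda>_. (0,0)"] exI[of _ 0]) (auto simp: up_right_path_def)
next
  case (2 W i)
  then obtain p l where "up_right_path p l (0, 0) (int i, int 0)" "(\<Sum>r\<in>{1..l}. lpp_weight W (p r)) = bl 0 0 W i 0"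
    by blast
  with up_right_path_extend[of p l "(0,0)" "(int i, int 0)" "(int (Suc i), int 0)" W]
  show ?case by (intro exI[of _ "p(Suc l := (int (Suc i), int 0))"] exI[of _ "Suc l"]) (simp add: lpp_weight_def)
next
  case (3 W j)
  then obtain p l where "up_right_path p l (0, 0) (int 0, int j)" "(\<Sum>r\<in>{1..l}. lpp_weight W (p r)) = bl 0 0 W 0 j"
    by blast
  with up_right_path_extend[of p l "(0,0)" "(int 0, int j)" "(int 0, int (Suc j))" W]
  show ?case by (intro exI[of _ "p(Suc l := (int 0, int (Suc j)))"] exI[of _ "Suc l"]) (simp add: lpp_weight_def)
next
  case (4 W i j)
  have w: "lpp_weight W (int (Suc i), int (Suc j)) = W (Suc i) (Suc j)"
    by (simp add: lpp_weight_def nat_add_distrib)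
  show ?case
  proof (cases "bl 0 0 W i (Suc j) \<le> bl 0 0 W (Suc i) j")
    case True
    obtain p l where pl: "up_right_path p l (0, 0) (int (Suc i), int j)" "(\<Sum>r\<in>{1..l}. lpp_weight W (p r)) = bl 0 0 W (Suc i) j"
      using 4 by blast
    have "(int (Suc i), int (Suc j)) = (int (Suc i), int j) + (0, 1)" by simp
    from up_right_path_extend[OF pl(1) disjI2[OF this], of W] pl(2) True w
    show ?thesis by (intro exI[of _ "p(Suc l := (int (Suc i), int (Suc j)))"] exI[of _ "Suc l"]) simp
  next
    case False
    obtain p l where pl: "up_right_path p l (0, 0) (int i, int (Suc j))" "(\<Sum>r\<in>{1..l}. lpp_weight W (p r)) = bl 0 0 W i (Suc j)"
      using 4 by blast
    have "(int (Suc i), int (Suc j)) = (int i, int (Suc j)) + (1, 0)" by simp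
    from up_right_path_extend[OF pl(1) disjI1[OF this], of W] pl(2) False w
    show ?thesis by (intro exI[of _ "p(Suc l := (int (Suc i), int (Suc j)))"] exI[of _ "Suc l"]) simp
  qed
qed

lemma lpp_eq_bl:
  "lpp W (0, 0) (int m, int n) = bl 0 0 W m n"
  unfolding lpp_def
proof (rule cSup_eq_maximum)
  show "bl 0 0 W m n \<in> {\<Sum>k = 1..l. lpp_weight W (p k) |p l. up_right_path p l (0, 0) (int m, int n)}"
    using up_right_path_attaining_bl[of m n W] by force
next
  fix x assume "x \<in> {\<Sum>k = 1..l. lpp_weight W (p k) |p l. up_right_path p l (0, 0) (int m, int n)}"
  then obtain p l where x: "x = (\<Sum>k = 1..l. lpp_weight W (p k))" "up_right_path p l (0, 0) (int m, int n)"
    by blast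
  then have "p l = (int m, int n)" by (simp add: up_right_path_def)
  with up_right_path_prefix_le_bl[OF x(2), of l W] x(1) show "x \<le> bl 0 0 W m n" by auto
qed


section \<open>Exponential variables and the Burke property\<close>

definition expm :: "real \<Rightarrow> real measure" where
  "expm l = density lborel (\<lambda>x. ennreal (exponential_density l x))"

lemma sets_expm [simp, measurable_cong]: "sets (expm l) = sets borel"
  by (simp add: expm_def)

lemma space_expm [simp]: "space (expm l) = UNIV"
  by (simp add: expm_def)

lemma prob_space_expm: "0 < l \<Longrightarrow> prob_space (expm l)"
  unfolding expm_def by (rule prob_space_exponential_density)

lemma sigma_finite_expm: "0 < l \<Longrightarrow> sigma_finite_measure (expm l)"
  by (intro prob_space_imp_sigma_finite prob_space_expm)

lemma nn_integral_expm:
  assumes [measurable]: "f \<in> borel_measurable borel"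
  shows "(\<integral>\<^sup>+x. f x \<partial>expm l) = (\<integral>\<^sup>+x. ennreal (exponential_density l x) * f x \<partial>lborel)"
  unfolding expm_def by (subst nn_integral_density) auto

lemma nn_integral_expm_scale:
  assumes [measurable]: "f \<in> borel_measurable borel" and l: "0 < l"
  shows "(\<integral>\<^sup>+x. f (x / l) \<partial>expm 1) = (\<integral>\<^sup>+x. f x \<partial>expm l)"
proof -
  have "(\<integral>\<^sup>+x. f (x / l) \<partial>expm 1) = (\<integral>\<^sup>+x. ennreal (exponential_density 1 x) * f (x / l) \<partial>lborel)"
    by (rule nn_integral_expm) simp
  also have "\<dots> = ennreal l * (\<integral>\<^sup>+x. ennreal (exponential_density 1 (0 + l * x)) * f ((0 + l * x) / l) \<partial>lborel)"
    using l by (subst nn_integral_real_affine[where c=l and t=0]) auto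
  also have "\<dots> = (\<integral>\<^sup>+x. ennreal l * (ennreal (exponential_density 1 (0 + l * x)) * f ((0 + l * x) / l)) \<partial>lborel)"
    by (subst nn_integral_cmult) auto
  also have "\<dots> = (\<integral>\<^sup>+x. ennreal (exponential_density l x) * f x \<partial>lborel)"
  proof (intro nn_integral_cong)
    fix x :: real
    have "ennreal l * ennreal (exponential_density 1 (0 + l * x)) = ennreal (exponential_density l x)"
      using l by (subst ennreal_mult'[symmetric]) (auto simp: exponential_density_def mult.commute zero_le_mult_iff mult_less_0_iff)
    then show "ennreal l * (ennreal (exponential_density 1 (0 + l * x)) * f ((0 + l * x) / l)) = ennreal (exponential_density l x) * f x"
      using l by (simp add: mult.assoc[symmetric])
  qed
  also have "\<dots> = (\<integral>\<^sup>+x. f x \<partial>expm l)"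
    by (rule nn_integral_expm[symmetric]) simp
  finally show ?thesis .
qed

text \<open>The source of every exact moment below: tilting rate \<open>l\<close> by
  \<open>exp ((l - l') * x)\<close> produces rate \<open>l'\<close> at the cost of the factor
  \<open>l / l'\<close>.\<close>

lemma nn_integral_expm_tilt:
  assumes [measurable]: "f \<in> borel_measurable borel" and l: "0 < l" "0 < l'"
  shows "(\<integral>\<^sup>+x. ennreal (exp ((l - l') * x)) * f x \<partial>expm l) = ennreal (l / l') * (\<integral>\<^sup>+x. f x \<partial>expm l')"
proof -
  have "(\<integral>\<^sup>+x. ennreal (exp ((l - l') * x)) * f x \<partial>expm l) =
    (\<integral>\<^sup>+x. ennreal (exponential_density l x) * (ennreal (exp ((l - l') * x)) * f x) \<partial>lborel)"
    by (rule nn_integral_expm) simp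
  also have "\<dots> = (\<integral>\<^sup>+x. ennreal (l / l') * (ennreal (exponential_density l' x) * f x) \<partial>lborel)"
  proof (intro nn_integral_cong)
    fix x :: real
    have "exponential_density l x * exp ((l - l') * x) = l / l' * exponential_density l' x"
      using l by (auto simp: exponential_density_def exp_add[symmetric] algebra_simps)
    then have "ennreal (exponential_density l x) * ennreal (exp ((l - l') * x)) = ennreal (l / l') * ennreal (exponential_density l' x)"
      using l by (simp add: ennreal_mult'[symmetric] ennreal_mult''[symmetric])
    then show "ennreal (exponential_density l x) * (ennreal (exp ((l - l') * x)) * f x) = ennreal (l / l') * (ennreal (exponential_density l' x) * f x)"
      by (simp add: mult.assoc[symmetric])
  qed
  also have "\<dots> = ennreal (l / l') * (\<integral>\<^sup>+x. f x \<partial>expm l')"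
    by (subst nn_integral_cmult) (auto simp: nn_integral_expm)
  finally show ?thesis .
qed

lemma nn_integral_expm_exp:
  assumes l: "0 < l" "0 < l'"
  shows "(\<integral>\<^sup>+x. ennreal (exp ((l - l') * x)) \<partial>expm l) = ennreal (l / l')"
proof -
  interpret prob_space "expm l'" by (rule prob_space_expm) fact
  show ?thesis using nn_integral_expm_tilt[of "\<lambda>_. 1" l l'] l emeasure_space_1 by simp
qed

lemma nn_integral_lborel_reflect:
  fixes t :: real
  assumes [measurable]: "f \<in> borel_measurable borel"
  shows "(\<integral>\<^sup>+x. f x \<partial>lborel) = (\<integral>\<^sup>+x. f (t - x) \<partial>lborel)"
  using nn_integral_real_affine[of f "-1" t] by simp

lemma nn_integral_lborel_shift:
  fixes t :: real
  assumes [measurable]: "f \<in> borel_measurable borel"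
  shows "(\<integral>\<^sup>+x. f x \<partial>lborel) = (\<integral>\<^sup>+x. f (x + t) \<partial>lborel)"
  using nn_integral_real_affine[of f 1 t] by (simp add: add.commute)

text \<open>The density of the difference of independent exponentials of rates \<open>w\<close> and
  \<open>1 - w\<close>; the constant is \<open>w * (1 - w)\<close> because the rates add up to
  1.\<close>

definition diff_density :: "real \<Rightarrow> real \<Rightarrow> ennreal" where
  "diff_density w d = ennreal (w * (1 - w) * exp (- w * max 0 d - (1 - w) * max 0 (- d)))"

lemma diff_density_measurable [measurable]: "diff_density w \<in> borel_measurable borel"
  unfolding diff_density_def by measurable

text \<open>The minimum of independent exponentials of rates \<open>w\<close> and \<open>1 - w\<close> has rate 1 and is
  independent of their difference.\<close>

lemma nn_integral_expm_min_diff: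
  assumes H[measurable]: "(\<lambda>(u, d). H u d) \<in> borel_measurable (borel \<Otimes>\<^sub>M borel)" and w: "0 < w" "w < 1"
  shows "(\<integral>\<^sup>+i. (\<integral>\<^sup>+j. H (min i j) (i - j) \<partial>expm (1 - w)) \<partial>expm w) =
    (\<integral>\<^sup>+u. (\<integral>\<^sup>+d. diff_density w d * H u d \<partial>lborel) \<partial>expm 1)"
proof -
  define g where "g i j = ennreal (exponential_density w i) * ennreal (exponential_density (1 - w) j)" for i j
  have g[measurable]: "(\<lambda>x. g (f x) (h x)) \<in> borel_measurable N"
    if [measurable]: "f \<in> borel_measurable N" "h \<in> borel_measurable N" for f h and N :: "'z measure"
    unfolding g_def by measurable
  \<comment> \<open>In the coordinates minimum \<open>u\<close> and difference \<open>d\<close> the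
    joint density factorises: the rates sum to 1, so \<open>u\<close> enters only through
    \<open>exp (- u)\<close>.\<close>
  have g_eq: "g (u + max 0 d) (u + max 0 (- d)) = ennreal (exponential_density 1 u) * diff_density w d" for u d
  proof (cases "u < 0")
    case True
    then show ?thesis unfolding g_def by (auto simp: exponential_density_def max_def)
  next
    case False
    have "exp (-(u + max 0 d) * w) * exp (-(u + max 0 (- d)) * (1 - w)) = exp (- u) * exp (- w * max 0 d - (1 - w) * max 0 (- d))"
      unfolding exp_add[symmetric] by (simp add: algebra_simps)
    moreover have "\<not> u + max 0 d < 0" "\<not> u + max 0 (- d) < 0" using False by auto
    ultimately show ?thesis
      using w False unfolding g_def diff_density_def
      by (simp add: exponential_density_def ennreal_mult[symmetric] mult.assoc mult.left_commute)
  qed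
  have "(\<integral>\<^sup>+i. (\<integral>\<^sup>+j. H (min i j) (i - j) \<partial>expm (1 - w)) \<partial>expm w) =
    (\<integral>\<^sup>+i. (\<integral>\<^sup>+j. g i j * H (min i j) (i - j) \<partial>lborel) \<partial>lborel)"
    using w by (simp add: nn_integral_expm sigma_finite_measure.borel_measurable_nn_integral sigma_finite_expm g_def mult.assoc flip: nn_integral_cmult)
  also have "\<dots> = (\<integral>\<^sup>+i. (\<integral>\<^sup>+d. g i (i - d) * H (min i (i - d)) d \<partial>lborel) \<partial>lborel)"
  proof (rule nn_integral_cong)
    fix i :: real
    show "(\<integral>\<^sup>+j. g i j * H (min i j) (i - j) \<partial>lborel) = (\<integral>\<^sup>+d. g i (i - d) * H (min i (i - d)) d \<partial>lborel)"
      by (subst nn_integral_lborel_reflect[where t=i]) auto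
  qed
  also have "\<dots> = (\<integral>\<^sup>+d. (\<integral>\<^sup>+i. g i (i - d) * H (min i (i - d)) d \<partial>lborel) \<partial>lborel)"
    by (rule lborel_pair.Fubini') measurable
  also have "\<dots> = (\<integral>\<^sup>+d. (\<integral>\<^sup>+u. g (u + max 0 d) (u + max 0 (- d)) * H u d \<partial>lborel) \<partial>lborel)"
  proof (rule nn_integral_cong)
    fix d :: real
    have *: "u + max 0 d - d = u + max 0 (- d)" "min (u + max 0 d) (u + max 0 (- d)) = u" for u :: real
      by (auto simp: max_def min_def)
    show "(\<integral>\<^sup>+i. g i (i - d) * H (min i (i - d)) d \<partial>lborel) = (\<integral>\<^sup>+u. g (u + max 0 d) (u + max 0 (- d)) * H u d \<partial>lborel)"
      by (subst nn_integral_lborel_shift[where t="max 0 d"]) (auto simp: *)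
  qed
  also have "\<dots> = (\<integral>\<^sup>+u. (\<integral>\<^sup>+d. g (u + max 0 d) (u + max 0 (- d)) * H u d \<partial>lborel) \<partial>lborel)"
    by (rule lborel_pair.Fubini') measurable
  also have "\<dots> = (\<integral>\<^sup>+u. ennreal (exponential_density 1 u) * (\<integral>\<^sup>+d. diff_density w d * H u d \<partial>lborel) \<partial>lborel)"
    unfolding g_eq by (intro nn_integral_cong) (simp add: mult.assoc nn_integral_cmult)
  also have "\<dots> = (\<integral>\<^sup>+u. (\<integral>\<^sup>+d. diff_density w d * H u d \<partial>lborel) \<partial>expm 1)"
    by (rule nn_integral_expm[symmetric]) measurable
  finally show ?thesis .
qed

text \<open>The corner update keeps the difference \<open>a - y\<close> and replaces the minimum of
  \<open>a\<close> and \<open>y\<close> by the fresh weight \<open>b\<close>. Since that minimum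
  also has rate 1 and is independent of the difference, the pair keeps its law.\<close>

lemma burke_single:
  assumes F[measurable]: "(\<lambda>(u, d). F u d) \<in> borel_measurable (borel \<Otimes>\<^sub>M borel)" and w: "0 < w" "w < 1"
  shows "(\<integral>\<^sup>+y. (\<integral>\<^sup>+a. (\<integral>\<^sup>+b. F (b + max 0 (a - y)) (b + max 0 (y - a)) \<partial>expm 1) \<partial>expm w) \<partial>expm (1 - w)) =
    (\<integral>\<^sup>+a. (\<integral>\<^sup>+y. F a y \<partial>expm (1 - w)) \<partial>expm w)"
proof -
  interpret w: prob_space "expm w" by (rule prob_space_expm) fact
  interpret v: prob_space "expm (1 - w)" by (rule prob_space_expm) (use w in simp)
  interpret e: prob_space "expm 1" by (rule prob_space_expm) simp
  interpret vw: pair_sigma_finite "expm (1 - w)" "expm w" ..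
  interpret ew: pair_sigma_finite "expm 1" "expm w" ..
  interpret we: pair_sigma_finite "expm w" "expm 1" ..
  interpret ve: pair_sigma_finite "expm (1 - w)" "expm 1" ..
  have "(\<integral>\<^sup>+y. (\<integral>\<^sup>+a. (\<integral>\<^sup>+b. F (b + max 0 (a - y)) (b + max 0 (y - a)) \<partial>expm 1) \<partial>expm w) \<partial>expm (1 - w)) =
     (\<integral>\<^sup>+a. (\<integral>\<^sup>+y. (\<integral>\<^sup>+b. F (b + max 0 (a - y)) (b + max 0 (- (a - y))) \<partial>expm 1) \<partial>expm (1 - w)) \<partial>expm w)"
    by (subst vw.Fubini'[symmetric]) auto
  also have "\<dots> = (\<integral>\<^sup>+u. (\<integral>\<^sup>+d. diff_density w d * (\<integral>\<^sup>+b. F (b + max 0 d) (b + max 0 (- d)) \<partial>expm 1) \<partial>lborel) \<partial>expm 1)"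
    by (rule nn_integral_expm_min_diff[where H="\<lambda>u d. \<integral>\<^sup>+b. F (b + max 0 d) (b + max 0 (- d)) \<partial>expm 1"]) (use w in measurable)
  also have "\<dots> = (\<integral>\<^sup>+d. diff_density w d * (\<integral>\<^sup>+b. F (b + max 0 d) (b + max 0 (- d)) \<partial>expm 1) \<partial>lborel)"
    using e.emeasure_space_1 by simp
  also have "\<dots> = (\<integral>\<^sup>+d. (\<integral>\<^sup>+b. diff_density w d * F (b + max 0 d) (b + max 0 (- d)) \<partial>expm 1) \<partial>lborel)"
    by (intro nn_integral_cong nn_integral_cmult[symmetric]) measurable
  also have "\<dots> = (\<integral>\<^sup>+b. (\<integral>\<^sup>+d. diff_density w d * F (b + max 0 d) (b + max 0 (- d)) \<partial>lborel) \<partial>expm 1)"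
    by (rule pair_sigma_finite.Fubini') (auto intro: pair_sigma_finite.intro e.sigma_finite_measure_axioms lborel.sigma_finite_measure_axioms)
  also have "\<dots> = (\<integral>\<^sup>+a. (\<integral>\<^sup>+y. F (min a y + max 0 (a - y)) (min a y + max 0 (- (a - y))) \<partial>expm (1 - w)) \<partial>expm w)"
    by (rule nn_integral_expm_min_diff[where H="\<lambda>b d. F (b + max 0 d) (b + max 0 (- d))", symmetric]) (use w in measurable)
  also have "\<dots> = (\<integral>\<^sup>+a. (\<integral>\<^sup>+y. F a y \<partial>expm (1 - w)) \<partial>expm w)"
    by (intro nn_integral_cong arg_cong2[where f=F]) (auto simp: min_def max_def)
  finally show ?thesis .
qed

section \<open>The Burke property along a row\<close>

text \<open>A Lindley recursion for a queue: \<open>a\<close> holds the horizontal increments of one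
  row, \<open>b\<close> the weights of the next one, and \<open>y\<close> the vertical increment
  entering from the axis. \<open>row_J\<close> are the vertical increments between the two rows,
  \<open>row_I\<close> the horizontal increments of the upper one.\<close>

fun row_J :: "real \<Rightarrow> (nat \<Rightarrow> real) \<Rightarrow> (nat \<Rightarrow> real) \<Rightarrow> nat \<Rightarrow> real" where
  "row_J y a b 0 = y"
| "row_J y a b (Suc i) = b (Suc i) + max 0 (row_J y a b i - a (Suc i))"

definition row_I :: "real \<Rightarrow> (nat \<Rightarrow> real) \<Rightarrow> (nat \<Rightarrow> real) \<Rightarrow> nat \<Rightarrow> real" where
  "row_I y a b i = b i + max 0 (a i - row_J y a b (i - 1))"

lemma row_J_cong: "(\<And>k. k \<in> {1..i} \<Longrightarrow> a k = a' k \<and> b k = b' k) \<Longrightarrow> row_J y a b i = row_J y a' b' i"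
  by (induction i) auto

lemma row_J_measurable:
  assumes "\<And>i. i \<in> {1..k} \<Longrightarrow> (\<lambda>x. A x i) \<in> borel_measurable N"
    and "\<And>i. i \<in> {1..k} \<Longrightarrow> (\<lambda>x. B x i) \<in> borel_measurable N"
    and [measurable]: "Y \<in> borel_measurable N"
  shows "(\<lambda>x. row_J (Y x) (A x) (B x) k) \<in> borel_measurable N"
  using assms(1,2)
proof (induction k)
  case (Suc k)
  have [measurable]: "(\<lambda>x. A x (Suc k)) \<in> borel_measurable N" "(\<lambda>x. B x (Suc k)) \<in> borel_measurable N"
    "(\<lambda>x. row_J (Y x) (A x) (B x) k) \<in> borel_measurable N"
    using Suc by auto
  show ?case by simp
qed simp

definition expv :: "real \<Rightarrow> nat \<Rightarrow> (nat \<Rightarrow> real) measure" where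
  "expv w m = PiM {1..m} (\<lambda>_. expm w)"

lemma sets_expv [measurable_cong]: "sets (expv w m) = sets (PiM {1..m} (\<lambda>_. borel))"
  unfolding expv_def by (intro sets_PiM_cong) auto

lemma space_expv: "space (expv w m) = PiE {1..m} (\<lambda>_. UNIV)"
  unfolding expv_def by (simp add: space_PiM)

lemma prob_space_expv: "0 < w \<Longrightarrow> prob_space (expv w m)"
  unfolding expv_def by (intro prob_space_PiM prob_space_expm)

lemma nn_integral_expv_Suc:
  assumes w: "0 < w" and [measurable]: "f \<in> borel_measurable (PiM {1..Suc m} (\<lambda>_. borel))"
  shows "(\<integral>\<^sup>+a. f a \<partial>expv w (Suc m)) = (\<integral>\<^sup>+a. (\<integral>\<^sup>+x. f (a(Suc m := x)) \<partial>expm w) \<partial>expv w m)"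
proof -
  interpret product_sigma_finite "\<lambda>_::nat. expm w"
    by standard (intro sigma_finite_measure.sigma_finite_countable sigma_finite_expm w)
  have eq: "{1..Suc m} = insert (Suc m) {1..m}" by auto
  have "f \<in> borel_measurable (PiM (insert (Suc m) {1..m}) (\<lambda>_. expm w))"
    using assms(2) unfolding eq by (subst measurable_cong_sets[OF sets_PiM_cong refl]) auto
  then show ?thesis unfolding expv_def eq
    by (subst product_nn_integral_insert) auto
qed

lemma nn_integral_expv_0: "(\<integral>\<^sup>+a. f a \<partial>expv w 0) = f (\<lambda>_. undefined)"
  unfolding expv_def by (simp add: PiM_empty nn_integral_count_space_finite)


lemma PiM_component_measurable:
  assumes "f \<in> measurable N (PiM K (\<lambda>_. borel))" "i \<in> K"
  shows "(\<lambda>x. f x i) \<in> borel_measurable N"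
  using measurable_compose[OF assms(1) measurable_component_singleton[OF assms(2)]] by simp

lemma row_J_vec_measurable [measurable (raw)]:
  assumes "A \<in> measurable N (PiM {1..k'} (\<lambda>_. borel))" "B \<in> measurable N (PiM {1..k'} (\<lambda>_. borel))"
    "Y \<in> borel_measurable N" "k \<le> k'"
  shows "(\<lambda>x. row_J (Y x) (A x) (B x) k) \<in> borel_measurable N"
proof (rule row_J_measurable[OF _ _ assms(3)])
  fix i assume "i \<in> {1..k}"
  then have "i \<in> {1..k'}" using assms(4) by auto
  then show "(\<lambda>x. A x i) \<in> borel_measurable N" "(\<lambda>x. B x i) \<in> borel_measurable N"
    using assms(1,2) by (auto intro: PiM_component_measurable)
qed

lemma row_I_vec_measurable [measurable (raw)]:
  assumes [measurable]: "A \<in> measurable N (PiM {1..k} (\<lambda>_. borel))" "B \<in> measurable N (PiM {1..k} (\<lambda>_. borel))"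
    "Y \<in> borel_measurable N"
  shows "(\<lambda>x. restrict (row_I (Y x) (A x) (B x)) {1..k}) \<in> measurable N (PiM {1..k} (\<lambda>_. borel))"
proof (rule measurable_restrict)
  fix i assume i: "i \<in> {1..k}"
  have [measurable]: "(\<lambda>x. row_J (Y x) (A x) (B x) (i - 1)) \<in> borel_measurable N"
    using i by (intro row_J_vec_measurable[where k'=k] assms) auto
  have [measurable]: "(\<lambda>x. A x i) \<in> borel_measurable N" "(\<lambda>x. B x i) \<in> borel_measurable N"
    using i by (auto intro!: PiM_component_measurable[where K="{1..k}"] assms)
  show "(\<lambda>x. row_I (Y x) (A x) (B x) i) \<in> borel_measurable N" unfolding row_I_def by measurable
qed

lemma vec_snoc_measurable [measurable (raw)]:
  assumes "f \<in> measurable N (PiM {1..m} (\<lambda>_. borel))" "h \<in> borel_measurable N"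
  shows "(\<lambda>x. (f x)(Suc m := h x)) \<in> measurable N (PiM {1..Suc m} (\<lambda>_. borel))"
  by (rule measurable_fun_upd[OF _ assms]) auto

text \<open>Induction over the columns: the vertical increment leaving the first \<open>m\<close>
  columns enters the last one, where the single-corner update applies. For this to chain, the
  outgoing vertical increment has to appear in \<open>\<Psi>\<close> together with the new
  row.\<close>

lemma burke_row:
  assumes \<Psi>: "(\<lambda>(r, j). \<Psi> r j) \<in> borel_measurable (PiM {1..m} (\<lambda>_. borel) \<Otimes>\<^sub>M borel)" and w: "0 < w" "w < 1"
  shows "(\<integral>\<^sup>+b. (\<integral>\<^sup>+a. (\<integral>\<^sup>+y. \<Psi> (restrict (row_I y a b) {1..m}) (row_J y a b m) \<partial>expm (1 - w)) \<partial>expv w m) \<partial>expv 1 m) =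
    (\<integral>\<^sup>+a. (\<integral>\<^sup>+y. \<Psi> a y \<partial>expm (1 - w)) \<partial>expv w m)"
  using \<Psi>
proof (induction m arbitrary: \<Psi>)
  case 0
  then show ?case
    using prob_space.emeasure_space_1[OF prob_space_expv[of w 0]] prob_space.emeasure_space_1[OF prob_space_expv[of 1 0]] w
    by (simp add: nn_integral_expv_0 restrict_def)
next
  case (Suc m)
  note [measurable] = Suc.prems
  interpret w: prob_space "expm w" by (rule prob_space_expm) fact
  interpret v: prob_space "expm (1 - w)" by (rule prob_space_expm) (use w in simp)
  interpret e: prob_space "expm 1" by (rule prob_space_expm) simp
  interpret wm: prob_space "expv w m" by (rule prob_space_expv) fact
  interpret em: prob_space "expv 1 m" by (rule prob_space_expv) simp
  interpret wS: prob_space "expv w (Suc m)" by (rule prob_space_expv) fact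
  interpret eS: prob_space "expv 1 (Suc m)" by (rule prob_space_expv) simp
  define R where "R y a b = restrict (row_I y a b) {1..m}" for y a b
  define T where "T y a b = row_J y a b m" for y a b
  have R[measurable (raw)]: "(\<lambda>x. R (Y x) (A x) (B x)) \<in> measurable N (PiM {1..m} (\<lambda>_. borel))"
    if "A \<in> measurable N (PiM {1..m} (\<lambda>_. borel))" "B \<in> measurable N (PiM {1..m} (\<lambda>_. borel))" "Y \<in> borel_measurable N"
    for A B :: "'z \<Rightarrow> nat \<Rightarrow> real" and Y N
    unfolding R_def using that by (rule row_I_vec_measurable)
  have T[measurable (raw)]: "(\<lambda>x. T (Y x) (A x) (B x)) \<in> borel_measurable N"
    if "A \<in> measurable N (PiM {1..m} (\<lambda>_. borel))" "B \<in> measurable N (PiM {1..m} (\<lambda>_. borel))" "Y \<in> borel_measurable N"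
    for A B :: "'z \<Rightarrow> nat \<Rightarrow> real" and Y N
    unfolding T_def using that by (rule row_J_vec_measurable) simp
  define Q where "Q r j x u = \<Psi> (r(Suc m := u + max 0 (x - j))) (u + max 0 (j - x))" for r j x u
  have Q[measurable (raw)]: "(\<lambda>z. Q (f z) (g z) (h z) (k z)) \<in> borel_measurable N"
    if [measurable]: "f \<in> measurable N (PiM {1..m} (\<lambda>_. borel))" "g \<in> borel_measurable N" "h \<in> borel_measurable N" "k \<in> borel_measurable N"
    for f :: "'z \<Rightarrow> nat \<Rightarrow> real" and g h k N
    unfolding Q_def by measurable
  have step: "\<Psi> (restrict (row_I y (a(Suc m := x)) (b(Suc m := u))) {1..Suc m}) (row_J y (a(Suc m := x)) (b(Suc m := u)) (Suc m))
     = Q (R y a b) (T y a b) x u" for y a b x u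
  proof -
    have eq: "row_J y (a(Suc m := x)) (b(Suc m := u)) i = row_J y a b i" if "i \<le> m" for i
      using that by (intro row_J_cong) auto
    have "restrict (row_I y (a(Suc m := x)) (b(Suc m := u))) {1..Suc m} = (R y a b)(Suc m := u + max 0 (x - T y a b))"
      unfolding R_def T_def by (auto simp: fun_eq_iff restrict_def row_I_def eq)
    moreover have "row_J y (a(Suc m := x)) (b(Suc m := u)) (Suc m) = u + max 0 (T y a b - x)"
      using eq[of m] by (simp add: T_def)
    ultimately show ?thesis by (simp add: Q_def)
  qed
  have "(\<integral>\<^sup>+b. (\<integral>\<^sup>+a. (\<integral>\<^sup>+y. \<Psi> (restrict (row_I y a b) {1..Suc m}) (row_J y a b (Suc m)) \<partial>expm (1 - w)) \<partial>expv w (Suc m)) \<partial>expv 1 (Suc m)) =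
    (\<integral>\<^sup>+b. (\<integral>\<^sup>+u. (\<integral>\<^sup>+a. (\<integral>\<^sup>+y. \<Psi> (restrict (row_I y a (b(Suc m := u))) {1..Suc m}) (row_J y a (b(Suc m := u)) (Suc m)) \<partial>expm (1 - w)) \<partial>expv w (Suc m)) \<partial>expm 1) \<partial>expv 1 m)"
    by (rule nn_integral_expv_Suc) (simp, measurable)
  also have "\<dots> = (\<integral>\<^sup>+b. (\<integral>\<^sup>+u. (\<integral>\<^sup>+a. (\<integral>\<^sup>+x. (\<integral>\<^sup>+y. Q (R y a b) (T y a b) x u \<partial>expm (1 - w)) \<partial>expm w) \<partial>expv w m) \<partial>expm 1) \<partial>expv 1 m)"
  proof (intro nn_integral_cong)
    fix b u assume b: "b \<in> space (expv 1 m)"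
    then have [measurable]: "(\<lambda>_. b) \<in> measurable N (PiM {1..m} (\<lambda>_. borel))" for N :: "'z measure"
      by (auto simp: space_expv space_PiM)
    show "(\<integral>\<^sup>+a. (\<integral>\<^sup>+y. \<Psi> (restrict (row_I y a (b(Suc m := u))) {1..Suc m}) (row_J y a (b(Suc m := u)) (Suc m)) \<partial>expm (1 - w)) \<partial>expv w (Suc m))
       = (\<integral>\<^sup>+a. (\<integral>\<^sup>+x. (\<integral>\<^sup>+y. Q (R y a b) (T y a b) x u \<partial>expm (1 - w)) \<partial>expm w) \<partial>expv w m)"
      unfolding step[symmetric] by (rule nn_integral_expv_Suc) (use w in \<open>simp, measurable\<close>)
  qed
  \<comment> \<open>The exchanges of integrals move the last weight \<open>u\<close> and the last
    increment \<open>x\<close> inside the integral over \<open>y\<close>, so that the induction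
    hypothesis sees a functional of the first \<open>m\<close> columns.\<close>
  also have "\<dots> = (\<integral>\<^sup>+b. (\<integral>\<^sup>+a. (\<integral>\<^sup>+u. (\<integral>\<^sup>+y. (\<integral>\<^sup>+x. Q (R y a b) (T y a b) x u \<partial>expm w) \<partial>expm (1 - w)) \<partial>expm 1) \<partial>expv w m) \<partial>expv 1 m)"
  proof (intro nn_integral_cong)
    fix b assume b: "b \<in> space (expv 1 m)"
    then have [measurable]: "(\<lambda>_. b) \<in> measurable N (PiM {1..m} (\<lambda>_. borel))" for N :: "'z measure"
      by (auto simp: space_expv space_PiM)
    have "(\<integral>\<^sup>+u. (\<integral>\<^sup>+a. (\<integral>\<^sup>+x. (\<integral>\<^sup>+y. Q (R y a b) (T y a b) x u \<partial>expm (1 - w)) \<partial>expm w) \<partial>expv w m) \<partial>expm 1) =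
      (\<integral>\<^sup>+a. (\<integral>\<^sup>+u. (\<integral>\<^sup>+x. (\<integral>\<^sup>+y. Q (R y a b) (T y a b) x u \<partial>expm (1 - w)) \<partial>expm w) \<partial>expm 1) \<partial>expv w m)"
      by (rule pair_sigma_finite.Fubini') (auto intro!: pair_sigma_finite.intro e.sigma_finite_measure_axioms wm.sigma_finite_measure_axioms)
    also have "\<dots> = (\<integral>\<^sup>+a. (\<integral>\<^sup>+u. (\<integral>\<^sup>+y. (\<integral>\<^sup>+x. Q (R y a b) (T y a b) x u \<partial>expm w) \<partial>expm (1 - w)) \<partial>expm 1) \<partial>expv w m)"
    proof (intro nn_integral_cong)
      fix a u assume "a \<in> space (expv w m)"
      then have [measurable]: "(\<lambda>_. a) \<in> measurable N (PiM {1..m} (\<lambda>_. borel))" for N :: "'z measure"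
        by (auto simp: space_expv space_PiM)
      show "(\<integral>\<^sup>+x. (\<integral>\<^sup>+y. Q (R y a b) (T y a b) x u \<partial>expm (1 - w)) \<partial>expm w) = (\<integral>\<^sup>+y. (\<integral>\<^sup>+x. Q (R y a b) (T y a b) x u \<partial>expm w) \<partial>expm (1 - w))"
        by (rule pair_sigma_finite.Fubini') (auto intro!: pair_sigma_finite.intro v.sigma_finite_measure_axioms w.sigma_finite_measure_axioms)
    qed
    finally show "(\<integral>\<^sup>+u. (\<integral>\<^sup>+a. (\<integral>\<^sup>+x. (\<integral>\<^sup>+y. Q (R y a b) (T y a b) x u \<partial>expm (1 - w)) \<partial>expm w) \<partial>expv w m) \<partial>expm 1) =
       (\<integral>\<^sup>+a. (\<integral>\<^sup>+u. (\<integral>\<^sup>+y. (\<integral>\<^sup>+x. Q (R y a b) (T y a b) x u \<partial>expm w) \<partial>expm (1 - w)) \<partial>expm 1) \<partial>expv w m)" .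
  qed
  also have "\<dots> = (\<integral>\<^sup>+b. (\<integral>\<^sup>+a. (\<integral>\<^sup>+y. (\<integral>\<^sup>+x. (\<integral>\<^sup>+u. Q (R y a b) (T y a b) x u \<partial>expm 1) \<partial>expm w) \<partial>expm (1 - w)) \<partial>expv w m) \<partial>expv 1 m)"
  proof (intro nn_integral_cong)
    fix b a assume b: "b \<in> space (expv 1 m)" and a: "a \<in> space (expv w m)"
    have [measurable]: "(\<lambda>_. b) \<in> measurable N (PiM {1..m} (\<lambda>_. borel))" for N :: "'z measure"
      using b by (auto simp: space_expv space_PiM)
    have [measurable]: "(\<lambda>_. a) \<in> measurable N (PiM {1..m} (\<lambda>_. borel))" for N :: "'z measure"
      using a by (auto simp: space_expv space_PiM)
    have "(\<integral>\<^sup>+u. (\<integral>\<^sup>+y. (\<integral>\<^sup>+x. Q (R y a b) (T y a b) x u \<partial>expm w) \<partial>expm (1 - w)) \<partial>expm 1) =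
      (\<integral>\<^sup>+y. (\<integral>\<^sup>+u. (\<integral>\<^sup>+x. Q (R y a b) (T y a b) x u \<partial>expm w) \<partial>expm 1) \<partial>expm (1 - w))"
      by (rule pair_sigma_finite.Fubini') (auto intro!: pair_sigma_finite.intro e.sigma_finite_measure_axioms v.sigma_finite_measure_axioms)
    also have "\<dots> = (\<integral>\<^sup>+y. (\<integral>\<^sup>+x. (\<integral>\<^sup>+u. Q (R y a b) (T y a b) x u \<partial>expm 1) \<partial>expm w) \<partial>expm (1 - w))"
    proof (rule nn_integral_cong)
      fix y
      have [measurable]: "(\<lambda>_. R y a b) \<in> measurable N (PiM {1..m} (\<lambda>_. borel))" for N :: "'z measure"
        by (auto simp: space_PiM R_def)
      show "(\<integral>\<^sup>+u. (\<integral>\<^sup>+x. Q (R y a b) (T y a b) x u \<partial>expm w) \<partial>expm 1) = (\<integral>\<^sup>+x. (\<integral>\<^sup>+u. Q (R y a b) (T y a b) x u \<partial>expm 1) \<partial>expm w)"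
        by (rule pair_sigma_finite.Fubini') (auto intro!: pair_sigma_finite.intro e.sigma_finite_measure_axioms w.sigma_finite_measure_axioms)
    qed
    finally show "(\<integral>\<^sup>+u. (\<integral>\<^sup>+y. (\<integral>\<^sup>+x. Q (R y a b) (T y a b) x u \<partial>expm w) \<partial>expm (1 - w)) \<partial>expm 1) =
       (\<integral>\<^sup>+y. (\<integral>\<^sup>+x. (\<integral>\<^sup>+u. Q (R y a b) (T y a b) x u \<partial>expm 1) \<partial>expm w) \<partial>expm (1 - w))" .
  qed
  also have "\<dots> = (\<integral>\<^sup>+a. (\<integral>\<^sup>+y. (\<integral>\<^sup>+x. (\<integral>\<^sup>+u. Q a y x u \<partial>expm 1) \<partial>expm w) \<partial>expm (1 - w)) \<partial>expv w m)"
    unfolding R_def T_def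
    by (rule Suc.IH[where \<Psi>="\<lambda>a y. (\<integral>\<^sup>+x. (\<integral>\<^sup>+u. Q a y x u \<partial>expm 1) \<partial>expm w)"]) measurable
  also have "\<dots> = (\<integral>\<^sup>+a. (\<integral>\<^sup>+x. (\<integral>\<^sup>+y. \<Psi> (a(Suc m := x)) y \<partial>expm (1 - w)) \<partial>expm w) \<partial>expv w m)"
  proof (rule nn_integral_cong)
    fix a assume a: "a \<in> space (expv w m)"
    have [measurable]: "(\<lambda>_. a) \<in> measurable N (PiM {1..m} (\<lambda>_. borel))" for N :: "'z measure"
      using a by (auto simp: space_expv space_PiM)
    show "(\<integral>\<^sup>+y. (\<integral>\<^sup>+x. (\<integral>\<^sup>+u. Q a y x u \<partial>expm 1) \<partial>expm w) \<partial>expm (1 - w)) = (\<integral>\<^sup>+x. (\<integral>\<^sup>+y. \<Psi> (a(Suc m := x)) y \<partial>expm (1 - w)) \<partial>expm w)"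
      unfolding Q_def by (rule burke_single[where F="\<lambda>x y. \<Psi> (a(Suc m := x)) y"]) (use w in measurable)
  qed
  also have "\<dots> = (\<integral>\<^sup>+a. (\<integral>\<^sup>+y. \<Psi> a y \<partial>expm (1 - w)) \<partial>expv w (Suc m))"
    by (rule nn_integral_expv_Suc[symmetric]) (use w in measurable)
  finally show ?case .
qed

section \<open>Independent exponential fields\<close>

lemma (in prob_space) nn_integral_indep_var:
  assumes ind: "indep_var S U T V" and F[measurable]: "F \<in> borel_measurable (S \<Otimes>\<^sub>M T)"
  shows "(\<integral>\<^sup>+x. F (U x, V x) \<partial>M) = (\<integral>\<^sup>+x. (\<integral>\<^sup>+v. F (U x, v) \<partial>distr M T V) \<partial>M)"
proof -
  have [measurable]: "U \<in> measurable M S" "V \<in> measurable M T"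
    using ind by (auto dest: indep_var_rv1 indep_var_rv2)
  interpret V: prob_space "distr M T V" by (rule prob_space_distr) measurable
  have "(\<integral>\<^sup>+x. F (U x, V x) \<partial>M) = (\<integral>\<^sup>+p. F p \<partial>distr M (S \<Otimes>\<^sub>M T) (\<lambda>x. (U x, V x)))"
    by (subst nn_integral_distr) auto
  also have "distr M (S \<Otimes>\<^sub>M T) (\<lambda>x. (U x, V x)) = distr M S U \<Otimes>\<^sub>M distr M T V"
    using ind by (simp add: indep_var_distribution_eq)
  also have "(\<integral>\<^sup>+p. F p \<partial>(distr M S U \<Otimes>\<^sub>M distr M T V)) = (\<integral>\<^sup>+u. (\<integral>\<^sup>+v. F (u, v) \<partial>distr M T V) \<partial>distr M S U)"
    by (subst V.nn_integral_fst[symmetric]) auto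
  also have "\<dots> = (\<integral>\<^sup>+x. (\<integral>\<^sup>+v. F (U x, v) \<partial>distr M T V) \<partial>M)"
    by (subst nn_integral_distr) auto
  finally show ?thesis .
qed

lemma (in prob_space) indep_vars_reindex:
  assumes ind: "indep_vars M' X I" and inj: "inj_on e K" and sub: "e ` K \<subseteq> I"
  shows "indep_vars (\<lambda>k. M' (e k)) (\<lambda>k. X (e k)) K"
proof -
  have rv: "\<And>i. i \<in> I \<Longrightarrow> random_variable (M' i) (X i)"
    and isets: "indep_sets (\<lambda>i. {X i -` A \<inter> space M |A. A \<in> sets (M' i)}) I"
    using ind unfolding indep_vars_def2 by auto
  have "indep_sets (\<lambda>k. {X (e k) -` A \<inter> space M |A. A \<in> sets (M' (e k))}) K"
  proof (rule indep_setsI)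
    fix k assume "k \<in> K"
    then show "{X (e k) -` A \<inter> space M |A. A \<in> sets (M' (e k))} \<subseteq> events"
      using rv[of "e k"] sub by (auto intro: measurable_sets)
  next
    fix A J assume J: "J \<noteq> {}" "J \<subseteq> K" "finite J" and A: "\<forall>j\<in>J. A j \<in> {X (e j) -` A \<inter> space M |A. A \<in> sets (M' (e j))}"
    define A' where "A' i = A (the_inv_into J e i)" for i
    have injJ: "inj_on e J" using inj J by (auto intro: inj_on_subset)
    have A': "A' (e j) = A j" if "j \<in> J" for j
      using the_inv_into_f_f[OF injJ that] by (simp add: A'_def)
    have "prob (\<Inter>i\<in>e ` J. A' i) = (\<Prod>i\<in>e ` J. prob (A' i))"
    proof (rule indep_setsD[OF isets])
      show "e ` J \<subseteq> I" using J sub by auto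
      show "\<forall>i\<in>e ` J. A' i \<in> {X i -` A \<inter> space M |A. A \<in> sets (M' i)}"
        using A A' by auto
    qed (use J in auto)
    also have "(\<Inter>i\<in>e ` J. A' i) = (\<Inter>j\<in>J. A j)" using A' by auto
    also have "(\<Prod>i\<in>e ` J. prob (A' i)) = (\<Prod>j\<in>J. prob (A j))"
      using A' by (subst prod.reindex[OF injJ]) (auto intro: prod.cong)
    finally show "prob (\<Inter>j\<in>J. A j) = (\<Prod>j\<in>J. prob (A j))" .
  qed
  then show ?thesis using rv sub unfolding indep_vars_def2 by auto
qed

text \<open>The indices include the axes, whose rescaled weights form the boundary. Nonnegativity
  holds everywhere rather than almost surely, so pathwise comparisons have no exceptional
  sets.\<close>

locale exp_field = prob_space M for M :: "'a measure" +
  fixes X :: "nat \<Rightarrow> nat \<Rightarrow> 'a \<Rightarrow> real"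
  assumes indep: "indep_vars (\<lambda>_. borel) (\<lambda>(i, j). X i j) UNIV"
    and law: "\<And>i j. distr M borel (X i j) = expm 1"
    and nonneg: "\<And>i j x. 0 \<le> X i j x"
begin

lemma X_measurable [measurable]: "X i j \<in> borel_measurable M"
  using indep unfolding indep_vars_def2 by (auto dest: bspec[of _ _ "(i, j)"])

text \<open>Transposition, shift and box reversal are injective relabellings of the sites, so each
  yields a field to which all results about fields apply again.\<close>

lemma exp_field_reindex:
  assumes "inj e"
  shows "exp_field M (\<lambda>i j. X (fst (e (i, j))) (snd (e (i, j))))"
proof
  have "indep_vars (\<lambda>k. borel) (\<lambda>k. (\<lambda>(i, j). X i j) (e k)) UNIV"
    by (rule indep_vars_reindex[OF indep assms]) simp
  moreover have "(\<lambda>k. (\<lambda>(i, j). X i j) (e k)) = (\<lambda>(i, j). X (fst (e (i, j))) (snd (e (i, j))))"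
    by (auto simp: fun_eq_iff split_beta)
  ultimately show "indep_vars (\<lambda>_. borel) (\<lambda>(i, j). X (fst (e (i, j))) (snd (e (i, j)))) UNIV" by simp
qed (auto simp: law nonneg)

lemma vector_law:
  assumes inj: "inj_on e S" and S: "S \<noteq> {}"
  shows "distr M (PiM S (\<lambda>_. borel)) (\<lambda>x. \<lambda>s\<in>S. X (fst (e s)) (snd (e s)) x) = PiM S (\<lambda>_. expm 1)"
proof -
  have "indep_vars (\<lambda>k. borel) (\<lambda>k. (\<lambda>(i, j). X i j) (e k)) S"
    by (rule indep_vars_reindex[OF indep inj]) simp
  then have "indep_vars (\<lambda>k. borel) (\<lambda>k. X (fst (e k)) (snd (e k))) S"
    by (simp add: split_beta)
  then have "distr M (PiM S (\<lambda>_. borel)) (\<lambda>x. \<lambda>s\<in>S. X (fst (e s)) (snd (e s)) x) = PiM S (\<lambda>s. distr M borel (X (fst (e s)) (snd (e s))))"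
    by (subst (asm) indep_vars_iff_distr_eq_PiM') (auto simp: S)
  then show ?thesis by (simp add: law)
qed

end


lemma bl_measurable:
  assumes "\<And>k l. k \<le> i \<Longrightarrow> l \<le> j \<Longrightarrow> (\<lambda>x. W x k l) \<in> borel_measurable N"
  shows "(\<lambda>x. bl p q (W x) i j) \<in> borel_measurable N"
  using assms
proof (induction "i + j" arbitrary: i j rule: less_induct)
  case less
  have W: "(\<lambda>x. W x i j) \<in> borel_measurable N" using less.prems by auto
  have IH: "(\<lambda>x. bl p q (W x) i' j') \<in> borel_measurable N" if "i' + j' < i + j" "i' \<le> i" "j' \<le> j" for i' j'
    using that less.prems by (intro less.hyps) auto
  show ?case
  proof (cases i)
    case 0
    then show ?thesis using IH[of 0 "j - 1"] W by (cases j) auto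
  next
    case (Suc i')
    then show ?thesis using IH[of i' j] IH[of i "j - 1"] W by (cases j) auto
  qed
qed

text \<open>The corner recursion read as the queueing update, with the scaled axis weight of the new
  row as incoming vertical increment.\<close>

lemma bl_row_increments:
  fixes p q W n
  defines "a \<equiv> \<lambda>i. bl p q W i n - bl p q W (i - 1) n"
  shows "bl p q W i (Suc n) - bl p q W i n = row_J (q * W 0 (Suc n)) a (\<lambda>i. W i (Suc n)) i" (is "?J i")
    and "1 \<le> i \<Longrightarrow> bl p q W i (Suc n) - bl p q W (i - 1) (Suc n) = row_I (q * W 0 (Suc n)) a (\<lambda>i. W i (Suc n)) i"
proof -
  have J: "?J i" for i
  proof (induction i)
    case (Suc i)
    then show ?case by (simp add: a_def max_def)
  qed simp
  then show "?J i" .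
  show "bl p q W i (Suc n) - bl p q W (i - 1) (Suc n) = row_I (q * W 0 (Suc n)) a (\<lambda>i. W i (Suc n)) i" if i: "1 \<le> i"
  proof -
    obtain k where "i = Suc k" using i by (cases i) auto
    then show ?thesis using J[of k] by (simp add: row_I_def a_def max_def)
  qed
qed

lemma row_I_cong: "(\<And>k. k \<in> {1..i} \<Longrightarrow> a k = a' k \<and> b k = b' k) \<Longrightarrow> 1 \<le> i \<Longrightarrow> row_I y a b i = row_I y a' b' i"
  unfolding row_I_def by (subst row_J_cong[where a'=a' and b'=b']) auto

lemma nn_integral_expv_scale:
  assumes w: "0 < w" and "\<Phi> \<in> borel_measurable (PiM {1..m} (\<lambda>_. borel))"
  shows "(\<integral>\<^sup>+a. \<Phi> (\<lambda>i\<in>{1..m}. a i / w) \<partial>expv 1 m) = (\<integral>\<^sup>+a. \<Phi> a \<partial>expv w m)"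
  using assms(2)
proof (induction m arbitrary: \<Phi>)
  case 0
  then show ?case using prob_space.emeasure_space_1[OF prob_space_expv[of 1 0]]
    by (simp add: nn_integral_expv_0 restrict_def)
next
  case (Suc m)
  note [measurable] = Suc.prems
  interpret w: prob_space "expm w" by (rule prob_space_expm) fact
  have "(\<lambda>a. (\<lambda>i\<in>{1..Suc m}. a i / w)) \<in> measurable (PiM {1..Suc m} (\<lambda>_. borel)) (PiM {1..Suc m} (\<lambda>_. borel))"
    by (rule measurable_restrict) measurable
  then have [measurable]: "(\<lambda>a. \<Phi> (\<lambda>i\<in>{1..Suc m}. a i / w)) \<in> borel_measurable (PiM {1..Suc m} (\<lambda>_. borel))"
    by measurable
  have "(\<integral>\<^sup>+a. \<Phi> (\<lambda>i\<in>{1..Suc m}. a i / w) \<partial>expv 1 (Suc m)) =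
    (\<integral>\<^sup>+a. (\<integral>\<^sup>+x. \<Phi> (\<lambda>i\<in>{1..Suc m}. (a(Suc m := x)) i / w) \<partial>expm 1) \<partial>expv 1 m)"
    by (rule nn_integral_expv_Suc) (simp, measurable)
  also have "\<dots> = (\<integral>\<^sup>+a. (\<integral>\<^sup>+x. \<Phi> ((\<lambda>i\<in>{1..m}. a i / w)(Suc m := x / w)) \<partial>expm 1) \<partial>expv 1 m)"
    by (intro nn_integral_cong arg_cong[where f=\<Phi>]) (auto simp: fun_eq_iff restrict_def)
  also have "\<dots> = (\<integral>\<^sup>+a. (\<integral>\<^sup>+x. \<Phi> ((\<lambda>i\<in>{1..m}. a i / w)(Suc m := x)) \<partial>expm w) \<partial>expv 1 m)"
  proof (intro nn_integral_cong nn_integral_expm_scale w)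
    fix a :: "nat \<Rightarrow> real"
    have [measurable]: "(\<lambda>_. (\<lambda>i\<in>{1..m}. a i / w)) \<in> measurable borel (PiM {1..m} (\<lambda>_. borel))"
      by (auto simp: space_PiM)
    show "(\<lambda>x. \<Phi> ((\<lambda>i\<in>{1..m}. a i / w)(Suc m := x))) \<in> borel_measurable borel" by measurable
  qed
  also have "\<dots> = (\<integral>\<^sup>+a. (\<integral>\<^sup>+x. \<Phi> (a(Suc m := x)) \<partial>expm w) \<partial>expv w m)"
    by (rule Suc.IH[where \<Phi>="\<lambda>a. \<integral>\<^sup>+x. \<Phi> (a(Suc m := x)) \<partial>expm w"]) measurable
  also have "\<dots> = (\<integral>\<^sup>+a. \<Phi> a \<partial>expv w (Suc m))"
    by (rule nn_integral_expv_Suc[symmetric]) (use w Suc.prems in \<open>simp_all only:\<close>)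
  finally show ?case .
qed

lemma nn_integral_PiM_insert_0:
  assumes f: "f \<in> borel_measurable (PiM {0..m} (\<lambda>_. borel))"
  shows "(\<integral>\<^sup>+v. f v \<partial>PiM {0..m} (\<lambda>_. expm 1)) = (\<integral>\<^sup>+b. (\<integral>\<^sup>+y. f (b(0 := y)) \<partial>expm 1) \<partial>expv 1 m)"
proof -
  interpret product_sigma_finite "\<lambda>_::nat. expm 1"
    by standard (intro sigma_finite_measure.sigma_finite_countable sigma_finite_expm, simp)
  have eq: "{0..m} = insert 0 {1..m}" by auto
  have "f \<in> borel_measurable (PiM (insert 0 {1..m}) (\<lambda>_. expm 1))"
    using f unfolding eq by (subst measurable_cong_sets[OF sets_PiM_cong refl]) auto
  then show ?thesis unfolding expv_def eq
    by (subst product_nn_integral_insert) auto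
qed

context exp_field begin

abbreviation Lx :: "real \<Rightarrow> real \<Rightarrow> nat \<Rightarrow> nat \<Rightarrow> 'a \<Rightarrow> real" where
  "Lx p q i j x \<equiv> bl p q (\<lambda>k l. X k l x) i j"

lemma Lx_measurable [measurable]: "Lx p q i j \<in> borel_measurable M"
  by (rule bl_measurable) measurable

definition top_row :: "real \<Rightarrow> real \<Rightarrow> nat \<Rightarrow> nat \<Rightarrow> 'a \<Rightarrow> nat \<Rightarrow> real" where
  "top_row p q m n x = (\<lambda>i\<in>{1..m}. Lx p q i n x - Lx p q (i - 1) n x)"

lemma top_row_measurable [measurable]: "top_row p q m n \<in> measurable M (PiM {1..m} (\<lambda>_. borel))"
  unfolding top_row_def by (rule measurable_restrict) measurable

text \<open>The rows up to \<open>n\<close> and row \<open>Suc n\<close> use disjoint sets of sites.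
  The axis value \<open>Lx p q 0 n\<close> is kept beside the row because it appears in the
  exponential weight of the tilted identity.\<close>

lemma nn_integral_next_row:
  assumes F[measurable]: "F \<in> borel_measurable ((borel \<Otimes>\<^sub>M PiM {1..m} (\<lambda>_. borel)) \<Otimes>\<^sub>M PiM {0..m} (\<lambda>_. borel))"
  shows "(\<integral>\<^sup>+x. F ((Lx p q 0 n x, top_row p q m n x), \<lambda>i\<in>{0..m}. X i (Suc n) x) \<partial>M) =
    (\<integral>\<^sup>+x. (\<integral>\<^sup>+v. F ((Lx p q 0 n x, top_row p q m n x), v) \<partial>PiM {0..m} (\<lambda>_. expm 1)) \<partial>M)"
proof -
  define A where "A = {0..m} \<times> {0..n}"
  define B where "B = {0..m} \<times> {Suc n}"
  define f where "f g = (bl p q (\<lambda>i j. g (i, j)) 0 n, \<lambda>i\<in>{1..m}. bl p q (\<lambda>i j. g (i, j)) i n - bl p q (\<lambda>i j. g (i, j)) (i - 1) n)"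
    for g :: "nat \<times> nat \<Rightarrow> real"
  define h where "h g = (\<lambda>i\<in>{0..m}. g (i, Suc n))" for g :: "nat \<times> nat \<Rightarrow> real"
  have ind: "indep_var (PiM A (\<lambda>_. borel)) (\<lambda>x. restrict (\<lambda>k. (case k of (i, j) \<Rightarrow> X i j) x) A)
      (PiM B (\<lambda>_. borel)) (\<lambda>x. restrict (\<lambda>k. (case k of (i, j) \<Rightarrow> X i j) x) B)"
    by (rule indep_var_restrict[OF indep]) (auto simp: A_def B_def)
  have bl_meas: "(\<lambda>g. bl p q (\<lambda>i j. g (i, j)) i n) \<in> borel_measurable (PiM A (\<lambda>_. borel))" if "i \<le> m" for i
    using that by (intro bl_measurable measurable_component_singleton) (auto simp: A_def)
  have f[measurable]: "f \<in> measurable (PiM A (\<lambda>_. borel)) (borel \<Otimes>\<^sub>M PiM {1..m} (\<lambda>_. borel))"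
    unfolding f_def by (intro measurable_Pair measurable_restrict borel_measurable_diff bl_meas) auto
  have h[measurable]: "h \<in> measurable (PiM B (\<lambda>_. borel)) (PiM {0..m} (\<lambda>_. borel))"
    unfolding h_def by (intro measurable_restrict measurable_component_singleton) (auto simp: B_def)
  have eq: "bl p q (\<lambda>i j. restrict (\<lambda>k. (case k of (i, j) \<Rightarrow> X i j) x) A (i, j)) i n = Lx p q i n x" if "i \<le> m" for i x
    using that by (intro bl_cong) (auto simp: A_def)
  let ?U = "\<lambda>x. restrict (\<lambda>k. (case k of (i, j) \<Rightarrow> X i j) x) A"
  let ?V = "\<lambda>x. restrict (\<lambda>k. (case k of (i, j) \<Rightarrow> X i j) x) B"
  have [measurable]: "?V \<in> measurable M (PiM B (\<lambda>_. borel))"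
    using indep_var_rv2[OF ind] .
  have fU: "f (?U x) = (Lx p q 0 n x, top_row p q m n x)" for x
    by (auto simp: f_def top_row_def fun_eq_iff eq restrict_def[of _ "{Suc 0..m}"] simp del: restrict_apply)
  have hV: "h (?V x) = (\<lambda>i\<in>{0..m}. X i (Suc n) x)" for x
    by (auto simp: h_def B_def fun_eq_iff)
  have hlaw: "distr (distr M (PiM B (\<lambda>_. borel)) ?V) (PiM {0..m} (\<lambda>_. borel)) h = PiM {0..m} (\<lambda>_. expm 1)"
    using vector_law[of "\<lambda>i. (i, Suc n)" "{0..m}"] by (subst distr_distr) (auto simp: inj_on_def comp_def hV)
  have "(\<integral>\<^sup>+x. F ((Lx p q 0 n x, top_row p q m n x), \<lambda>i\<in>{0..m}. X i (Suc n) x) \<partial>M) =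
    (\<integral>\<^sup>+x. (\<lambda>(u, v). F (f u, h v)) (?U x, ?V x) \<partial>M)"
    by (simp add: fU hV del: One_nat_def)
  also have "\<dots> = (\<integral>\<^sup>+x. (\<integral>\<^sup>+v. (\<lambda>(u, v). F (f u, h v)) (?U x, v) \<partial>distr M (PiM B (\<lambda>_. borel)) ?V) \<partial>M)"
    by (rule nn_integral_indep_var[OF ind]) measurable
  also have "\<dots> = (\<integral>\<^sup>+x. (\<integral>\<^sup>+v. F ((Lx p q 0 n x, top_row p q m n x), v) \<partial>PiM {0..m} (\<lambda>_. expm 1)) \<partial>M)"
  proof (rule nn_integral_cong)
    fix x
    have "f (?U x) \<in> space (borel \<Otimes>\<^sub>M PiM {1..m} (\<lambda>_. borel))"
      unfolding fU by (auto simp: space_pair_measure space_PiM top_row_def)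
    then have [measurable]: "(\<lambda>v. F (f (?U x), v)) \<in> borel_measurable (PiM {0..m} (\<lambda>_. borel))"
      by (intro measurable_compose[OF measurable_Pair1' F])
    show "(\<integral>\<^sup>+v. (\<lambda>(u, v). F (f u, h v)) (?U x, v) \<partial>distr M (PiM B (\<lambda>_. borel)) ?V) =
      (\<integral>\<^sup>+v. F ((Lx p q 0 n x, top_row p q m n x), v) \<partial>PiM {0..m} (\<lambda>_. expm 1))"
      unfolding hlaw[symmetric] fU[symmetric] prod.case
      by (rule nn_integral_distr[where f="\<lambda>v. F (f (?U x), v)", symmetric]) measurable
  qed
  finally show ?thesis .
qed

text \<open>The exponential of \<open>w - z\<close> times the passage time on the vertical axis
  changes the rate of each of the \<open>n\<close> axis weights from \<open>1 - z\<close> to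
  \<open>1 - w\<close> and costs \<open>(1 - z) / (1 - w)\<close> each time. Under the tilted
  weights the boundary is stationary with parameter \<open>w\<close>, so the Burke property keeps
  the row i.i.d. of rate \<open>w\<close>.\<close>

lemma tilted_burke:
  assumes w: "0 < w" "w < 1" and z: "z < 1" and m: "1 \<le> m"
    and "\<Phi> \<in> borel_measurable (PiM {1..m} (\<lambda>_. borel))"
  shows "(\<integral>\<^sup>+x. ennreal (exp ((w - z) * Lx (1 / w) (1 / (1 - z)) 0 n x)) * \<Phi> (top_row (1 / w) (1 / (1 - z)) m n x) \<partial>M) =
    ennreal (((1 - z) / (1 - w)) ^ n) * (\<integral>\<^sup>+a. \<Phi> a \<partial>expv w m)"
  using assms(5)
proof (induction n arbitrary: \<Phi>)
  case 0
  note [measurable] = 0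
  have [measurable]: "(\<lambda>a. (\<lambda>i\<in>{1..m}. a i / w)) \<in> measurable (PiM {1..m} (\<lambda>_. borel)) (PiM {1..m} (\<lambda>_. borel))"
    by (rule measurable_restrict) measurable
  have [measurable]: "(\<lambda>x. \<lambda>i\<in>{1..m}. X i 0 x) \<in> measurable M (PiM {1..m} (\<lambda>_. borel))"
    by (rule measurable_restrict) measurable
  have "(\<integral>\<^sup>+x. \<Phi> (top_row (1 / w) (1 / (1 - z)) m 0 x) \<partial>M) =
    (\<integral>\<^sup>+x. \<Phi> (\<lambda>i\<in>{1..m}. (\<lambda>i\<in>{1..m}. X i 0 x) i / w) \<partial>M)"
  proof (intro nn_integral_cong arg_cong[where f=\<Phi>])
    fix x
    have "bl p q W i 0 - bl p q W (i - 1) 0 = p * W i 0" if "1 \<le> i" for p q W i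
      using that by (cases i) auto
    from this[of _ "1 / w" "1 / (1 - z)" "\<lambda>k l. X k l x"]
    show "top_row (1 / w) (1 / (1 - z)) m 0 x = (\<lambda>i\<in>{1..m}. (\<lambda>i\<in>{1..m}. X i 0 x) i / w)"
      by (auto simp: top_row_def fun_eq_iff)
  qed
  also have "\<dots> = (\<integral>\<^sup>+a. \<Phi> (\<lambda>i\<in>{1..m}. a i / w) \<partial>distr M (PiM {1..m} (\<lambda>_. borel)) (\<lambda>x. \<lambda>i\<in>{1..m}. X i 0 x))"
    by (rule nn_integral_distr[symmetric]) measurable
  also have "distr M (PiM {1..m} (\<lambda>_. borel)) (\<lambda>x. \<lambda>i\<in>{1..m}. X i 0 x) = expv 1 m"
    using vector_law[of "\<lambda>i. (i, 0)" "{1..m}"] m by (simp add: expv_def inj_on_def)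
  also have "(\<integral>\<^sup>+a. \<Phi> (\<lambda>i\<in>{1..m}. a i / w) \<partial>expv 1 m) = (\<integral>\<^sup>+a. \<Phi> a \<partial>expv w m)"
    by (rule nn_integral_expv_scale) (use w 0 in \<open>simp_all only:\<close>)
  finally show ?case by simp
next
  case (Suc n)
  note [measurable] = Suc.prems
  interpret e1: prob_space "expm 1" by (rule prob_space_expm) simp
  interpret vz: prob_space "expm (1 - z)" by (rule prob_space_expm) (use z in simp)
  interpret vw: prob_space "expm (1 - w)" by (rule prob_space_expm) (use w in simp)
  interpret em: prob_space "expv 1 m" by (rule prob_space_expv) simp
  interpret wm: prob_space "expv w m" by (rule prob_space_expv) fact
  define P where "P = PiM {0..m} (\<lambda>_::nat. expm 1)"
  have sets_P[measurable_cong]: "sets P = sets (PiM {0..m} (\<lambda>_. borel))"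
    unfolding P_def by (intro sets_PiM_cong) auto
  interpret P: prob_space P unfolding P_def by (intro prob_space_PiM prob_space_expm) simp
  let ?p = "1 / w" and ?q = "1 / (1 - z)"
  let ?V = "\<lambda>x. \<lambda>i\<in>{0..m}. X i (Suc n) x"
  define S where "S v = restrict v {1..m}" for v :: "nat \<Rightarrow> real"
  have [measurable]: "S \<in> measurable (PiM {0..m} (\<lambda>_. borel)) (PiM {1..m} (\<lambda>_. borel))"
    unfolding S_def by (rule measurable_restrict_subset) auto
  have [measurable]: "(\<lambda>v. v 0) \<in> borel_measurable (PiM {0..m} (\<lambda>_. borel))"
    by (rule measurable_component_singleton) auto
  define F where "F a v = ennreal (exp ((w - z) * (v 0 / (1 - z)))) * \<Phi> (restrict (row_I (v 0 / (1 - z)) a (S v)) {1..m})" for a v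
  have F[measurable (raw)]: "(\<lambda>x. F (f x) (g x)) \<in> borel_measurable N"
    if [measurable]: "f \<in> measurable N (PiM {1..m} (\<lambda>_. borel))" "g \<in> measurable N (PiM {0..m} (\<lambda>_. borel))" for f g and N :: "'z measure"
    unfolding F_def by measurable
  have "(\<integral>\<^sup>+x. ennreal (exp ((w - z) * Lx ?p ?q 0 (Suc n) x)) * \<Phi> (top_row ?p ?q m (Suc n) x) \<partial>M) =
    (\<integral>\<^sup>+x. (\<lambda>p. ennreal (exp ((w - z) * fst (fst p))) * F (snd (fst p)) (snd p)) ((Lx ?p ?q 0 n x, top_row ?p ?q m n x), ?V x) \<partial>M)"
  proof (rule nn_integral_cong)
    fix x
    have "top_row ?p ?q m (Suc n) x = restrict (row_I (?V x 0 / (1 - z)) (top_row ?p ?q m n x) (S (?V x))) {1..m}"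
    proof -
      have "Lx ?p ?q i (Suc n) x - Lx ?p ?q (i - 1) (Suc n) x = row_I (?V x 0 / (1 - z)) (top_row ?p ?q m n x) (S (?V x)) i"
        if i: "i \<in> {1..m}" for i
      proof -
        have "Lx ?p ?q i (Suc n) x - Lx ?p ?q (i - 1) (Suc n) x =
          row_I (?q * X 0 (Suc n) x) (\<lambda>i. Lx ?p ?q i n x - Lx ?p ?q (i - 1) n x) (\<lambda>i. X i (Suc n) x) i"
          using bl_row_increments(2)[of i ?p ?q "\<lambda>k l. X k l x" n] i by simp
        also have "\<dots> = row_I (?q * X 0 (Suc n) x) (top_row ?p ?q m n x) (S (?V x)) i"
          using i by (intro row_I_cong) (auto simp: top_row_def S_def)
        finally show ?thesis by simp
      qed
      then show ?thesis by (auto simp: top_row_def[of _ _ _ "Suc n"] fun_eq_iff simp del: One_nat_def)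
    qed
    moreover have "ennreal (exp ((w - z) * Lx ?p ?q 0 (Suc n) x)) =
      ennreal (exp ((w - z) * Lx ?p ?q 0 n x)) * ennreal (exp ((w - z) * (?V x 0 / (1 - z))))"
      by (subst ennreal_mult[symmetric]) (simp_all add: distrib_left exp_add)
    ultimately show "ennreal (exp ((w - z) * Lx ?p ?q 0 (Suc n) x)) * \<Phi> (top_row ?p ?q m (Suc n) x) =
       (\<lambda>p. ennreal (exp ((w - z) * fst (fst p))) * F (snd (fst p)) (snd p)) ((Lx ?p ?q 0 n x, top_row ?p ?q m n x), ?V x)"
      by (simp only: F_def fst_conv snd_conv mult.assoc)
  qed
  also have "\<dots> = (\<integral>\<^sup>+x. (\<integral>\<^sup>+v. (\<lambda>p. ennreal (exp ((w - z) * fst (fst p))) * F (snd (fst p)) (snd p)) ((Lx ?p ?q 0 n x, top_row ?p ?q m n x), v) \<partial>P) \<partial>M)"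
    unfolding P_def by (rule nn_integral_next_row[of "\<lambda>p. ennreal (exp ((w - z) * fst (fst p))) * F (snd (fst p)) (snd p)"]) measurable
  also have "\<dots> = (\<integral>\<^sup>+x. ennreal (exp ((w - z) * Lx ?p ?q 0 n x)) * (\<integral>\<^sup>+v. F (top_row ?p ?q m n x) v \<partial>P) \<partial>M)"
  proof (rule nn_integral_cong)
    fix x
    have [measurable]: "(\<lambda>_. top_row ?p ?q m n x) \<in> measurable N (PiM {1..m} (\<lambda>_. borel))" for N :: "'z measure"
      by (auto simp: space_PiM top_row_def)
    show "(\<integral>\<^sup>+v. (\<lambda>p. ennreal (exp ((w - z) * fst (fst p))) * F (snd (fst p)) (snd p)) ((Lx ?p ?q 0 n x, top_row ?p ?q m n x), v) \<partial>P) =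
      ennreal (exp ((w - z) * Lx ?p ?q 0 n x)) * (\<integral>\<^sup>+v. F (top_row ?p ?q m n x) v \<partial>P)"
      by (simp, rule nn_integral_cmult) measurable
  qed
  also have "\<dots> = ennreal (((1 - z) / (1 - w)) ^ n) * (\<integral>\<^sup>+a. (\<integral>\<^sup>+v. F a v \<partial>P) \<partial>expv w m)"
    by (rule Suc.IH[of "\<lambda>a. \<integral>\<^sup>+v. F a v \<partial>P"]) measurable
  also have "(\<integral>\<^sup>+a. (\<integral>\<^sup>+v. F a v \<partial>P) \<partial>expv w m) =
    (\<integral>\<^sup>+a. (\<integral>\<^sup>+b. ennreal ((1 - z) / (1 - w)) * (\<integral>\<^sup>+y. \<Phi> (restrict (row_I y a b) {1..m}) \<partial>expm (1 - w)) \<partial>expv 1 m) \<partial>expv w m)"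
  proof (rule nn_integral_cong)
    fix a assume a: "a \<in> space (expv w m)"
    have [measurable]: "(\<lambda>_. a) \<in> measurable N (PiM {1..m} (\<lambda>_. borel))" for N :: "'z measure"
      using a by (auto simp: space_expv space_PiM)
    have "(\<integral>\<^sup>+v. F a v \<partial>P) = (\<integral>\<^sup>+b. (\<integral>\<^sup>+y. F a (b(0 := y)) \<partial>expm 1) \<partial>expv 1 m)"
      unfolding P_def by (rule nn_integral_PiM_insert_0) measurable
    also have "\<dots> = (\<integral>\<^sup>+b. ennreal ((1 - z) / (1 - w)) * (\<integral>\<^sup>+y. \<Phi> (restrict (row_I y a b) {1..m}) \<partial>expm (1 - w)) \<partial>expv 1 m)"
    proof (rule nn_integral_cong)
      fix b assume b: "b \<in> space (expv 1 m)"
      have [measurable]: "(\<lambda>_. b) \<in> measurable N (PiM {1..m} (\<lambda>_. borel))" for N :: "'z measure"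
        using b by (auto simp: space_expv space_PiM)
      have Sb: "S (b(0 := y)) = b" for y
        using b by (auto simp: S_def space_expv fun_eq_iff PiE_def extensional_def restrict_def)
      have "(\<integral>\<^sup>+y. F a (b(0 := y)) \<partial>expm 1) =
        (\<integral>\<^sup>+y. ennreal (exp ((w - z) * (y / (1 - z)))) * \<Phi> (restrict (row_I (y / (1 - z)) a b) {1..m}) \<partial>expm 1)"
        by (simp add: F_def Sb del: One_nat_def)
      also have "\<dots> = (\<integral>\<^sup>+y. ennreal (exp ((w - z) * y)) * \<Phi> (restrict (row_I y a b) {1..m}) \<partial>expm (1 - z))"
        by (rule nn_integral_expm_scale[where f="\<lambda>y. ennreal (exp ((w - z) * y)) * \<Phi> (restrict (row_I y a b) {1..m})"])
          (measurable, use z in linarith)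
      \<comment> \<open>The new axis weight is tilted here; the exponent fits because
        \<open>1 - z - (1 - w) = w - z\<close>.\<close>
      also have "\<dots> = ennreal ((1 - z) / (1 - w)) * (\<integral>\<^sup>+y. \<Phi> (restrict (row_I y a b) {1..m}) \<partial>expm (1 - w))"
      proof -
        have "(\<lambda>y. \<Phi> (restrict (row_I y a b) {1..m})) \<in> borel_measurable borel" by measurable
        moreover have "0 < 1 - z" "0 < 1 - w" "1 - z - (1 - w) = w - z" using w z by auto
        ultimately show ?thesis using nn_integral_expm_tilt[of "\<lambda>y. \<Phi> (restrict (row_I y a b) {1..m})" "1 - z" "1 - w"] by metis
      qed
      finally show "(\<integral>\<^sup>+y. F a (b(0 := y)) \<partial>expm 1) = ennreal ((1 - z) / (1 - w)) * (\<integral>\<^sup>+y. \<Phi> (restrict (row_I y a b) {1..m}) \<partial>expm (1 - w))" .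
    qed
    finally show "(\<integral>\<^sup>+v. F a v \<partial>P) = (\<integral>\<^sup>+b. ennreal ((1 - z) / (1 - w)) * (\<integral>\<^sup>+y. \<Phi> (restrict (row_I y a b) {1..m}) \<partial>expm (1 - w)) \<partial>expv 1 m)" .
  qed
  also have "\<dots> = (\<integral>\<^sup>+a. ennreal ((1 - z) / (1 - w)) * (\<integral>\<^sup>+b. (\<integral>\<^sup>+y. \<Phi> (restrict (row_I y a b) {1..m}) \<partial>expm (1 - w)) \<partial>expv 1 m) \<partial>expv w m)"
  proof (rule nn_integral_cong)
    fix a assume a: "a \<in> space (expv w m)"
    have [measurable]: "(\<lambda>_. a) \<in> measurable N (PiM {1..m} (\<lambda>_. borel))" for N :: "'z measure"
      using a by (auto simp: space_expv space_PiM)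
    show "(\<integral>\<^sup>+b. ennreal ((1 - z) / (1 - w)) * (\<integral>\<^sup>+y. \<Phi> (restrict (row_I y a b) {1..m}) \<partial>expm (1 - w)) \<partial>expv 1 m) =
      ennreal ((1 - z) / (1 - w)) * (\<integral>\<^sup>+b. (\<integral>\<^sup>+y. \<Phi> (restrict (row_I y a b) {1..m}) \<partial>expm (1 - w)) \<partial>expv 1 m)"
      by (rule nn_integral_cmult) measurable
  qed
  also have "\<dots> = ennreal ((1 - z) / (1 - w)) * (\<integral>\<^sup>+a. (\<integral>\<^sup>+b. (\<integral>\<^sup>+y. \<Phi> (restrict (row_I y a b) {1..m}) \<partial>expm (1 - w)) \<partial>expv 1 m) \<partial>expv w m)"
    by (rule nn_integral_cmult) measurable
  also have "(\<integral>\<^sup>+a. (\<integral>\<^sup>+b. (\<integral>\<^sup>+y. \<Phi> (restrict (row_I y a b) {1..m}) \<partial>expm (1 - w)) \<partial>expv 1 m) \<partial>expv w m) =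
    (\<integral>\<^sup>+b. (\<integral>\<^sup>+a. (\<integral>\<^sup>+y. \<Phi> (restrict (row_I y a b) {1..m}) \<partial>expm (1 - w)) \<partial>expv w m) \<partial>expv 1 m)"
    by (rule pair_sigma_finite.Fubini'[OF pair_sigma_finite.intro[OF em.sigma_finite_measure_axioms wm.sigma_finite_measure_axioms]]) measurable
  \<comment> \<open>Only the new row is passed on to the next level, so the functional depends on
    the row alone.\<close>
  also have "\<dots> = (\<integral>\<^sup>+a. (\<integral>\<^sup>+y. \<Phi> a \<partial>expm (1 - w)) \<partial>expv w m)"
    by (rule burke_row[where \<Psi>="\<lambda>a y. \<Phi> a"]) (use w in measurable)
  also have "\<dots> = (\<integral>\<^sup>+a. \<Phi> a \<partial>expv w m)"
    using vw.emeasure_space_1 by simp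
  finally have "(\<integral>\<^sup>+x. ennreal (exp ((w - z) * Lx ?p ?q 0 (Suc n) x)) * \<Phi> (top_row ?p ?q m (Suc n) x) \<partial>M) =
    ennreal (((1 - z) / (1 - w)) ^ n) * (ennreal ((1 - z) / (1 - w)) * (\<integral>\<^sup>+a. \<Phi> a \<partial>expv w m))" .
  moreover have "ennreal (((1 - z) / (1 - w)) ^ Suc n) = ennreal (((1 - z) / (1 - w)) ^ n) * ennreal ((1 - z) / (1 - w))"
    using w z by (subst ennreal_mult[symmetric]) (auto simp: mult.commute)
  ultimately show ?case by (simp only: mult.assoc)
qed

text \<open>The passage time is the axis value plus the sum of the increments in row
  \<open>n\<close>. By the tilted Burke property the former contributes the power of
  \<open>(1 - z) / (1 - w)\<close>, and each of the \<open>m\<close> increments of rate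
  \<open>w\<close> contributes \<open>w / z\<close>.\<close>

lemma exp_moment_stationary:
  assumes w: "0 < w" "w < 1" and z: "0 < z" "z < 1" and m: "1 \<le> m"
  shows "(\<integral>\<^sup>+x. ennreal (exp ((w - z) * Lx (1 / w) (1 / (1 - z)) m n x)) \<partial>M) =
    ennreal ((w / z) ^ m * ((1 - z) / (1 - w)) ^ n)"
proof -
  interpret product_sigma_finite "\<lambda>_::nat. expm w"
    by standard (intro sigma_finite_measure.sigma_finite_countable sigma_finite_expm w)
  let ?p = "1 / w" and ?q = "1 / (1 - z)"
  let ?\<Phi> = "\<lambda>a. \<Prod>i\<in>{1..m}. ennreal (exp ((w - z) * a i))"
  have "(\<integral>\<^sup>+x. ennreal (exp ((w - z) * Lx ?p ?q m n x)) \<partial>M) =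
    (\<integral>\<^sup>+x. ennreal (exp ((w - z) * Lx ?p ?q 0 n x)) * ?\<Phi> (top_row ?p ?q m n x) \<partial>M)"
  proof (rule nn_integral_cong)
    fix x
    have "(\<Sum>i\<in>{1..m}. f i - f (i - 1)) = f m - f 0" for f :: "nat \<Rightarrow> real"
      by (induction m) auto
    then have tel: "(\<Sum>i\<in>{1..m}. top_row ?p ?q m n x i) = Lx ?p ?q m n x - Lx ?p ?q 0 n x"
      by (simp add: top_row_def)
    have "?\<Phi> (top_row ?p ?q m n x) = ennreal (exp ((w - z) * (\<Sum>i\<in>{1..m}. top_row ?p ?q m n x i)))"
      by (simp add: prod_ennreal exp_sum sum_distrib_left)
    then show "ennreal (exp ((w - z) * Lx ?p ?q m n x)) = ennreal (exp ((w - z) * Lx ?p ?q 0 n x)) * ?\<Phi> (top_row ?p ?q m n x)"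
      unfolding tel by (simp add: ennreal_mult[symmetric] exp_add[symmetric] algebra_simps)
  qed
  also have "\<dots> = ennreal (((1 - z) / (1 - w)) ^ n) * (\<integral>\<^sup>+a. ?\<Phi> a \<partial>expv w m)"
    by (rule tilted_burke[OF w z(2) m]) measurable
  also have "(\<integral>\<^sup>+a. ?\<Phi> a \<partial>expv w m) = (\<Prod>i\<in>{1..m}. (\<integral>\<^sup>+a. ennreal (exp ((w - z) * a)) \<partial>expm w))"
    unfolding expv_def by (rule product_nn_integral_prod) auto
  also have "\<dots> = ennreal ((w / z) ^ m)"
    using w z by (simp add: nn_integral_expm_exp ennreal_power)
  finally show ?thesis using w z by (simp add: ennreal_mult[symmetric] mult.commute)
qed

lemma top_row_law:
  assumes w: "0 < w" "w < 1" and m: "1 \<le> m"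
  shows "distr M (PiM {1..m} (\<lambda>_. borel)) (top_row (1 / w) (1 / (1 - w)) m n) = expv w m"
proof (rule measure_eqI)
  fix A assume "A \<in> sets (distr M (PiM {1..m} (\<lambda>_. borel)) (top_row (1 / w) (1 / (1 - w)) m n))"
  then have A[measurable]: "A \<in> sets (PiM {1..m} (\<lambda>_. borel))" by simp
  let ?\<mu> = "distr M (PiM {1..m} (\<lambda>_. borel)) (top_row (1 / w) (1 / (1 - w)) m n)"
  have "emeasure ?\<mu> A = (\<integral>\<^sup>+a. indicator A a \<partial>?\<mu>)"
    by (simp del: One_nat_def)
  also have "\<dots> = (\<integral>\<^sup>+x. indicator A (top_row (1 / w) (1 / (1 - w)) m n x) \<partial>M)"
    by (rule nn_integral_distr) measurable
  also have "\<dots> = (\<integral>\<^sup>+a. indicator A a \<partial>expv w m)"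
    using tilted_burke[OF w(1,2,2) m, of "indicator A" n] w by (simp del: One_nat_def)
  also have "\<dots> = emeasure (expv w m) A"
    by (rule nn_integral_indicator) (simp add: sets_expv del: One_nat_def)
  finally show "emeasure ?\<mu> A = emeasure (expv w m) A" .
qed (simp add: sets_expv)

end


section \<open>Moment bounds and exit points\<close>

definition lpp_mean :: "nat \<Rightarrow> nat \<Rightarrow> real" where
  "lpp_mean m n = (sqrt (real m) + sqrt (real n))\<^sup>2"

text \<open>The minimiser of \<open>stat_mean\<close>: the parameter whose stationary model has (m,
  n) as its characteristic direction, so that neither axis is preferred.\<close>

definition crit :: "nat \<Rightarrow> nat \<Rightarrow> real" where
  "crit m n = sqrt (real m) / (sqrt (real m) + sqrt (real n))"

definition stat_mean :: "nat \<Rightarrow> nat \<Rightarrow> real \<Rightarrow> real" where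
  "stat_mean m n x = real m / x + real n / (1 - x)"

lemma crit_bounds: "1 \<le> m \<Longrightarrow> 1 \<le> n \<Longrightarrow> 0 < crit m n \<and> crit m n < 1"
  by (auto simp: crit_def add_pos_pos)

lemma crit_swap: "1 \<le> m \<Longrightarrow> 1 \<le> n \<Longrightarrow> crit n m = 1 - crit m n"
  using real_sqrt_gt_zero[of "real m"] real_sqrt_gt_zero[of "real n"]
  by (simp add: crit_def field_simps add_pos_pos less_imp_neq[symmetric])

lemma lpp_mean_swap: "lpp_mean n m = lpp_mean m n"
  by (simp add: lpp_mean_def add.commute)

lemma lpp_mean_pos: "1 \<le> m \<Longrightarrow> 0 < lpp_mean m n"
proof -
  assume "1 \<le> m"
  then have "0 < sqrt (real m) + sqrt (real n)" by (intro add_pos_nonneg) auto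
  then show ?thesis by (simp add: lpp_mean_def)
qed

lemma crit_param:
  assumes "1 \<le> m" "1 \<le> n"
  shows "real m = lpp_mean m n * (crit m n)\<^sup>2" "real n = lpp_mean m n * (1 - crit m n)\<^sup>2"
proof -
  have *: "sqrt (real m) + sqrt (real n) > 0" using assms by (simp add: add_pos_pos)
  show "real m = lpp_mean m n * (crit m n)\<^sup>2"
    using * by (simp add: lpp_mean_def crit_def power_divide)
  have "1 - crit m n = sqrt (real n) / (sqrt (real m) + sqrt (real n))"
    using * by (simp add: crit_def field_simps)
  then show "real n = lpp_mean m n * (1 - crit m n)\<^sup>2"
    using * by (simp add: lpp_mean_def power_divide)
qed

text \<open>Since \<open>real m\<close> and \<open>real n\<close> are \<open>lpp_mean\<close> times
  squares in \<open>crit\<close>, the numerator completes to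
  \<open>x * (1 - x) + (x - crit m n)\<^sup>2\<close>. The excess over the minimum is thus quadratic
  in the distance to the critical parameter, without any Taylor remainder.\<close>

lemma stat_mean_eq:
  assumes "1 \<le> m" "1 \<le> n" "0 < x" "x < 1"
  shows "stat_mean m n x = lpp_mean m n * (1 + (x - crit m n)\<^sup>2 / (x * (1 - x)))"
proof -
  define s c where "s = lpp_mean m n" and "c = crit m n"
  have "stat_mean m n x = s * c\<^sup>2 / x + s * (1 - c)\<^sup>2 / (1 - x)"
    unfolding stat_mean_def using crit_param[OF assms(1,2)] by (simp add: s_def c_def)
  also have "\<dots> = (s * c\<^sup>2 * (1 - x) + s * (1 - c)\<^sup>2 * x) / (x * (1 - x))"
    using assms by (simp add: add_divide_eq_iff field_simps)
  also have "s * c\<^sup>2 * (1 - x) + s * (1 - c)\<^sup>2 * x = s * (x * (1 - x) + (x - c)\<^sup>2)"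
    by algebra
  also have "s * (x * (1 - x) + (x - c)\<^sup>2) / (x * (1 - x)) = s * (1 + (x - c)\<^sup>2 / (x * (1 - x)))"
    using assms by (simp add: field_simps)
  finally show ?thesis by (simp add: s_def c_def)
qed

lemma stat_mean_crit: "1 \<le> m \<Longrightarrow> 1 \<le> n \<Longrightarrow> stat_mean m n (crit m n) = lpp_mean m n"
  using stat_mean_eq[of m n "crit m n"] crit_bounds[of m n] by simp

text \<open>The derivative of \<open>stat_mean\<close> vanishes at \<open>crit\<close>, so the slope
  between two parameters is bounded by their distances to it. A merely bounded slope would miss the
  \<open>n^(1/3)\<close> scale, since the prefactor \<open>lpp_mean\<close> is of order n.\<close>

lemma stat_mean_lipschitz:
  assumes mn: "1 \<le> m" "1 \<le> n" and q: "0 < q" and x: "q \<le> x" "x \<le> 1 - q" and y: "q \<le> y" "y \<le> 1 - q"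
  shows "\<bar>stat_mean m n x - stat_mean m n y\<bar> \<le>
    \<bar>x - y\<bar> * lpp_mean m n * (3 * (\<bar>x - crit m n\<bar> + \<bar>y - crit m n\<bar>)) / q ^ 4"
proof -
  define s c where "s = lpp_mean m n" and "c = crit m n"
  define p r where "p = x - c" and "r = y - c"
  have c: "0 < c" "c < 1" using crit_bounds[OF mn] by (auto simp: c_def)
  have s: "0 < s" using lpp_mean_pos[OF mn(1)] by (simp add: s_def)
  have x': "0 < x" "x < 1" and y': "0 < y" "y < 1" using q x y by linarith+
  have D: "q ^ 4 \<le> x * y * ((1 - x) * (1 - y))"
  proof -
    have "q * q * (q * q) \<le> x * y * ((1 - x) * (1 - y))"
      using q x y x' y' by (intro mult_mono) auto
    then show ?thesis by (simp add: power4_eq_xxxx mult.assoc)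
  qed
  have Dpos: "0 < x * y * ((1 - x) * (1 - y))" using x' y' by simp
  \<comment> \<open>What remains of the numerator after \<open>x - y\<close> is pulled out; in terms
    of \<open>p\<close> and \<open>r\<close> it has no constant term.\<close>
  define N where "N = c\<^sup>2 * (p + r) + (1 - 2 * c) * (c * p + c * r + p * r)"
  have eq: "stat_mean m n x - stat_mean m n y = (x - y) * s * N / (x * y * ((1 - x) * (1 - y)))"
  proof -
    have "stat_mean m n x - stat_mean m n y = s * c\<^sup>2 / x + s * (1 - c)\<^sup>2 / (1 - x) - (s * c\<^sup>2 / y + s * (1 - c)\<^sup>2 / (1 - y))"
      unfolding stat_mean_def using crit_param[OF mn] by (simp add: s_def c_def)
    also have "\<dots> = s * c\<^sup>2 * (y - x) / (x * y) + s * (1 - c)\<^sup>2 * (x - y) / ((1 - x) * (1 - y))"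
    proof -
      have *: "k / u - k / v = k * (v - u) / (u * v)" if "0 < u" "0 < v" for k u v :: real
        using that by (simp add: diff_frac_eq algebra_simps)
      show ?thesis using *[of x y "s * c\<^sup>2"] *[of "1 - x" "1 - y" "s * (1 - c)\<^sup>2"] x' y' by simp
    qed
    also have "\<dots> = (s * c\<^sup>2 * (y - x) * ((1 - x) * (1 - y)) + s * (1 - c)\<^sup>2 * (x - y) * (x * y)) / (x * y * ((1 - x) * (1 - y)))"
      using x' y' by (subst add_frac_eq) auto
    also have "s * c\<^sup>2 * (y - x) * ((1 - x) * (1 - y)) + s * (1 - c)\<^sup>2 * (x - y) * (x * y) = (x - y) * s * N"
      unfolding N_def p_def r_def by algebra
    finally show ?thesis .
  qed
  have N: "\<bar>N\<bar> \<le> 3 * (\<bar>p\<bar> + \<bar>r\<bar>)"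
  proof -
    have p1: "\<bar>p\<bar> \<le> 1" using x' c by (auto simp: p_def)
    have "\<bar>c\<^sup>2 * (p + r)\<bar> \<le> 1 * (\<bar>p\<bar> + \<bar>r\<bar>)"
      unfolding abs_mult using c by (intro mult_mono) (auto simp: power_le_one)
    moreover have "\<bar>(1 - 2 * c) * (c * p + c * r + p * r)\<bar> \<le> 1 * (2 * (\<bar>p\<bar> + \<bar>r\<bar>))"
    proof -
      have "\<bar>c * p\<bar> \<le> 1 * \<bar>p\<bar>" "\<bar>c * r\<bar> \<le> 1 * \<bar>r\<bar>" "\<bar>p * r\<bar> \<le> 1 * \<bar>r\<bar>"
        unfolding abs_mult using c p1 by (intro mult_right_mono; simp)+
      moreover have "\<bar>c * p + c * r + p * r\<bar> \<le> \<bar>c * p\<bar> + \<bar>c * r\<bar> + \<bar>p * r\<bar>"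
        using abs_triangle_ineq[of "c * p + c * r" "p * r"] abs_triangle_ineq[of "c * p" "c * r"] by linarith
      ultimately have "\<bar>c * p + c * r + p * r\<bar> \<le> 2 * (\<bar>p\<bar> + \<bar>r\<bar>)"
        using abs_ge_zero[of p] by (smt (verit))
      then show ?thesis unfolding abs_mult[of "1 - 2 * c"] using c by (intro mult_mono) auto
    qed
    ultimately show ?thesis unfolding N_def by linarith
  qed
  have "\<bar>stat_mean m n x - stat_mean m n y\<bar> = \<bar>x - y\<bar> * s * \<bar>N\<bar> / (x * y * ((1 - x) * (1 - y)))"
    unfolding eq using s x' y' by (simp add: abs_mult)
  also have "\<dots> \<le> \<bar>x - y\<bar> * s * (3 * (\<bar>p\<bar> + \<bar>r\<bar>)) / q ^ 4"
    using s N D q by (intro frac_le mult_left_mono) auto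
  finally show ?thesis by (simp add: s_def c_def p_def r_def)
qed

text \<open>The trapezoidal estimate for the integral of 1 / x: for \<open>t = w / z\<close> the
  right-hand side is \<open>(w - z) * (1 / z + 1 / w) / 2\<close>. The difference of the two sides
  has half a square as derivative.\<close>

lemma ln_le_half_diff_inverse:
  fixes t :: real
  assumes "1 \<le> t"
  shows "ln t \<le> (t - 1 / t) / 2"
proof -
  have "(1 - 1 / 1) / 2 - ln 1 \<le> (t - 1 / t) / 2 - ln t"
  proof (rule DERIV_nonneg_imp_nondecreasing[OF assms, of "\<lambda>t. (t - 1 / t) / 2 - ln t"])
    fix x :: real assume x: "1 \<le> x" "x \<le> t"
    have "((\<lambda>t. (t - 1 / t) / 2 - ln t) has_real_derivative ((1 + 1 / (x * x)) / 2 - 1 / x)) (at x)"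
      using x by (auto intro!: derivative_eq_intros simp: field_simps)
    moreover have "(1 + 1 / (x * x)) / 2 - 1 / x = (1 - 1 / x)\<^sup>2 / 2"
      using x by (simp add: power2_eq_square field_simps)
    ultimately show "\<exists>y. ((\<lambda>t. (t - 1 / t) / 2 - ln t) has_real_derivative y) (at x) \<and> 0 \<le> y"
      by (metis divide_nonneg_pos zero_le_power2 zero_less_numeral)
  qed
  then show ?thesis by simp
qed

text \<open>The logarithmic moment generating function has the convex derivative \<open>stat_mean\<close>,
  so it lies below the trapezoidal estimate.\<close>

lemma exp_moment_le_trapezoid:
  assumes z: "0 < z" and zw: "z \<le> w" and w: "w < 1"
  shows "(w / z) ^ m * ((1 - z) / (1 - w)) ^ n \<le> exp ((w - z) * (stat_mean m n z + stat_mean m n w) / 2)"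
proof -
  have pos: "0 < w / z" "0 < (1 - z) / (1 - w)" using assms by auto
  have "ln (w / z) \<le> (w / z - 1 / (w / z)) / 2"
    using assms by (intro ln_le_half_diff_inverse) (simp add: field_simps)
  also have "\<dots> = (w - z) * (1 / z + 1 / w) / 2"
    using assms by (simp add: field_simps power2_eq_square)
  finally have 1: "real m * ln (w / z) \<le> real m * ((w - z) * (1 / z + 1 / w) / 2)"
    by (intro mult_left_mono) auto
  have "ln ((1 - z) / (1 - w)) \<le> ((1 - z) / (1 - w) - 1 / ((1 - z) / (1 - w))) / 2"
    using assms by (intro ln_le_half_diff_inverse) (simp add: field_simps)
  also have "\<dots> = (w - z) * (1 / (1 - z) + 1 / (1 - w)) / 2"
  proof -
    have "x / y - 1 / (x / y) = (x - y) * (1 / x + 1 / y)" if "0 < x" "0 < y" for x y :: real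
      using that by (simp add: field_simps)
    from this[of "1 - z" "1 - w"] show ?thesis using assms by simp
  qed
  finally have 2: "real n * ln ((1 - z) / (1 - w)) \<le> real n * ((w - z) * (1 / (1 - z) + 1 / (1 - w)) / 2)"
    by (intro mult_left_mono) auto
  have "(w / z) ^ m * ((1 - z) / (1 - w)) ^ n = exp (real m * ln (w / z) + real n * ln ((1 - z) / (1 - w)))"
    using pos by (simp add: exp_add exp_of_nat_mult)
  also have "\<dots> \<le> exp (real m * ((w - z) * (1 / z + 1 / w) / 2) + real n * ((w - z) * (1 / (1 - z) + 1 / (1 - w)) / 2))"
    unfolding exp_le_cancel_iff by (intro add_mono 1 2)
  also have "real m * ((w - z) * (1 / z + 1 / w) / 2) + real n * ((w - z) * (1 / (1 - z) + 1 / (1 - w)) / 2)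
    = (w - z) * (stat_mean m n z + stat_mean m n w) / 2"
    by (simp add: stat_mean_def algebra_simps add_divide_distrib)
  finally show ?thesis .
qed

section \<open>Deviations of the stationary passage time\<close>

lemma (in prob_space) chernoff_bound:
  assumes [measurable]: "f \<in> borel_measurable M" and b: "0 \<le> b"
    and bound: "(\<integral>\<^sup>+x. ennreal (exp (b * f x)) \<partial>M) \<le> ennreal (exp c)"
  shows "prob {x \<in> space M. y \<le> f x} \<le> exp (c - b * y)"
proof -
  have "emeasure M {x \<in> space M. y \<le> f x} = (\<integral>\<^sup>+x. indicator {x \<in> space M. y \<le> f x} x \<partial>M)" by simp
  also have "\<dots> \<le> (\<integral>\<^sup>+x. ennreal (exp (- b * y)) * ennreal (exp (b * f x)) \<partial>M)"
  proof (rule nn_integral_mono)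
    fix x
    show "indicator {x \<in> space M. y \<le> f x} x \<le> ennreal (exp (- b * y)) * ennreal (exp (b * f x))"
    proof (cases "y \<le> f x")
      case True
      then have "0 \<le> b * f x - b * y" using b by (simp add: mult_left_mono)
      then have "1 \<le> exp (- b * y) * exp (b * f x)" by (simp add: exp_add[symmetric])
      then show ?thesis by (subst ennreal_mult[symmetric]) (auto simp: indicator_def)
    qed (auto simp: indicator_def)
  qed
  also have "\<dots> = ennreal (exp (- b * y)) * (\<integral>\<^sup>+x. ennreal (exp (b * f x)) \<partial>M)"
    by (rule nn_integral_cmult) measurable
  also have "\<dots> \<le> ennreal (exp (- b * y)) * ennreal (exp c)"
    by (intro mult_left_mono bound) auto
  also have "\<dots> = ennreal (exp (c - b * y))"
    by (subst ennreal_mult[symmetric]) (auto simp: exp_add[symmetric])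
  finally show ?thesis by (simp add: emeasure_eq_measure)
qed

lemma expm_mean:
  assumes "0 < w"
  shows "has_bochner_integral (expm w) (\<lambda>x. x) (1 / w)"
proof -
  interpret prob_space "expm w" by (rule prob_space_expm) fact
  have "distributed (expm w) lborel (\<lambda>x. x) (exponential_density w)"
    unfolding distributed_def
  proof (intro conjI)
    show "distr (expm w) lborel (\<lambda>x. x) = density lborel (\<lambda>x. ennreal (exponential_density w x))"
      unfolding expm_def by (rule distr_id2) simp
  qed measurable
  from has_bochner_integral_erlang_ith_moment[OF assms this, of 1] show ?thesis by simp
qed

context exp_field begin

lemma Lx_max: "0 \<le> p \<Longrightarrow> 0 \<le> q \<Longrightarrow> Lx p q m n x = max (Lx p 0 m n x) (Lx 0 q m n x)"
  by (intro bl_eq_max nonneg)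

text \<open>The exponent \<open>b\<close> is free: adding vertical axis weights of rate
  \<open>1 - (w - b)\<close> only increases the passage time, and then the exact moment applies with
  \<open>w - z = b\<close>.\<close>

lemma horizontal_exp_moment:
  assumes m: "1 \<le> m" and b: "0 \<le> b" "b < w" and w: "w < 1"
  shows "(\<integral>\<^sup>+x. ennreal (exp (b * Lx (1 / w) 0 m n x)) \<partial>M) \<le>
    ennreal (exp (b * (stat_mean m n (w - b) + stat_mean m n w) / 2))"
proof -
  have "(\<integral>\<^sup>+x. ennreal (exp (b * Lx (1 / w) 0 m n x)) \<partial>M) \<le>
    (\<integral>\<^sup>+x. ennreal (exp ((w - (w - b)) * Lx (1 / w) (1 / (1 - (w - b))) m n x)) \<partial>M)"
  proof (rule nn_integral_mono)
    fix x
    have "Lx (1 / w) 0 m n x \<le> Lx (1 / w) (1 / (1 - (w - b))) m n x"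
      using b w by (intro bl_mono_boundary nonneg) auto
    then show "ennreal (exp (b * Lx (1 / w) 0 m n x)) \<le> ennreal (exp ((w - (w - b)) * Lx (1 / w) (1 / (1 - (w - b))) m n x))"
      using b(1) by (intro ennreal_leI) (simp add: mult_left_mono)
  qed
  also have "\<dots> = ennreal ((w / (w - b)) ^ m * ((1 - (w - b)) / (1 - w)) ^ n)"
    using b w m by (intro exp_moment_stationary) auto
  also have "\<dots> \<le> ennreal (exp ((w - (w - b)) * (stat_mean m n (w - b) + stat_mean m n w) / 2))"
    using b w by (intro ennreal_leI exp_moment_le_trapezoid) auto
  finally show ?thesis by simp
qed

text \<open>Symmetrically, horizontal weights of rate \<open>w + b\<close> are added to a model that
  has only vertical ones.\<close>

lemma vertical_exp_moment:
  assumes m: "1 \<le> m" and b: "0 \<le> b" "w + b < 1" and w: "0 < w"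
  shows "(\<integral>\<^sup>+x. ennreal (exp (b * Lx 0 (1 / (1 - w)) m n x)) \<partial>M) \<le>
    ennreal (exp (b * (stat_mean m n w + stat_mean m n (w + b)) / 2))"
proof -
  have "(\<integral>\<^sup>+x. ennreal (exp (b * Lx 0 (1 / (1 - w)) m n x)) \<partial>M) \<le>
    (\<integral>\<^sup>+x. ennreal (exp ((w + b - w) * Lx (1 / (w + b)) (1 / (1 - w)) m n x)) \<partial>M)"
  proof (rule nn_integral_mono)
    fix x
    have "Lx 0 (1 / (1 - w)) m n x \<le> Lx (1 / (w + b)) (1 / (1 - w)) m n x"
      using b w by (intro bl_mono_boundary nonneg) auto
    then show "ennreal (exp (b * Lx 0 (1 / (1 - w)) m n x)) \<le> ennreal (exp ((w + b - w) * Lx (1 / (w + b)) (1 / (1 - w)) m n x))"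
      using b(1) by (intro ennreal_leI) (simp add: mult_left_mono)
  qed
  also have "\<dots> = ennreal (((w + b) / w) ^ m * ((1 - w) / (1 - (w + b))) ^ n)"
    using b w m by (intro exp_moment_stationary) auto
  also have "\<dots> \<le> ennreal (exp ((w + b - w) * (stat_mean m n w + stat_mean m n (w + b)) / 2))"
    using b w by (intro ennreal_leI exp_moment_le_trapezoid) auto
  finally show ?thesis by simp
qed

text \<open>The passage time is read off along the vertical axis up to height \<open>n\<close> and
  then along row \<open>n\<close>, whose increments have rate \<open>w\<close> by the Burke
  property.\<close>

lemma stationary_mean:
  assumes w: "0 < w" "w < 1" and m: "1 \<le> m"
  shows "has_bochner_integral M (Lx (1 / w) (1 / (1 - w)) m n) (stat_mean m n w)"
proof -
  let ?L = "Lx (1 / w) (1 / (1 - w))"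
  have inc: "has_bochner_integral M (\<lambda>x. ?L i n x - ?L (i - 1) n x) (1 / w)" if i: "i \<in> {1..m}" for i
  proof -
    have "distr M borel (\<lambda>x. top_row (1 / w) (1 / (1 - w)) m n x i) =
      distr (distr M (PiM {1..m} (\<lambda>_. borel)) (top_row (1 / w) (1 / (1 - w)) m n)) borel (\<lambda>a. a i)"
      using i by (subst distr_distr) (auto simp: comp_def simp del: One_nat_def)
    also have "\<dots> = distr (expv w m) borel (\<lambda>a. a i)" using top_row_law[OF w m] by simp
    also have "\<dots> = distr (PiM {1..m} (\<lambda>_. expm w)) (expm w) (\<lambda>a. a i)"
      unfolding expv_def by (intro distr_cong) auto
    also have "\<dots> = expm w"
      using i w by (intro distr_PiM_component prob_space_expm) auto
    finally have *: "distr M borel (\<lambda>x. top_row (1 / w) (1 / (1 - w)) m n x i) = expm w" .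
    have "has_bochner_integral (distr M borel (\<lambda>x. top_row (1 / w) (1 / (1 - w)) m n x i)) (\<lambda>x. x) (1 / w)"
      unfolding * by (rule expm_mean) fact
    then have "has_bochner_integral M (\<lambda>x. top_row (1 / w) (1 / (1 - w)) m n x i) (1 / w)"
      using PiM_component_measurable[OF top_row_measurable i]
      by (auto simp: has_bochner_integral_iff integrable_distr_eq integral_distr)
    then show ?thesis using i by (simp add: top_row_def)
  qed
  have col: "has_bochner_integral M (\<lambda>x. (1 / (1 - w)) * X 0 j x) (1 / (1 - w))" for j
  proof -
    have "has_bochner_integral (distr M borel (X 0 j)) (\<lambda>x. x) (1 / 1)"
      unfolding law by (rule expm_mean) simp
    then have "has_bochner_integral M (X 0 j) 1"
      by (auto simp: has_bochner_integral_iff integrable_distr_eq integral_distr)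
    then have "has_bochner_integral M (\<lambda>x. (1 / (1 - w)) * X 0 j x) ((1 / (1 - w)) * 1)"
      by (rule has_bochner_integral_mult_right)
    then show ?thesis by simp
  qed
  have "has_bochner_integral M (\<lambda>x. (\<Sum>j\<in>{1..n}. (1 / (1 - w)) * X 0 j x) + (\<Sum>i\<in>{1..m}. ?L i n x - ?L (i - 1) n x))
    ((\<Sum>j\<in>{1..n}. 1 / (1 - w)) + (\<Sum>i\<in>{1..m}. 1 / w))"
    by (intro has_bochner_integral_add has_bochner_integral_sum inc col)
  moreover have "(\<Sum>j\<in>{1..n}. (1 / (1 - w)) * X 0 j x) + (\<Sum>i\<in>{1..m}. ?L i n x - ?L (i - 1) n x) = ?L m n x" for x
  proof -
    have "(\<Sum>i\<in>{1..m}. f i - f (i - 1)) = f m - f 0" for f :: "nat \<Rightarrow> real"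
      by (induction m) auto
    from this[of "\<lambda>i. ?L i n x"] show ?thesis by (simp add: bl_col_0)
  qed
  ultimately show ?thesis by (simp add: stat_mean_def add.commute)
qed

text \<open>The stationary passage time is the maximum of two one-sided ones, whose moments involve
  the parameters \<open>w - b\<close> and \<open>w + b\<close>; this bounds the positive part of the
  centred variable, and mean zero does the rest.\<close>

lemma stationary_abs_deviation:
  assumes w: "0 < w" "w < 1" and m: "1 \<le> m" and b: "0 < b" "b < w" "w + b < 1" and \<Delta>: "0 \<le> \<Delta>"
    and left: "(stat_mean m n (w - b) - stat_mean m n w) / 2 \<le> \<Delta>"
    and right: "(stat_mean m n (w + b) - stat_mean m n w) / 2 \<le> \<Delta>"
  shows "integrable M (\<lambda>x. \<bar>Lx (1 / w) (1 / (1 - w)) m n x - stat_mean m n w\<bar>)"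
    and "expectation (\<lambda>x. \<bar>Lx (1 / w) (1 / (1 - w)) m n x - stat_mean m n w\<bar>) \<le> 2 * (ln 3 / b + \<Delta>)"
proof -
  define Y where "Y x = Lx (1 / w) (1 / (1 - w)) m n x - stat_mean m n w" for x
  have [measurable]: "Y \<in> borel_measurable M" unfolding Y_def by measurable
  have Y: "integrable M Y" "expectation Y = 0"
    using stationary_mean[OF w m, of n] unfolding Y_def
    by (auto simp: has_bochner_integral_iff prob_space)
  show int: "integrable M (\<lambda>x. \<bar>Lx (1 / w) (1 / (1 - w)) m n x - stat_mean m n w\<bar>)"
    using Y(1) unfolding Y_def by (rule integrable_abs)
  \<comment> \<open>The factor 3 counts the bounds for the value 0, for the horizontal and for the
    vertical model.\<close>
  have bound: "(\<integral>\<^sup>+x. ennreal (exp (b * max 0 (Y x))) \<partial>M) \<le> ennreal (3 * exp (b * \<Delta>))"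
  proof -
    let ?c = "exp (- b * stat_mean m n w)"
    have "(\<integral>\<^sup>+x. ennreal (exp (b * max 0 (Y x))) \<partial>M) \<le>
      (\<integral>\<^sup>+x. 1 + (ennreal ?c * ennreal (exp (b * Lx (1 / w) 0 m n x)) + ennreal ?c * ennreal (exp (b * Lx 0 (1 / (1 - w)) m n x))) \<partial>M)"
    proof (rule nn_integral_mono)
      fix x
      define A where "A = Lx (1 / w) 0 m n x"
      define B where "B = Lx 0 (1 / (1 - w)) m n x"
      have "Y x = max A B - stat_mean m n w"
        unfolding Y_def A_def B_def using w by (subst Lx_max) auto
      then have "exp (b * max 0 (Y x)) \<le> 1 + (exp (b * (A - stat_mean m n w)) + exp (b * (B - stat_mean m n w)))"
        by (auto simp: max_def add_increasing add_increasing2)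
      also have "\<dots> = 1 + (?c * exp (b * A) + ?c * exp (b * B))"
        by (simp add: exp_add[symmetric] algebra_simps)
      finally show "ennreal (exp (b * max 0 (Y x))) \<le> 1 + (ennreal ?c * ennreal (exp (b * A)) + ennreal ?c * ennreal (exp (b * B)))"
        by (simp add: ennreal_mult[symmetric] ennreal_plus[symmetric] flip: ennreal_1 del: ennreal_1 ennreal_plus)
    qed
    also have "\<dots> = 1 + (ennreal ?c * (\<integral>\<^sup>+x. ennreal (exp (b * Lx (1 / w) 0 m n x)) \<partial>M) + ennreal ?c * (\<integral>\<^sup>+x. ennreal (exp (b * Lx 0 (1 / (1 - w)) m n x)) \<partial>M))"
      by (simp add: nn_integral_add nn_integral_cmult emeasure_space_1)
    also have "\<dots> \<le> 1 + (ennreal ?c * ennreal (exp (b * (stat_mean m n (w - b) + stat_mean m n w) / 2)) + ennreal ?c * ennreal (exp (b * (stat_mean m n w + stat_mean m n (w + b)) / 2)))"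
      using w m b by (intro add_left_mono add_mono mult_left_mono horizontal_exp_moment vertical_exp_moment) auto
    also have "\<dots> = ennreal (1 + (exp (b * ((stat_mean m n (w - b) - stat_mean m n w) / 2)) + exp (b * ((stat_mean m n (w + b) - stat_mean m n w) / 2))))"
    proof -
      have "?c * exp (b * (stat_mean m n (w - b) + stat_mean m n w) / 2) = exp (b * ((stat_mean m n (w - b) - stat_mean m n w) / 2))"
        "?c * exp (b * (stat_mean m n w + stat_mean m n (w + b)) / 2) = exp (b * ((stat_mean m n (w + b) - stat_mean m n w) / 2))"
        unfolding exp_add[symmetric] by (simp_all add: field_simps)
      then show ?thesis
        by (simp add: ennreal_mult[symmetric] ennreal_plus[symmetric] flip: ennreal_1 del: ennreal_1 ennreal_plus)
    qed
    also have "\<dots> \<le> ennreal (3 * exp (b * \<Delta>))"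
    proof (rule ennreal_leI)
      have "exp (b * ((stat_mean m n (w - b) - stat_mean m n w) / 2)) \<le> exp (b * \<Delta>)"
        "exp (b * ((stat_mean m n (w + b) - stat_mean m n w) / 2)) \<le> exp (b * \<Delta>)"
        using left right b unfolding exp_le_cancel_iff by (auto intro!: mult_left_mono)
      moreover have "1 \<le> exp (b * \<Delta>)" using b \<Delta> by simp
      ultimately show "1 + (exp (b * ((stat_mean m n (w - b) - stat_mean m n w) / 2)) + exp (b * ((stat_mean m n (w + b) - stat_mean m n w) / 2))) \<le> 3 * exp (b * \<Delta>)"
        by linarith
    qed
    finally show ?thesis .
  qed
  have intE: "integrable M (\<lambda>x. exp (b * max 0 (Y x)))"
    using bound by (intro integrableI_nonneg) (auto simp: less_top[symmetric] top_unique intro: le_less_trans)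
  have E: "expectation (\<lambda>x. exp (b * max 0 (Y x))) \<le> 3 * exp (b * \<Delta>)"
    using bound nn_integral_eq_integral[OF intE] by simp
  have int': "integrable M (\<lambda>x. max 0 (Y x))"
    using Y(1) by (intro Bochner_Integration.integrable_max) auto
  let ?K = "3 * exp (b * \<Delta>)"
  \<comment> \<open>Jensen's inequality for the logarithm, through its tangent line at
    \<open>?K\<close>.\<close>
  have "expectation (\<lambda>x. b * max 0 (Y x)) \<le> expectation (\<lambda>x. ln ?K - 1 + exp (b * max 0 (Y x)) / ?K)"
  proof (rule integral_mono)
    fix x
    have "ln (exp (b * max 0 (Y x)) / ?K) \<le> exp (b * max 0 (Y x)) / ?K - 1"
      by (intro ln_le_minus_one) simp
    moreover have "ln (exp (b * max 0 (Y x)) / ?K) = b * max 0 (Y x) - ln ?K"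
      by (subst ln_div) auto
    ultimately show "b * max 0 (Y x) \<le> ln ?K - 1 + exp (b * max 0 (Y x)) / ?K" by linarith
  qed (use int' intE in auto)
  also have "\<dots> = ln ?K - 1 + expectation (\<lambda>x. exp (b * max 0 (Y x))) / ?K"
    using intE by (subst Bochner_Integration.integral_add) (auto simp: prob_space)
  also have "\<dots> \<le> ln ?K"
    using E by (simp add: divide_le_eq_1)
  also have "ln ?K = ln 3 + b * \<Delta>" by (subst ln_mult) auto
  finally have "b * expectation (\<lambda>x. max 0 (Y x)) \<le> ln 3 + b * \<Delta>" by simp
  then have "expectation (\<lambda>x. max 0 (Y x)) \<le> ln 3 / b + \<Delta>"
    using b by (simp add: field_simps)
  moreover have "expectation (\<lambda>x. \<bar>Y x\<bar>) = expectation (\<lambda>x. 2 * max 0 (Y x) - Y x)"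
    by (intro Bochner_Integration.integral_cong) (auto simp: max_def)
  moreover have "\<dots> = 2 * expectation (\<lambda>x. max 0 (Y x)) - expectation Y"
    using int' Y by (subst Bochner_Integration.integral_diff) auto
  ultimately show "expectation (\<lambda>x. \<bar>Lx (1 / w) (1 / (1 - w)) m n x - stat_mean m n w\<bar>) \<le> 2 * (ln 3 / b + \<Delta>)"
    using Y(2) unfolding Y_def[symmetric] by simp
qed

end


section \<open>Maximal inequalities along a row\<close>

text \<open>Freezing the walk once it has reached \<open>l\<close> lets its final value record
  whether the level was ever reached. The factor \<open>\<theta>\<close> may be negative, so one
  definition serves both directions; \<open>b\<close> is the column at which the walk
  starts.\<close>

fun stopped_walk :: "real \<Rightarrow> real \<Rightarrow> real \<Rightarrow> nat \<Rightarrow> (nat \<Rightarrow> real) \<Rightarrow> nat \<Rightarrow> real" where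
  "stopped_walk \<theta> \<mu> l b a 0 = 0"
| "stopped_walk \<theta> \<mu> l b a (Suc k) =
     (if l \<le> stopped_walk \<theta> \<mu> l b a k then stopped_walk \<theta> \<mu> l b a k
      else stopped_walk \<theta> \<mu> l b a k + \<theta> * (a (Suc (b + k)) - \<mu>))"

lemma stopped_walk_reaches:
  assumes "j \<le> k" and "l \<le> \<theta> * (\<Sum>i\<in>{b+1..b+j}. a i - \<mu>)"
  shows "l \<le> stopped_walk \<theta> \<mu> l b a k"
proof -
  have "l \<le> stopped_walk \<theta> \<mu> l b a k \<or>
    (stopped_walk \<theta> \<mu> l b a k = \<theta> * (\<Sum>i\<in>{b+1..b+k}. a i - \<mu>) \<and> (\<forall>j\<le>k. \<not> l \<le> \<theta> * (\<Sum>i\<in>{b+1..b+j}. a i - \<mu>)))" for k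
  proof (induction k)
    case (Suc k)
    then show ?case by (auto simp: le_Suc_eq distrib_left not_le)
  qed auto
  from this[of k] assms show ?thesis by blast
qed

lemma stopped_walk_cong:
  "(\<And>i. i \<in> {b+1..b+k} \<Longrightarrow> a i = a' i) \<Longrightarrow> stopped_walk \<theta> \<mu> l b a k = stopped_walk \<theta> \<mu> l b a' k"
  by (induction k) auto

lemma stopped_walk_measurable:
  "b + k \<le> m \<Longrightarrow> (\<lambda>a. stopped_walk \<theta> \<mu> l b a k) \<in> borel_measurable (PiM {1..m} (\<lambda>_. borel))"
proof (induction k)
  case (Suc k)
  have [measurable]: "(\<lambda>a. a (Suc (b + k))) \<in> borel_measurable (PiM {1..m} (\<lambda>_. borel))"
    using Suc.prems by (intro measurable_component_singleton) auto
  have [measurable]: "(\<lambda>a. stopped_walk \<theta> \<mu> l b a k) \<in> borel_measurable (PiM {1..m} (\<lambda>_. borel))"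
    using Suc by auto
  show ?case unfolding stopped_walk.simps by measurable
qed simp

lemma nn_integral_expm_centered:
  assumes w: "0 < w" and \<theta>: "\<bar>\<theta>\<bar> \<le> w / 2"
  shows "(\<integral>\<^sup>+x. ennreal (exp (\<theta> * (x - 1 / w))) \<partial>expm w) \<le> ennreal (exp (2 * \<theta>\<^sup>2 / w\<^sup>2))"
proof -
  have pos: "0 < w - \<theta>" using w \<theta> by (auto simp: abs_le_iff)
  have "(\<integral>\<^sup>+x. ennreal (exp (\<theta> * (x - 1 / w))) \<partial>expm w) = (\<integral>\<^sup>+x. ennreal (exp (- \<theta> / w)) * ennreal (exp ((w - (w - \<theta>)) * x)) \<partial>expm w)"
    by (intro nn_integral_cong, subst ennreal_mult[symmetric]) (auto simp: exp_add[symmetric] algebra_simps)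
  also have "\<dots> = ennreal (exp (- \<theta> / w)) * ennreal (w / (w - \<theta>))"
    unfolding nn_integral_expm_exp[OF w pos, symmetric] by (rule nn_integral_cmult) measurable
  also have "\<dots> = ennreal (exp (- \<theta> / w) * (w / (w - \<theta>)))"
    using w pos by (subst ennreal_mult) auto
  also have "\<dots> \<le> ennreal (exp (2 * \<theta>\<^sup>2 / w\<^sup>2))"
  proof (rule ennreal_leI)
    have "\<bar>ln (1 + (- \<theta> / w)) - (- \<theta> / w)\<bar> \<le> 2 * (- \<theta> / w)\<^sup>2"
      using w \<theta> by (intro abs_ln_one_plus_x_minus_x_bound) (simp add: field_simps)
    then have "- ln (1 - \<theta> / w) \<le> \<theta> / w + 2 * \<theta>\<^sup>2 / w\<^sup>2"
      by (simp add: power_divide abs_le_iff)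
    moreover have "1 - \<theta> / w = (w - \<theta>) / w" using w by (simp add: field_simps)
    moreover have "- ln ((w - \<theta>) / w) = ln (w / (w - \<theta>))" using w pos by (simp add: ln_div)
    ultimately have "- \<theta> / w + ln (w / (w - \<theta>)) \<le> 2 * \<theta>\<^sup>2 / w\<^sup>2" by simp
    then have "exp (- \<theta> / w + ln (w / (w - \<theta>))) \<le> exp (2 * \<theta>\<^sup>2 / w\<^sup>2)" by simp
    moreover have "exp (- \<theta> / w + ln (w / (w - \<theta>))) = exp (- \<theta> / w) * (w / (w - \<theta>))"
      using w pos by (subst exp_add) simp
    ultimately show "exp (- \<theta> / w) * (w / (w - \<theta>)) \<le> exp (2 * \<theta>\<^sup>2 / w\<^sup>2)"
      by (simp only:)
  qed
  finally show ?thesis .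
qed

text \<open>A moving step multiplies the moment by at most
  \<open>exp (2 * \<theta>\<^sup>2 / w\<^sup>2)\<close>, and a frozen step by 1, which is no larger.
  This takes the place of Doob's inequality.\<close>

lemma nn_integral_exp_stopped_walk:
  assumes w: "0 < w" and \<theta>: "\<bar>\<theta>\<bar> \<le> w / 2"
  shows "(\<integral>\<^sup>+a. ennreal (exp (stopped_walk \<theta> (1 / w) l b a k)) \<partial>expv w (b + k)) \<le> ennreal (exp (real k * (2 * \<theta>\<^sup>2 / w\<^sup>2)))"
proof (induction k)
  case 0
  interpret prob_space "expv w b" by (rule prob_space_expv) fact
  show ?case by (simp add: emeasure_space_1)
next
  case (Suc k)
  let ?c = "2 * \<theta>\<^sup>2 / w\<^sup>2"
  let ?V = "\<lambda>a. stopped_walk \<theta> (1 / w) l b a k"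
  interpret e: prob_space "expm w" by (rule prob_space_expm) fact
  have [measurable]: "?V \<in> borel_measurable (PiM {1..b + k} (\<lambda>_. borel))"
    by (rule stopped_walk_measurable) simp
  have "(\<integral>\<^sup>+a. ennreal (exp (stopped_walk \<theta> (1 / w) l b a (Suc k))) \<partial>expv w (b + Suc k)) =
    (\<integral>\<^sup>+a. (\<integral>\<^sup>+x. ennreal (exp (stopped_walk \<theta> (1 / w) l b (a(Suc (b + k) := x)) (Suc k))) \<partial>expm w) \<partial>expv w (b + k))"
    unfolding add_Suc_right
  proof (rule nn_integral_expv_Suc[OF w])
    have "(\<lambda>a. stopped_walk \<theta> (1 / w) l b a (Suc k)) \<in> borel_measurable (PiM {1..Suc (b + k)} (\<lambda>_. borel))"
      by (rule stopped_walk_measurable) simp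
    then show "(\<lambda>a. ennreal (exp (stopped_walk \<theta> (1 / w) l b a (Suc k)))) \<in> borel_measurable (PiM {1..Suc (b + k)} (\<lambda>_. borel))"
      by measurable
  qed
  also have "\<dots> \<le> (\<integral>\<^sup>+a. ennreal (exp ?c) * ennreal (exp (?V a)) \<partial>expv w (b + k))"
  proof (rule nn_integral_mono)
    fix a
    have V: "stopped_walk \<theta> (1 / w) l b (a(Suc (b + k) := x)) k = ?V a" for x
      by (rule stopped_walk_cong) auto
    show "(\<integral>\<^sup>+x. ennreal (exp (stopped_walk \<theta> (1 / w) l b (a(Suc (b + k) := x)) (Suc k))) \<partial>expm w) \<le> ennreal (exp ?c) * ennreal (exp (?V a))"
    proof (cases "l \<le> ?V a")
      case True
      have "(\<integral>\<^sup>+x. ennreal (exp (stopped_walk \<theta> (1 / w) l b (a(Suc (b + k) := x)) (Suc k))) \<partial>expm w) = 1 * ennreal (exp (?V a))"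
        using True V e.emeasure_space_1 by simp
      also have "\<dots> \<le> ennreal (exp ?c) * ennreal (exp (?V a))"
        by (intro mult_right_mono) (auto simp: ennreal_ge_1)
      finally show ?thesis .
    next
      case False
      have "(\<integral>\<^sup>+x. ennreal (exp (stopped_walk \<theta> (1 / w) l b (a(Suc (b + k) := x)) (Suc k))) \<partial>expm w) =
        (\<integral>\<^sup>+x. ennreal (exp (?V a)) * ennreal (exp (\<theta> * (x - 1 / w))) \<partial>expm w)"
        using False V by (intro nn_integral_cong) (simp add: exp_add ennreal_mult)
      also have "\<dots> = ennreal (exp (?V a)) * (\<integral>\<^sup>+x. ennreal (exp (\<theta> * (x - 1 / w))) \<partial>expm w)"
        by (rule nn_integral_cmult) measurable
      also have "\<dots> \<le> ennreal (exp (?V a)) * ennreal (exp ?c)"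
        by (intro mult_left_mono nn_integral_expm_centered w \<theta>) simp
      finally show ?thesis by (simp only: mult.commute)
    qed
  qed
  also have "\<dots> = ennreal (exp ?c) * (\<integral>\<^sup>+a. ennreal (exp (?V a)) \<partial>expv w (b + k))"
    by (rule nn_integral_cmult) measurable
  also have "\<dots> \<le> ennreal (exp ?c) * ennreal (exp (real k * ?c))"
    by (intro mult_left_mono Suc.IH) simp
  also have "\<dots> = ennreal (exp (real (Suc k) * ?c))"
    by (subst ennreal_mult[symmetric]) (auto simp: exp_add[symmetric] distrib_right add_divide_distrib)
  finally show ?case .
qed

context exp_field begin

text \<open>By the Burke property the increments of row \<open>n\<close> are i.i.d., so the maximum
  over all prefixes reduces to a Chernoff bound for the stopped walk at its final time.\<close>

lemma row_walk_maximal_signed: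
  assumes w: "0 < w" "w < 1" and \<theta>: "\<bar>\<theta>\<bar> \<le> w / 2" and bK: "1 \<le> b + K"
  shows "prob {x \<in> space M. \<exists>j\<le>K. l \<le> \<theta> * (Lx (1 / w) (1 / (1 - w)) (b + j) n x - Lx (1 / w) (1 / (1 - w)) b n x - real j / w)}
    \<le> exp (real K * (2 * \<theta>\<^sup>2 / w\<^sup>2) - l)"
proof -
  let ?L = "Lx (1 / w) (1 / (1 - w))"
  let ?T = "top_row (1 / w) (1 / (1 - w)) (b + K) n"
  let ?f = "\<lambda>x. stopped_walk \<theta> (1 / w) l b (?T x) K"
  have [measurable]: "(\<lambda>a. stopped_walk \<theta> (1 / w) l b a K) \<in> borel_measurable (PiM {1..b + K} (\<lambda>_. borel))"
    by (rule stopped_walk_measurable) simp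
  have f[measurable]: "?f \<in> borel_measurable M" by measurable
  have sum_eq: "(\<Sum>i\<in>{b+1..b+j}. ?T x i - 1 / w) = ?L (b + j) n x - ?L b n x - real j / w" if "j \<le> K" for x j
    using that
  proof (induction j)
    case (Suc j)
    then show ?case by (simp add: top_row_def add_divide_distrib)
  qed simp
  have "prob {x \<in> space M. \<exists>j\<le>K. l \<le> \<theta> * (?L (b + j) n x - ?L b n x - real j / w)} \<le> prob {x \<in> space M. l \<le> ?f x}"
  proof (rule finite_measure_mono)
    show "{x \<in> space M. \<exists>j\<le>K. l \<le> \<theta> * (?L (b + j) n x - ?L b n x - real j / w)} \<subseteq> {x \<in> space M. l \<le> ?f x}"
      using sum_eq by (auto intro!: stopped_walk_reaches[where k=K])
  qed measurable
  also have "\<dots> \<le> exp (real K * (2 * \<theta>\<^sup>2 / w\<^sup>2) - 1 * l)"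
  proof (rule chernoff_bound)
    have "(\<integral>\<^sup>+x. ennreal (exp (1 * ?f x)) \<partial>M) = (\<integral>\<^sup>+a. ennreal (exp (stopped_walk \<theta> (1 / w) l b a K)) \<partial>distr M (PiM {1..b + K} (\<lambda>_. borel)) ?T)"
      unfolding mult_1 by (rule nn_integral_distr[symmetric]) measurable
    also have "\<dots> \<le> ennreal (exp (real K * (2 * \<theta>\<^sup>2 / w\<^sup>2)))"
      unfolding top_row_law[OF w bK] by (rule nn_integral_exp_stopped_walk[OF w(1) \<theta>])
    finally show "(\<integral>\<^sup>+x. ennreal (exp (1 * ?f x)) \<partial>M) \<le> ennreal (exp (real K * (2 * \<theta>\<^sup>2 / w\<^sup>2)))" .
  qed (use f in auto)
  finally show ?thesis by simp
qed

lemma row_walk_maximal: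
  assumes w: "0 < w" "w < 1" and \<theta>: "0 < \<theta>" "\<theta> \<le> w / 2" and bK: "1 \<le> b + K"
  shows "prob {x \<in> space M. \<exists>j\<le>K. l \<le> \<bar>Lx (1 / w) (1 / (1 - w)) (b + j) n x - Lx (1 / w) (1 / (1 - w)) b n x - real j / w\<bar>}
    \<le> 2 * exp (real K * (2 * \<theta>\<^sup>2 / w\<^sup>2) - \<theta> * l)"
proof -
  let ?D = "\<lambda>j x. Lx (1 / w) (1 / (1 - w)) (b + j) n x - Lx (1 / w) (1 / (1 - w)) b n x - real j / w"
  have "prob {x \<in> space M. \<exists>j\<le>K. l \<le> \<bar>?D j x\<bar>} \<le>
    prob ({x \<in> space M. \<exists>j\<le>K. \<theta> * l \<le> \<theta> * ?D j x} \<union> {x \<in> space M. \<exists>j\<le>K. \<theta> * l \<le> - \<theta> * ?D j x})"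
  proof (rule finite_measure_mono)
    show "{x \<in> space M. \<exists>j\<le>K. l \<le> \<bar>?D j x\<bar>} \<subseteq>
      {x \<in> space M. \<exists>j\<le>K. \<theta> * l \<le> \<theta> * ?D j x} \<union> {x \<in> space M. \<exists>j\<le>K. \<theta> * l \<le> - \<theta> * ?D j x}"
    proof
      fix x assume "x \<in> {x \<in> space M. \<exists>j\<le>K. l \<le> \<bar>?D j x\<bar>}"
      then obtain j where j: "x \<in> space M" "j \<le> K" "l \<le> ?D j x \<or> l \<le> - ?D j x" by (auto simp: abs_if split: if_splits)
      then have "\<theta> * l \<le> \<theta> * ?D j x \<or> \<theta> * l \<le> - \<theta> * ?D j x"
        using \<theta>(1) mult_left_mono[of l "?D j x" \<theta>] mult_left_mono[of l "- ?D j x" \<theta>]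
        by (auto simp del: minus_diff_eq)
      with j show "x \<in> {x \<in> space M. \<exists>j\<le>K. \<theta> * l \<le> \<theta> * ?D j x} \<union> {x \<in> space M. \<exists>j\<le>K. \<theta> * l \<le> - \<theta> * ?D j x}"
        by blast
    qed
  qed measurable
  also have "\<dots> \<le> prob {x \<in> space M. \<exists>j\<le>K. \<theta> * l \<le> \<theta> * ?D j x} + prob {x \<in> space M. \<exists>j\<le>K. \<theta> * l \<le> - \<theta> * ?D j x}"
    by (rule measure_Un_le) measurable
  also have "\<dots> \<le> exp (real K * (2 * \<theta>\<^sup>2 / w\<^sup>2) - \<theta> * l) + exp (real K * (2 * (- \<theta>)\<^sup>2 / w\<^sup>2) - \<theta> * l)"
    using \<theta> by (intro add_mono row_walk_maximal_signed w bK) auto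
  finally show ?thesis by simp
qed

text \<open>Markov's inequality for the mean absolute deviation, with 2 bounding
  \<open>ln 3\<close>. The parameter \<open>b\<close> stays free to balance the two terms.\<close>

lemma stationary_deviation:
  assumes mn: "1 \<le> m" "1 \<le> n" and q: "0 < q" "q \<le> w - b" "w + b \<le> 1 - q" and b: "0 < b" and y: "0 < y"
  shows "prob {x \<in> space M. y \<le> \<bar>Lx (1 / w) (1 / (1 - w)) m n x - stat_mean m n w\<bar>} \<le>
    2 * (2 / b + 3 / 2 * b * lpp_mean m n * (2 * \<bar>w - crit m n\<bar> + b) / q ^ 4) / y"
proof -
  define \<Delta> where "\<Delta> = 3 / 2 * b * lpp_mean m n * (2 * \<bar>w - crit m n\<bar> + b) / q ^ 4"
  have s: "0 < lpp_mean m n" using lpp_mean_pos[OF mn(1)] .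
  have w: "0 < w" "w < 1" "b < w" "w + b < 1" using q b by linarith+
  have diff: "(stat_mean m n v - stat_mean m n w) / 2 \<le> \<Delta>" if v: "v = w - b \<or> v = w + b" for v
  proof -
    have "\<bar>stat_mean m n v - stat_mean m n w\<bar> \<le> \<bar>v - w\<bar> * lpp_mean m n * (3 * (\<bar>v - crit m n\<bar> + \<bar>w - crit m n\<bar>)) / q ^ 4"
      using q b v by (intro stat_mean_lipschitz mn) auto
    also have "\<dots> \<le> b * lpp_mean m n * (3 * (2 * \<bar>w - crit m n\<bar> + b)) / q ^ 4"
      using q b v s by (intro divide_right_mono mult_mono) auto
    also have "\<dots> = 2 * \<Delta>" by (simp add: \<Delta>_def)
    finally have "stat_mean m n v - stat_mean m n w \<le> 2 * \<Delta>" by (rule order_trans[OF abs_ge_self])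
    then show ?thesis by simp
  qed
  have \<Delta>: "0 \<le> \<Delta>" using s b q by (simp add: \<Delta>_def)
  let ?Y = "\<lambda>x. \<bar>Lx (1 / w) (1 / (1 - w)) m n x - stat_mean m n w\<bar>"
  note dev = stationary_abs_deviation[OF w(1,2) mn(1) b w(3,4) \<Delta> diff diff, OF disjI1[OF refl] disjI2[OF refl]]
  have "prob {x \<in> space M. y \<le> ?Y x} \<le> expectation ?Y / y"
    using integral_Markov_inequality_measure[OF dev(1), of "space M" y] y by auto
  also have "\<dots> \<le> 2 * (ln 3 / b + \<Delta>) / y"
    using dev(2) y by (intro divide_right_mono) auto
  also have "\<dots> \<le> 2 * (2 / b + \<Delta>) / y"
    using ln_le_minus_one[of 3] y b by (intro divide_right_mono mult_left_mono add_right_mono) auto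
  finally show ?thesis by (simp add: \<Delta>_def)
qed

text \<open>Below the critical parameter the stationary mean is \<open>s + e\<close> with
  \<open>e\<close> of order \<open>s * a\<^sup>2\<close>, while the trapezoidal estimate places the
  vertical model near \<open>s + e / 2\<close>, because its second endpoint \<open>w + a\<close> is
  exactly critical. When the vertical model wins it equals the stationary one, so either it is too
  large or the stationary one is far from its mean.\<close>

lemma exit_horizontal:
  assumes mn: "1 \<le> m" "1 \<le> n" and a: "0 < a" and \<tau>: "0 < \<tau>" "\<tau> \<le> 1" and w: "w = crit m n - a"
    and q: "0 < q" "q \<le> w - \<tau> * a" "w + \<tau> * a \<le> 1 - q"
  shows "prob {x \<in> space M. Lx (1 / w) 0 m n x < Lx 0 (1 / (1 - w)) m n x} \<le>
    exp (- lpp_mean m n * a ^ 3) + 4 / (\<tau> * lpp_mean m n * a ^ 3) + 9 * \<tau> / q ^ 4"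
proof -
  define s where "s = lpp_mean m n"
  define e where "e = stat_mean m n w - s"
  have s: "0 < s" using lpp_mean_pos[OF mn(1)] by (simp add: s_def)
  have \<tau>a: "0 < \<tau> * a" using \<tau> a by simp
  have w01: "0 < w" "w < 1" using q \<tau>a by linarith+
  have e_eq: "e = s * a\<^sup>2 / (w * (1 - w))"
  proof -
    have "(w - crit m n)\<^sup>2 = a\<^sup>2" using w by simp
    then show ?thesis using stat_mean_eq[OF mn w01] by (simp add: e_def s_def distrib_left)
  qed
  have e4: "4 * s * a\<^sup>2 \<le> e"
  proof -
    have "w * (1 - w) \<le> 1 / 4" using zero_le_power2[of "w - 1 / 2"] by (simp add: power2_eq_square algebra_simps)
    then have "s * a\<^sup>2 / (1 / 4) \<le> e"
      unfolding e_eq using s w01 by (intro divide_left_mono) auto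
    then show ?thesis by simp
  qed
  have e: "0 < e" unfolding e_eq using s a w01 by simp
  \<comment> \<open>Halfway between the estimate \<open>s + e / 2\<close> for the vertical model and
    the stationary mean \<open>s + e\<close>.\<close>
  let ?x = "s + 3 * e / 4"
  let ?V = "{x \<in> space M. ?x \<le> Lx 0 (1 / (1 - w)) m n x}"
  let ?D = "{x \<in> space M. e / 4 \<le> \<bar>Lx (1 / w) (1 / (1 - w)) m n x - stat_mean m n w\<bar>}"
  have "prob {x \<in> space M. Lx (1 / w) 0 m n x < Lx 0 (1 / (1 - w)) m n x} \<le> prob (?V \<union> ?D)"
  proof (rule finite_measure_mono)
    show "{x \<in> space M. Lx (1 / w) 0 m n x < Lx 0 (1 / (1 - w)) m n x} \<subseteq> ?V \<union> ?D"
    proof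
      fix x assume x: "x \<in> {x \<in> space M. Lx (1 / w) 0 m n x < Lx 0 (1 / (1 - w)) m n x}"
      have "Lx (1 / w) (1 / (1 - w)) m n x = Lx 0 (1 / (1 - w)) m n x"
        using x w01 by (subst Lx_max) auto
      moreover have "s + 3 * e / 4 \<le> L \<or> e / 4 \<le> \<bar>L - stat_mean m n w\<bar>" for L
        unfolding e_def by (auto simp: abs_if field_simps)
      ultimately show "x \<in> ?V \<union> ?D" using x by auto
    qed
  qed measurable
  also have "\<dots> \<le> prob ?V + prob ?D"
    by (rule measure_Un_le) measurable
  also have "\<dots> \<le> exp (- s * a ^ 3) + (4 / (\<tau> * s * a ^ 3) + 9 * \<tau> / q ^ 4)"
  proof (rule add_mono)
    have "prob ?V \<le> exp (a * (stat_mean m n w + stat_mean m n (w + a)) / 2 - a * ?x)"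
      using a w01 w mn crit_bounds[OF mn] by (intro chernoff_bound vertical_exp_moment) auto
    also have "stat_mean m n (w + a) = s" using w stat_mean_crit[OF mn] by (simp add: s_def)
    also have "a * (stat_mean m n w + s) / 2 - a * ?x = - (a * e / 4)"
      by (simp add: e_def field_simps)
    also have "exp (- (a * e / 4)) \<le> exp (- s * a ^ 3)"
      using mult_left_mono[OF e4, of a] a by (simp add: power2_eq_square power3_eq_cube algebra_simps)
    finally show "prob ?V \<le> exp (- s * a ^ 3)" .
    \<comment> \<open>With moment parameter \<open>\<tau> * a\<close> the deviation bound, divided
      by \<open>e\<close>, splits into a term that decays in \<open>s * a ^ 3\<close> and one
      proportional to \<open>\<tau>\<close>.\<close>
    have "prob ?D \<le> 2 * (2 / (\<tau> * a) + 3 / 2 * (\<tau> * a) * s * (2 * \<bar>w - crit m n\<bar> + \<tau> * a) / q ^ 4) / (e / 4)"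
      unfolding s_def using q \<tau>a e by (intro stationary_deviation mn) auto
    also have "\<dots> \<le> 2 * (2 / (\<tau> * a) + 3 / 2 * (\<tau> * a) * s * (3 * a) / q ^ 4) / (s * a\<^sup>2)"
    proof (rule frac_le)
      have "2 * \<bar>w - crit m n\<bar> + \<tau> * a \<le> 3 * a" using w a \<tau> by simp
      then show "2 * (2 / (\<tau> * a) + 3 / 2 * (\<tau> * a) * s * (2 * \<bar>w - crit m n\<bar> + \<tau> * a) / q ^ 4)
        \<le> 2 * (2 / (\<tau> * a) + 3 / 2 * (\<tau> * a) * s * (3 * a) / q ^ 4)"
        using \<tau>a s q by (intro mult_left_mono add_left_mono divide_right_mono) auto
    qed (use e4 s a \<tau> q in auto)
    also have "\<dots> = 4 / (\<tau> * s * a ^ 3) + 9 * \<tau> / q ^ 4"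
    proof -
      have "2 * (2 / (\<tau> * a)) / (s * a\<^sup>2) = 4 / (\<tau> * s * a ^ 3)"
        by (simp add: power2_eq_square power3_eq_cube mult.commute mult.left_commute)
      moreover have "2 * (3 / 2 * (\<tau> * a) * s * (3 * a) / q ^ 4) / (s * a\<^sup>2) = 9 * \<tau> / q ^ 4"
        using s a by (simp add: power2_eq_square)
      ultimately show ?thesis by (simp only: distrib_left add_divide_distrib)
    qed
    finally show "prob ?D \<le> 4 / (\<tau> * s * a ^ 3) + 9 * \<tau> / q ^ 4" .
  qed
  finally show ?thesis by (simp add: s_def)
qed

lemma exp_field_transpose: "exp_field M (\<lambda>i j. X j i)"
  using exp_field_reindex[of prod.swap] by (simp add: inj_def)

text \<open>Transposition exchanges the axes and turns \<open>w\<close> into \<open>1 - w\<close>,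
  hence \<open>crit m n + a\<close> into \<open>crit n m - a\<close>.\<close>

lemma exit_vertical:
  assumes mn: "1 \<le> m" "1 \<le> n" and a: "0 < a" and \<tau>: "0 < \<tau>" "\<tau> \<le> 1" and w: "w = crit m n + a"
    and q: "0 < q" "q \<le> w - \<tau> * a" "w + \<tau> * a \<le> 1 - q"
  shows "prob {x \<in> space M. Lx 0 (1 / (1 - w)) m n x < Lx (1 / w) 0 m n x} \<le>
    exp (- lpp_mean m n * a ^ 3) + 4 / (\<tau> * lpp_mean m n * a ^ 3) + 9 * \<tau> / q ^ 4"
proof -
  interpret T: exp_field M "\<lambda>i j. X j i" by (rule exp_field_transpose)
  have "1 - w = crit n m - a" using w crit_swap[OF mn] by simp
  from T.exit_horizontal[OF mn(2,1) a \<tau> this q(1)] q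
  have "prob {x \<in> space M. bl (1 / (1 - w)) 0 (\<lambda>i j. X j i x) n m < bl 0 (1 / w) (\<lambda>i j. X j i x) n m} \<le>
    exp (- lpp_mean n m * a ^ 3) + 4 / (\<tau> * lpp_mean n m * a ^ 3) + 9 * \<tau> / q ^ 4"
    by simp
  moreover have "bl p q (\<lambda>i j. X j i x) n m = Lx q p m n x" for p q x
    using bl_transpose[of p q "\<lambda>k l. X k l x" n m] by simp
  ultimately show ?thesis by (simp add: lpp_mean_swap)
qed

end


section \<open>Fluctuations of the bulk passage times\<close>

context exp_field begin

lemma exp_field_shift: "exp_field M (\<lambda>i j. X (i + k) j)"
  using exp_field_reindex[of "\<lambda>(i, j). (i + k, j)"] by (simp add: inj_def)

lemma exp_field_box_reverse: "exp_field M (box_reverse m n X)"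
proof -
  define e where "e = (\<lambda>(i, j). if 1 \<le> i \<and> i \<le> m \<and> 1 \<le> j \<and> j \<le> n then (m + 1 - i, n + 1 - j) else (i, j))"
  have "e (e p) = p" for p by (auto simp: e_def split: prod.splits if_splits)
  then have "inj e" by (metis injI)
  moreover have "X (fst (e (i, j))) (snd (e (i, j))) = box_reverse m n X i j" for i j
    by (simp add: e_def box_reverse_def)
  ultimately show ?thesis using exp_field_reindex[of e] by simp
qed

text \<open>Two regimes of the exit column. An exit up to \<open>k1\<close> gains a difference of
  two walks: the axis weights, with drift \<open>1 / z\<close>, against increments of the reversed
  bulk, which are bounded below by a walk of drift \<open>1 / w\<close> with
  \<open>w = z + a\<close>. A later exit is unlikely, because beyond \<open>k1\<close> the
  trapezoidal mean falls behind by \<open>real k1 * b / 2\<close>.\<close>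

lemma horizontal_excess:
  fixes m n k1 :: nat and a b \<tau> q \<theta> lam y :: real
  defines "z \<equiv> crit m n" and "s \<equiv> lpp_mean m n"
  assumes mn: "1 \<le> m" "1 \<le> n" and k1: "1 \<le> k1" "k1 < m" and a: "0 < a" and \<tau>: "0 < \<tau>" "\<tau> \<le> 1"
    and b: "0 < b" and q: "0 < q" "q \<le> z - b" "z + a + \<tau> * a \<le> 1 - q" and \<theta>: "0 < \<theta>" "\<theta> \<le> q / 2"
  shows "prob {x \<in> space M. s - y \<le> Lx (1 / z) 0 m n x \<and>
      Lx 0 0 m n x + (3 * lam + real k1 * a / q\<^sup>2 + 1 / q) < Lx (1 / z) 0 m n x} \<le>
    4 * exp (2 * real k1 * \<theta>\<^sup>2 / q\<^sup>2 - \<theta> * lam) +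
    (exp (- s * a ^ 3) + 4 / (\<tau> * s * a ^ 3) + 9 * \<tau> / q ^ 4) +
    exp (3 / 2 * s * b ^ 3 / q ^ 4 + b * (y + lam) - real k1 * b\<^sup>2 / 2)"
proof -
  define w where "w = z + a"
  have \<tau>a: "0 < \<tau> * a" "\<tau> * a \<le> a" using \<tau> a by auto
  have z: "q \<le> z" "z < w" "0 < z" "z < 1" "z \<le> 1 - q" using q b a \<tau>a by (auto simp: w_def)
  have w: "q \<le> w" "0 < w" "w < 1" using z q a \<tau>a by (auto simp: w_def)
  have s: "0 < s" using lpp_mean_pos[OF mn(1)] by (simp add: s_def)
  interpret R: exp_field M "box_reverse m n X" by (rule exp_field_box_reverse)
  interpret S: exp_field M "\<lambda>i j. X (i + k1) j" by (rule exp_field_shift)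
  let ?E1 = "{x \<in> space M. \<exists>j\<le>k1. lam \<le> \<bar>Lx (1 / z) (1 / (1 - z)) (0 + j) 0 x - Lx (1 / z) (1 / (1 - z)) 0 0 x - real j / z\<bar>}"
  let ?E2 = "{x \<in> space M. \<exists>j\<le>k1. lam \<le> \<bar>R.Lx (1 / w) (1 / (1 - w)) (m - k1 + j) n x - R.Lx (1 / w) (1 / (1 - w)) (m - k1) n x - real j / w\<bar>}"
  let ?E3 = "{x \<in> space M. R.Lx 0 (1 / (1 - w)) m n x < R.Lx (1 / w) 0 m n x}"
  let ?E4 = "{x \<in> space M. s - y - real k1 / z - lam \<le> S.Lx (1 / z) 0 (m - k1) n x}"
  let ?E = "{x \<in> space M. s - y \<le> Lx (1 / z) 0 m n x \<and>
      Lx 0 0 m n x + (3 * lam + real k1 * a / q\<^sup>2 + 1 / q) < Lx (1 / z) 0 m n x}"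
  have p1: "prob ?E1 \<le> 2 * exp (2 * real k1 * \<theta>\<^sup>2 / q\<^sup>2 - \<theta> * lam)"
  proof -
    have "prob ?E1 \<le> 2 * exp (real k1 * (2 * \<theta>\<^sup>2 / z\<^sup>2) - \<theta> * lam)"
      using z \<theta> k1 by (intro row_walk_maximal) auto
    also have "real k1 * (2 * \<theta>\<^sup>2 / z\<^sup>2) \<le> real k1 * (2 * \<theta>\<^sup>2 / q\<^sup>2)"
      using z q by (intro mult_left_mono divide_left_mono power_mono) auto
    finally show ?thesis by (simp add: mult.commute mult.left_commute)
  qed
  have p2: "prob ?E2 \<le> 2 * exp (2 * real k1 * \<theta>\<^sup>2 / q\<^sup>2 - \<theta> * lam)"
  proof -
    have "prob ?E2 \<le> 2 * exp (real k1 * (2 * \<theta>\<^sup>2 / w\<^sup>2) - \<theta> * lam)"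
      using w \<theta> k1 by (intro R.row_walk_maximal) auto
    also have "real k1 * (2 * \<theta>\<^sup>2 / w\<^sup>2) \<le> real k1 * (2 * \<theta>\<^sup>2 / q\<^sup>2)"
      using w q by (intro mult_left_mono divide_left_mono power_mono) auto
    finally show ?thesis by (simp add: mult.commute mult.left_commute)
  qed
  have p3: "prob ?E3 \<le> exp (- s * a ^ 3) + 4 / (\<tau> * s * a ^ 3) + 9 * \<tau> / q ^ 4"
    unfolding s_def using q z \<tau>a by (intro R.exit_vertical mn a \<tau>) (auto simp: w_def z_def)
  have p4: "prob ?E4 \<le> exp (3 / 2 * s * b ^ 3 / q ^ 4 + b * (y + lam) - real k1 * b\<^sup>2 / 2)"
  proof -
    have "prob ?E4 \<le> exp (b * (stat_mean (m - k1) n (z - b) + stat_mean (m - k1) n z) / 2 - b * (s - y - real k1 / z - lam))"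
      using b q z k1 by (intro chernoff_bound S.horizontal_exp_moment) auto
    also have "\<dots> \<le> exp (3 / 2 * s * b ^ 3 / q ^ 4 + b * (y + lam) - real k1 * b\<^sup>2 / 2)"
      unfolding exp_le_cancel_iff
    proof -
      have zb: "q \<le> z - b" "z - b < z" "0 < z - b" using q b by auto
      have sm: "stat_mean (m - k1) n v = stat_mean m n v - real k1 / v" for v
        using k1 by (simp add: stat_mean_def of_nat_diff diff_divide_distrib)
      have "\<bar>stat_mean m n (z - b) - stat_mean m n z\<bar> \<le> \<bar>z - b - z\<bar> * s * (3 * (\<bar>z - b - z\<bar> + \<bar>z - z\<bar>)) / q ^ 4"
        unfolding s_def z_def using q z b zb by (intro stat_mean_lipschitz mn) (auto simp: z_def)
      also have "\<dots> = 3 * s * b\<^sup>2 / q ^ 4" using b by (simp add: power2_eq_square)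
      finally have "stat_mean m n (z - b) - stat_mean m n z \<le> 3 * s * b\<^sup>2 / q ^ 4" by (rule order_trans[OF abs_ge_self])
      then have 1: "stat_mean m n (z - b) \<le> s + 3 * s * b\<^sup>2 / q ^ 4"
        using stat_mean_crit[OF mn] by (simp add: z_def s_def)
      \<comment> \<open>Dropping \<open>k1\<close> columns removes \<open>real k1 / (z - b)\<close>
        from the mean at \<open>z - b\<close>, at least \<open>real k1 * b\<close> more than
        \<open>real k1 / z\<close>; this surplus is what makes late exits unlikely.\<close>
      have "b \<le> b / (z * (z - b))"
      proof -
        have "z * (z - b) \<le> 1 * 1" using z zb by (intro mult_mono) auto
        then show ?thesis using b z zb by (simp add: pos_le_divide_eq mult_left_le)
      qed
      also have "b / (z * (z - b)) = 1 / (z - b) - 1 / z" using z zb by (simp add: field_simps)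
      finally have 2: "1 / z + b \<le> 1 / (z - b)" by simp
      have "real k1 * (1 / z + b) \<le> real k1 * (1 / (z - b))" by (intro mult_left_mono 2) simp
      then have 3: "real k1 / z + real k1 * b \<le> real k1 / (z - b)" by (simp add: distrib_left)
      have "stat_mean (m - k1) n (z - b) + stat_mean (m - k1) n z \<le>
        (s + 3 * s * b\<^sup>2 / q ^ 4 - (real k1 / z + real k1 * b)) + (s - real k1 / z)"
        unfolding sm using 1 3 stat_mean_crit[OF mn] by (simp add: z_def s_def)
      then have "b * (stat_mean (m - k1) n (z - b) + stat_mean (m - k1) n z) \<le>
        b * ((s + 3 * s * b\<^sup>2 / q ^ 4 - (real k1 / z + real k1 * b)) + (s - real k1 / z))"
        using b by (intro mult_left_mono) auto
      then have "b * (stat_mean (m - k1) n (z - b) + stat_mean (m - k1) n z) / 2 - b * (s - y - real k1 / z - lam) \<le>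
        b * ((s + 3 * s * b\<^sup>2 / q ^ 4 - (real k1 / z + real k1 * b)) + (s - real k1 / z)) / 2 - b * (s - y - real k1 / z - lam)"
        by simp
      also have "\<dots> = 3 / 2 * s * b ^ 3 / q ^ 4 + b * (y + lam) - real k1 * b\<^sup>2 / 2"
        by (simp add: algebra_simps power2_eq_square power3_eq_cube diff_divide_distrib add_divide_distrib)
      finally show "b * (stat_mean (m - k1) n (z - b) + stat_mean (m - k1) n z) / 2 - b * (s - y - real k1 / z - lam)
        \<le> 3 / 2 * s * b ^ 3 / q ^ 4 + b * (y + lam) - real k1 * b\<^sup>2 / 2" .
    qed
    finally show ?thesis .
  qed
  have "prob ?E \<le> prob (?E1 \<union> ?E2 \<union> ?E3 \<union> ?E4)"
  proof (rule finite_measure_mono)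
    show "?E \<subseteq> ?E1 \<union> ?E2 \<union> ?E3 \<union> ?E4"
    proof (rule subsetI, rule ccontr)
      fix x assume xE: "x \<in> ?E" and nx: "x \<notin> ?E1 \<union> ?E2 \<union> ?E3 \<union> ?E4"
      then have x: "x \<in> space M" by blast
      have n1: "\<bar>Lx (1 / z) (1 / (1 - z)) (0 + j) 0 x - Lx (1 / z) (1 / (1 - z)) 0 0 x - real j / z\<bar> < lam" if "j \<le> k1" for j
        unfolding not_le[symmetric] using nx x that by blast
      have n2: "\<bar>R.Lx (1 / w) (1 / (1 - w)) (m - k1 + j) n x - R.Lx (1 / w) (1 / (1 - w)) (m - k1) n x - real j / w\<bar> < lam" if "j \<le> k1" for j
        unfolding not_le[symmetric] using nx x that by blast
      have n3: "R.Lx (1 / w) 0 m n x \<le> R.Lx 0 (1 / (1 - w)) m n x"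
        unfolding not_less[symmetric] using nx x by blast
      have n4: "S.Lx (1 / z) 0 (m - k1) n x < s - y - real k1 / z - lam"
        unfolding not_le[symmetric] using nx x by blast
      define W where "W = (\<lambda>k l. X k l x)"
      have W: "0 \<le> W i j" for i j by (simp add: W_def nonneg)
      have RW: "R.Lx p q' i j x = bl p q' (box_reverse m n W) i j" for p q' i j
      proof -
        have "(\<lambda>k l. box_reverse m n X k l x) = box_reverse m n W"
          by (auto simp: fun_eq_iff box_reverse_def W_def)
        then show ?thesis by simp
      qed
      have SW: "S.Lx p q' i j x = bl p q' (\<lambda>i j. W (i + k1) j) i j" for p q' i j by (simp add: W_def)
      have S_bound: "\<bar>bl (1 / z) 0 W j 0 - real j / z\<bar> < lam" if "j \<le> k1" for j
        using n1[OF that] by (simp add: W_def bl_row_0)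
      obtain k where k: "k \<in> {1..m}" "bl (1 / z) 0 W m n \<le> bl (1 / z) 0 W k 0 + bl_to m n W k 1"
        using horizontal_exit_decomposition[of W "1 / z" m n] W z mn by auto
      have H: "s - y \<le> bl (1 / z) 0 W m n" "bl 0 0 W m n + (3 * lam + real k1 * a / q\<^sup>2 + 1 / q) < bl (1 / z) 0 W m n"
        using xE by (auto simp: W_def)
      show False
      proof (cases "k \<le> k1")
        case True
        have g: "bl_to m n W 1 1 \<le> bl 0 0 W m n"
          using bl_axis_plus_bl_to_le[of W 0 0 1 m n] W mn by simp
        \<comment> \<open>Reversal turns differences in the starting column into row increments from
          a fixed origin, to which the exit comparison applies.\<close>
        have "bl (1 / w) (1 / (1 - w)) (box_reverse m n W) m n - bl (1 / w) (1 / (1 - w)) (box_reverse m n W) (m + 1 - k) n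
          \<le> bl 0 0 (box_reverse m n W) m n - bl 0 0 (box_reverse m n W) (m + 1 - k) n"
        proof (rule bl_increment_ge_of_vertical_exit[where ?i1.0=m])
          show "bl (1 / w) 0 (box_reverse m n W) m n \<le> bl 0 (1 / (1 - w)) (box_reverse m n W) m n"
            using n3 unfolding RW .
        qed (use w k in \<open>auto simp: box_reverse_def W\<close>)
        then have inc: "bl (1 / w) (1 / (1 - w)) (box_reverse m n W) m n - bl (1 / w) (1 / (1 - w)) (box_reverse m n W) (m + 1 - k) n
          \<le> bl_to m n W 1 1 - bl_to m n W k 1"
          by (simp add: bl_to_def)
        \<comment> \<open>The reversed increment spans only \<open>k - 1\<close> columns, which
          explains the loss \<open>1 / w\<close>. Both its ends are measured from column
          \<open>m - k1\<close>, which uses two of the three \<open>lam\<close>; the third belongs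
          to the axis walk.\<close>
        have "m - k1 + k1 = m" "m - k1 + (k1 + 1 - k) = m + 1 - k" "k1 + 1 - k \<le> k1"
          using k1 k True by auto
        then have "real k1 / w - real (k1 + 1 - k) / w - 2 * lam <
          bl (1 / w) (1 / (1 - w)) (box_reverse m n W) m n - bl (1 / w) (1 / (1 - w)) (box_reverse m n W) (m + 1 - k) n"
          using n2[of k1] n2[of "k1 + 1 - k"] unfolding RW by (auto simp: abs_less_iff)
        moreover have "real (k1 + 1 - k) = real k1 + 1 - real k" using True by (simp add: of_nat_diff)
        ultimately have "real k / w - 1 / w - 2 * lam < bl_to m n W 1 1 - bl_to m n W k 1"
          using inc by (simp add: add_divide_distrib diff_divide_distrib)
        then have "bl (1 / z) 0 W m n < bl 0 0 W m n + 3 * lam + real k * (1 / z - 1 / w) + 1 / w"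
          using g k(2) S_bound[OF True] by (simp add: abs_less_iff right_diff_distrib)
        also have "\<dots> \<le> bl 0 0 W m n + 3 * lam + real k1 * (a / q\<^sup>2) + 1 / q"
        proof (intro order_refl add_mono mult_mono)
          have "1 / z - 1 / w = a / (z * w)" using z w by (simp add: w_def field_simps)
          also have "\<dots> \<le> a / q\<^sup>2" unfolding power2_eq_square using z w q a by (intro divide_left_mono mult_mono) auto
          finally show "1 / z - 1 / w \<le> a / q\<^sup>2" .
          show "0 \<le> 1 / z - 1 / w" using z w by (simp add: field_simps)
        qed (use True w q in \<open>auto simp: field_simps\<close>)
        finally show False using H(2) by simp
      next
        case False
        \<comment> \<open>For a late exit the origin moves to column \<open>k1\<close>: the axis
          weights up to there are bounded by the walk, and the rest is a passage time of the shifted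
          field.\<close>
        define W' where "W' = (\<lambda>i j. W (i + k1) j)"
        have "bl (1 / z) 0 W' (k - k1) 0 + bl_to (m - k1) n W' (k - k1) 1 \<le> bl (1 / z) 0 W' (m - k1) n"
          using k k1 False z mn W by (intro bl_axis_plus_bl_to_le) (auto simp: W'_def)
        moreover have "bl_to (m - k1) n W' (k - k1) 1 = bl_to m n W k 1"
          unfolding W'_def using k1 False by (subst bl_to_shift) auto
        moreover have "bl (1 / z) 0 W' (k - k1) 0 = bl (1 / z) 0 W k 0 - bl (1 / z) 0 W k1 0"
        proof -
          have "bl p q' (\<lambda>i j. W (i + k1) j) i 0 = bl p q' W (i + k1) 0 - bl p q' W k1 0" for p q' i
            by (induction i) auto
          from this[of "1 / z" 0 "k - k1"] show ?thesis using False by (simp add: W'_def)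
        qed
        moreover have "bl (1 / z) 0 W' (m - k1) n < s - y - real k1 / z - lam"
          using n4 unfolding SW W'_def .
        ultimately show False using k(2) S_bound[of k1] H(1) by (simp add: abs_less_iff)
      qed
    qed
  qed measurable
  also have "\<dots> \<le> prob ?E1 + prob ?E2 + prob ?E3 + prob ?E4"
    by (intro order_trans[OF measure_Un_le] add_mono order_refl; measurable)
  also have "\<dots> \<le> 2 * exp (2 * real k1 * \<theta>\<^sup>2 / q\<^sup>2 - \<theta> * lam) + 2 * exp (2 * real k1 * \<theta>\<^sup>2 / q\<^sup>2 - \<theta> * lam) +
    (exp (- s * a ^ 3) + 4 / (\<tau> * s * a ^ 3) + 9 * \<tau> / q ^ 4) +
    exp (3 / 2 * s * b ^ 3 / q ^ 4 + b * (y + lam) - real k1 * b\<^sup>2 / 2)"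
    by (intro add_mono p1 p2 p3 p4)
  finally show ?thesis by simp
qed

text \<open>The upper tail is immediate, since the critical stationary model dominates the bulk. For
  the lower tail, that model is within \<open>y\<close> of \<open>s\<close> and equals one of its
  one-sided versions; the gain of either over the bulk is bounded by the horizontal estimate or by
  its transpose.\<close>

lemma bulk_deviation:
  fixes m n k1 :: nat and a b \<tau> q \<theta> lam y :: real
  defines "z \<equiv> crit m n" and "s \<equiv> lpp_mean m n"
  assumes mn: "1 \<le> m" "1 \<le> n" and k1: "1 \<le> k1" "k1 < m" "k1 < n" and a: "0 < a" and \<tau>: "0 < \<tau>" "\<tau> \<le> 1"
    and b: "0 < b" and q: "0 < q" "q + b \<le> z" "z + b \<le> 1 - q" "q + 2 * a \<le> z" "z + 2 * a \<le> 1 - q"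
    and \<theta>: "0 < \<theta>" "\<theta> \<le> q / 2" and y: "0 < y" and lam: "0 \<le> lam"
  shows "prob {x \<in> space M. y + (3 * lam + real k1 * a / q\<^sup>2 + 1 / q) < \<bar>Lx 0 0 m n x - s\<bar>} \<le>
    2 * (2 / b + 3 / 2 * s * b\<^sup>2 / q ^ 4) / y + 2 * (4 * exp (2 * real k1 * \<theta>\<^sup>2 / q\<^sup>2 - \<theta> * lam) +
    (exp (- s * a ^ 3) + 4 / (\<tau> * s * a ^ 3) + 9 * \<tau> / q ^ 4) +
    exp (3 / 2 * s * b ^ 3 / q ^ 4 + b * (y + lam) - real k1 * b\<^sup>2 / 2))"
proof -
  define v where "v = 3 * lam + real k1 * a / q\<^sup>2 + 1 / q"
  have v: "0 \<le> v" using lam a q by (simp add: v_def)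
  interpret T: exp_field M "\<lambda>i j. X j i" by (rule exp_field_transpose)
  have z01: "0 < z" "z < 1" using q b by linarith+
  have \<tau>a: "0 < \<tau> * a" "\<tau> * a \<le> a" using \<tau> a by auto
  have zT: "crit n m = 1 - z" using crit_swap[OF mn] by (simp add: z_def)
  have sT: "lpp_mean n m = s" by (simp add: s_def lpp_mean_swap)
  have LT: "T.Lx p q' n m x = Lx q' p m n x" for p q' x
    using bl_transpose[of p q' "\<lambda>k l. X k l x" n m] by simp
  let ?B = "4 * exp (2 * real k1 * \<theta>\<^sup>2 / q\<^sup>2 - \<theta> * lam) +
    (exp (- s * a ^ 3) + 4 / (\<tau> * s * a ^ 3) + 9 * \<tau> / q ^ 4) +
    exp (3 / 2 * s * b ^ 3 / q ^ 4 + b * (y + lam) - real k1 * b\<^sup>2 / 2)"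
  let ?D = "{x \<in> space M. y \<le> \<bar>Lx (1 / z) (1 / (1 - z)) m n x - stat_mean m n z\<bar>}"
  let ?H = "{x \<in> space M. s - y \<le> Lx (1 / z) 0 m n x \<and> Lx 0 0 m n x + v < Lx (1 / z) 0 m n x}"
  let ?V = "{x \<in> space M. s - y \<le> Lx 0 (1 / (1 - z)) m n x \<and> Lx 0 0 m n x + v < Lx 0 (1 / (1 - z)) m n x}"
  have D: "prob ?D \<le> 2 * (2 / b + 3 / 2 * s * b\<^sup>2 / q ^ 4) / y"
  proof -
    have "prob ?D \<le> 2 * (2 / b + 3 / 2 * b * s * (2 * \<bar>z - crit m n\<bar> + b) / q ^ 4) / y"
      unfolding s_def using q b y by (intro stationary_deviation mn) auto
    also have "3 / 2 * b * s * (2 * \<bar>z - crit m n\<bar> + b) = 3 / 2 * s * b\<^sup>2"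
      by (simp add: z_def power2_eq_square)
    finally show ?thesis .
  qed
  have H: "prob ?H \<le> ?B"
    unfolding v_def s_def z_def
    by (rule horizontal_excess) (use mn k1 a \<tau> b q \<theta> \<tau>a in \<open>auto simp: z_def\<close>)
  have V: "prob ?V \<le> ?B"
  proof -
    have "prob {x \<in> space M. lpp_mean n m - y \<le> T.Lx (1 / crit n m) 0 n m x \<and>
      T.Lx 0 0 n m x + (3 * lam + real k1 * a / q\<^sup>2 + 1 / q) < T.Lx (1 / crit n m) 0 n m x} \<le>
      4 * exp (2 * real k1 * \<theta>\<^sup>2 / q\<^sup>2 - \<theta> * lam) +
      (exp (- lpp_mean n m * a ^ 3) + 4 / (\<tau> * lpp_mean n m * a ^ 3) + 9 * \<tau> / q ^ 4) +
      exp (3 / 2 * lpp_mean n m * b ^ 3 / q ^ 4 + b * (y + lam) - real k1 * b\<^sup>2 / 2)"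
      by (rule T.horizontal_excess) (use mn k1 a \<tau> b q \<theta> \<tau>a zT in auto)
    then show ?thesis unfolding LT zT sT v_def .
  qed
  have "prob {x \<in> space M. y + v < \<bar>Lx 0 0 m n x - s\<bar>} \<le> prob (?D \<union> ?H \<union> ?V)"
  proof (rule finite_measure_mono)
    show "{x \<in> space M. y + v < \<bar>Lx 0 0 m n x - s\<bar>} \<subseteq> ?D \<union> ?H \<union> ?V"
    proof (rule subsetI, rule ccontr)
      fix x assume x: "x \<in> {x \<in> space M. y + v < \<bar>Lx 0 0 m n x - s\<bar>}" and nx: "x \<notin> ?D \<union> ?H \<union> ?V"
      have d: "\<bar>Lx (1 / z) (1 / (1 - z)) m n x - s\<bar> < y"
        using x nx stat_mean_crit[OF mn] by (auto simp: z_def s_def)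
      have "Lx 0 0 m n x \<le> Lx (1 / z) (1 / (1 - z)) m n x"
        using z01 by (intro bl_mono_boundary nonneg) auto
      then have low: "Lx 0 0 m n x < s - (y + v)"
        using x d v by (auto simp: abs_if split: if_splits)
      have mx: "Lx (1 / z) (1 / (1 - z)) m n x = max (Lx (1 / z) 0 m n x) (Lx 0 (1 / (1 - z)) m n x)"
        using z01 by (intro Lx_max) auto
      have big: "s - y < Lx (1 / z) (1 / (1 - z)) m n x" using d by (simp add: abs_less_iff)
      show False
      proof (cases "Lx (1 / z) 0 m n x \<le> Lx 0 (1 / (1 - z)) m n x")
        case True
        then have "x \<in> ?V" using big low mx x by (simp only: mem_Collect_eq max_absorb2) auto
        then show False using nx by blast
      next
        case False
        then have "x \<in> ?H" using big low mx x by (simp only: mem_Collect_eq max_absorb1) auto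
        then show False using nx by blast
      qed
    qed
  qed measurable
  also have "\<dots> \<le> prob ?D + prob ?H + prob ?V"
    by (intro order_trans[OF measure_Un_le] add_mono order_refl; measurable)
  also have "\<dots> \<le> 2 * (2 / b + 3 / 2 * s * b\<^sup>2 / q ^ 4) / y + ?B + ?B"
    by (intro add_mono D H V)
  finally show ?thesis unfolding v_def by simp
qed

end


section \<open>Modulus of continuity along a row\<close>

lemma crit_mono:
  assumes "1 \<le> n" "m \<le> m'"
  shows "crit m n \<le> crit m' n"
proof -
  have "0 < sqrt (real n)" "0 \<le> sqrt (real m)" "sqrt (real m) \<le> sqrt (real m')" using assms by auto
  then have "0 < sqrt (real m) + sqrt (real n)" "0 < sqrt (real m') + sqrt (real n)"
    "sqrt (real m) * sqrt (real n) \<le> sqrt (real m') * sqrt (real n)"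
    by (auto intro: add_nonneg_pos mult_right_mono)
  then show ?thesis unfolding crit_def by (simp add: divide_le_eq pos_le_divide_eq field_simps)
qed

text \<open>The derivative of \<open>lpp_mean\<close> in its first argument is
  \<open>1 / crit\<close>, which decreases with the column, so a mean increment lies between the
  drifts at the two ends.\<close>

lemma lpp_mean_increment:
  assumes "1 \<le> k" "k \<le> k'" "1 \<le> n"
  shows "(real k' - real k) / crit k' n \<le> lpp_mean k' n - lpp_mean k n"
    and "lpp_mean k' n - lpp_mean k n \<le> (real k' - real k) / crit k n"
proof -
  define A B N where "A = sqrt (real k)" and "B = sqrt (real k')" and "N = sqrt (real n)"
  have pos: "0 < A" "A \<le> B" "0 < B" "0 < N" using assms by (auto simp: A_def B_def N_def)
  have k: "real k = A\<^sup>2" "real k' = B\<^sup>2" by (auto simp: A_def B_def)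
  have mean: "lpp_mean k' n - lpp_mean k n = (B - A) * (A + B + 2 * N)"
    unfolding lpp_mean_def A_def[symmetric] B_def[symmetric] N_def[symmetric] by (simp add: power2_eq_square algebra_simps)
  have c1: "(real k' - real k) / crit k' n = (B - A) * ((A + B) * (1 + N / B))"
    unfolding crit_def A_def[symmetric] B_def[symmetric] N_def[symmetric] k using pos by (simp add: field_simps power2_eq_square)
  have c2: "(real k' - real k) / crit k n = (B - A) * ((A + B) * (1 + N / A))"
    unfolding crit_def A_def[symmetric] B_def[symmetric] N_def[symmetric] k using pos by (simp add: field_simps power2_eq_square)
  have "(A + B) * (1 + N / B) = A + B + N * (A / B) + N"
    using pos by (simp add: field_simps)
  moreover have "N * (A / B) \<le> N * 1" using pos by (intro mult_left_mono) auto
  ultimately have "(A + B) * (1 + N / B) \<le> A + B + 2 * N" by simp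
  then show "(real k' - real k) / crit k' n \<le> lpp_mean k' n - lpp_mean k n"
    unfolding c1 mean using pos by (intro mult_left_mono) auto
  have "(A + B) * (1 + N / A) = A + B + N * (B / A) + N"
    using pos by (simp add: field_simps)
  moreover have "N * 1 \<le> N * (B / A)" using pos by (intro mult_left_mono) auto
  ultimately have "A + B + 2 * N \<le> (A + B) * (1 + N / A)" by simp
  then show "lpp_mean k' n - lpp_mean k n \<le> (real k' - real k) / crit k n"
    unfolding c2 mean using pos by (intro mult_left_mono) auto
qed

text \<open>Blocks start at multiples of \<open>K\<close> after \<open>m0\<close> but are watched
  over \<open>2 * K\<close> columns, so a pair at distance at most \<open>K\<close> lies in the
  window of the block that holds its left end. Passing through the start of the block doubles
  \<open>lam\<close>.\<close>

lemma block_increments: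
  fixes f :: "nat \<Rightarrow> real"
  assumes K: "1 \<le> K" and walk: "\<And>r j. r < R \<Longrightarrow> j \<le> 2 * K \<Longrightarrow> \<bar>f (m0 + r * K + j) - f (m0 + r * K) - real j * c\<bar> < lam"
    and k: "m0 \<le> k" "k \<le> k'" "k' \<le> k + K" "k < m0 + R * K"
  shows "\<bar>f k' - f k - (real k' - real k) * c\<bar> < 2 * lam"
proof -
  define r where "r = (k - m0) div K"
  define j where "j = (k - m0) mod K"
  have kj: "k = m0 + r * K + j" using k unfolding r_def j_def by (metis div_mult_mod_eq le_add_diff_inverse add.assoc)
  have j: "j < K" using K by (simp add: j_def)
  have r: "r < R" unfolding r_def using k K by (intro less_mult_imp_div_less) auto
  define j' where "j' = k' - (m0 + r * K)"
  have k'j: "k' = m0 + r * K + j'" using k kj by (simp add: j'_def)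
  have j': "j' \<le> 2 * K" using k kj k'j j by auto
  show ?thesis
    using walk[OF r j'] walk[OF r, of j] j unfolding kj[symmetric] k'j[symmetric]
    by (simp add: kj k'j abs_less_iff algebra_simps)
qed

context exp_field begin

text \<open>Two exit events control the whole window: for \<open>wm\<close> a horizontal exit at the
  left end \<open>m0\<close> persists to the right, for \<open>wp\<close> a vertical exit at the
  right end \<open>m1\<close> persists to the left. Bulk increments then lie between walks of drifts
  \<open>1 / wp\<close> and \<open>1 / wm\<close>, and the increments of \<open>lpp_mean\<close> lie
  between these same drifts.\<close>

lemma row_modulus:
  fixes n m0 m1 K R :: nat and a \<tau> q \<theta> lam :: real
  defines "wm \<equiv> crit m0 n - a" and "wp \<equiv> crit m1 n + a"
  assumes n: "1 \<le> n" and m: "1 \<le> m0" "m0 \<le> m1" and a: "0 < a" and \<tau>: "0 < \<tau>" "\<tau> \<le> 1"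
    and q: "0 < q" "q \<le> wm - \<tau> * a" "wp + \<tau> * a \<le> 1 - q"
    and K: "1 \<le> K" and R: "m1 \<le> m0 + R * K" and \<theta>: "0 < \<theta>" "\<theta> \<le> q / 2" and lam: "0 \<le> lam"
  shows "prob {x \<in> space M. \<exists>k\<in>{m0..m1}. \<exists>k'\<in>{m0..m1}. k \<le> k' \<and> k' \<le> k + K \<and>
      real K * (wp - wm) / q\<^sup>2 + 2 * lam < \<bar>Lx 0 0 k' n x - Lx 0 0 k n x - (lpp_mean k' n - lpp_mean k n)\<bar>} \<le>
    (exp (- lpp_mean m0 n * a ^ 3) + 4 / (\<tau> * lpp_mean m0 n * a ^ 3) + 9 * \<tau> / q ^ 4) +
    (exp (- lpp_mean m1 n * a ^ 3) + 4 / (\<tau> * lpp_mean m1 n * a ^ 3) + 9 * \<tau> / q ^ 4) +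
    real R * (4 * exp (4 * real K * \<theta>\<^sup>2 / q\<^sup>2 - \<theta> * lam))"
proof -
  have \<tau>a: "0 < \<tau> * a" "\<tau> * a \<le> a" using \<tau> a by auto
  have cm: "crit m0 n \<le> crit m1 n" by (rule crit_mono[OF n m(2)])
  have wm: "q \<le> wm" "0 < wm" "wm < 1" and wp: "q \<le> wp" "0 < wp" "wp < 1" and wmp: "wm \<le> wp"
    using q \<tau>a cm a by (auto simp: wm_def wp_def)
  let ?L = "\<lambda>w. Lx (1 / w) (1 / (1 - w))"
  let ?W = "\<lambda>w r. {x \<in> space M. \<exists>j\<le>2 * K. lam \<le> \<bar>?L w (m0 + r * K + j) n x - ?L w (m0 + r * K) n x - real j / w\<bar>}"
  let ?Eh = "{x \<in> space M. Lx (1 / wm) 0 m0 n x < Lx 0 (1 / (1 - wm)) m0 n x}"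
  let ?Ev = "{x \<in> space M. Lx 0 (1 / (1 - wp)) m1 n x < Lx (1 / wp) 0 m1 n x}"
  let ?bad = "{x \<in> space M. \<exists>k\<in>{m0..m1}. \<exists>k'\<in>{m0..m1}. k \<le> k' \<and> k' \<le> k + K \<and>
      real K * (wp - wm) / q\<^sup>2 + 2 * lam < \<bar>Lx 0 0 k' n x - Lx 0 0 k n x - (lpp_mean k' n - lpp_mean k n)\<bar>}"
  have W: "prob (?W w r) \<le> 2 * exp (4 * real K * \<theta>\<^sup>2 / q\<^sup>2 - \<theta> * lam)" if w: "q \<le> w" "w < 1" for w r
  proof -
    have "prob (?W w r) \<le> 2 * exp (real (2 * K) * (2 * \<theta>\<^sup>2 / w\<^sup>2) - \<theta> * lam)"
      using w q \<theta> K by (intro row_walk_maximal) auto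
    also have "real (2 * K) * (2 * \<theta>\<^sup>2 / w\<^sup>2) \<le> real (2 * K) * (2 * \<theta>\<^sup>2 / q\<^sup>2)"
      using w q by (intro mult_left_mono divide_left_mono power_mono) auto
    finally show ?thesis by (simp add: mult.commute mult.left_commute)
  qed
  have Eh: "prob ?Eh \<le> exp (- lpp_mean m0 n * a ^ 3) + 4 / (\<tau> * lpp_mean m0 n * a ^ 3) + 9 * \<tau> / q ^ 4"
    using q \<tau>a wm wmp a cm by (intro exit_horizontal m n a \<tau>) (auto simp: wm_def wp_def)
  have Ev: "prob ?Ev \<le> exp (- lpp_mean m1 n * a ^ 3) + 4 / (\<tau> * lpp_mean m1 n * a ^ 3) + 9 * \<tau> / q ^ 4"
    using q \<tau>a wm wmp a cm m by (intro exit_vertical n a \<tau>) (auto simp: wm_def wp_def)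
  have "prob ?bad \<le> prob (?Eh \<union> ?Ev \<union> (\<Union>r\<in>{..<R}. ?W wm r \<union> ?W wp r))"
  proof (rule finite_measure_mono)
    show "?bad \<subseteq> ?Eh \<union> ?Ev \<union> (\<Union>r\<in>{..<R}. ?W wm r \<union> ?W wp r)"
    proof (rule subsetI, rule ccontr)
      fix x assume xb: "x \<in> ?bad" and nx: "x \<notin> ?Eh \<union> ?Ev \<union> (\<Union>r\<in>{..<R}. ?W wm r \<union> ?W wp r)"
      have x: "x \<in> space M" using xb by blast
      obtain k k' where k: "m0 \<le> k" "k \<le> k'" "k' \<le> m1" "k' \<le> k + K"
        and big: "real K * (wp - wm) / q\<^sup>2 + 2 * lam < \<bar>Lx 0 0 k' n x - Lx 0 0 k n x - (lpp_mean k' n - lpp_mean k n)\<bar>"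
        using xb by auto
      have nn: "0 \<le> real K * (wp - wm) / q\<^sup>2" using wmp by simp
      have "k \<noteq> k'" using big nn lam by auto
      then have kR: "k < m0 + R * K" using k R by auto
      have walk: "\<bar>?L w (m0 + r * K + j) n x - ?L w (m0 + r * K) n x - real j * (1 / w)\<bar> < lam"
        if "w = wm \<or> w = wp" "r < R" "j \<le> 2 * K" for w r j
      proof -
        have "\<not> lam \<le> \<bar>?L w (m0 + r * K + j) n x - ?L w (m0 + r * K) n x - real j / w\<bar>"
          using nx x that by blast
        then show ?thesis by simp
      qed
      have inc: "\<bar>?L w k' n x - ?L w k n x - (real k' - real k) * (1 / w)\<bar> < 2 * lam" if w: "w = wm \<or> w = wp" for w
        by (rule block_increments[where f="\<lambda>i. ?L w i n x", OF K walk[OF w] k(1,2,4) kR])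
      have up: "Lx 0 0 k' n x - Lx 0 0 k n x \<le> ?L wm k' n x - ?L wm k n x"
        using nx x wm k
        by (intro bl_increment_le_of_horizontal_exit[where ?i0.0=m0] nonneg) (auto simp: not_less)
      have low: "?L wp k' n x - ?L wp k n x \<le> Lx 0 0 k' n x - Lx 0 0 k n x"
        using nx x wp k
        by (intro bl_increment_ge_of_vertical_exit[where ?i1.0=m1] nonneg) (auto simp: not_less)
      have kk: "0 \<le> real k' - real k" "real k' - real k \<le> real K" using k by auto
      have k1: "1 \<le> k" using k m by simp
      have ck: "wm \<le> crit k n" "crit k' n \<le> wp" "0 < crit k n" "0 < crit k' n"
        using crit_mono[OF n k(1)] crit_mono[OF n k(3)] a crit_bounds[of k n] crit_bounds[of k' n] n k1 k
        by (auto simp: wm_def wp_def)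
      have mu: "lpp_mean k' n - lpp_mean k n \<le> (real k' - real k) / wm"
        using lpp_mean_increment(2)[OF k1 k(2) n] divide_left_mono[OF ck(1) kk(1)] ck wm by simp
      have ml: "(real k' - real k) / wp \<le> lpp_mean k' n - lpp_mean k n"
        using lpp_mean_increment(1)[OF k1 k(2) n] divide_left_mono[OF ck(2) kk(1)] ck wp by simp
      have "(real k' - real k) * (1 / wm - 1 / wp) \<le> real K * ((wp - wm) / q\<^sup>2)"
      proof (intro mult_mono kk)
        have "1 / wm - 1 / wp = (wp - wm) / (wm * wp)" using wm wp by (simp add: field_simps)
        also have "\<dots> \<le> (wp - wm) / q\<^sup>2"
          unfolding power2_eq_square using wm wp wmp q by (intro divide_left_mono mult_mono) auto
        finally show "1 / wm - 1 / wp \<le> (wp - wm) / q\<^sup>2" .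
      qed (use wm wp wmp in \<open>auto simp: field_simps\<close>)
      then have "(real k' - real k) / wm - (real k' - real k) / wp \<le> real K * (wp - wm) / q\<^sup>2"
        by (simp add: right_diff_distrib)
      then show False using up low mu ml inc[of wm] inc[of wp] big by (auto simp: abs_less_iff abs_if split: if_splits)
    qed
  qed measurable
  also have "\<dots> \<le> prob ?Eh + prob ?Ev + prob (\<Union>r\<in>{..<R}. ?W wm r \<union> ?W wp r)"
    by (intro order_trans[OF measure_Un_le] add_mono order_refl; measurable)
  also have "prob (\<Union>r\<in>{..<R}. ?W wm r \<union> ?W wp r) \<le> (\<Sum>r\<in>{..<R}. prob (?W wm r \<union> ?W wp r))"
    by (rule measure_UNION_le) (simp, measurable)
  \<comment> \<open>Four exponentials per block: two walks, each in both directions.\<close>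
  also have "\<dots> \<le> (\<Sum>r\<in>{..<R}. 4 * exp (4 * real K * \<theta>\<^sup>2 / q\<^sup>2 - \<theta> * lam))"
  proof (rule sum_mono)
    fix r
    have "prob (?W wm r \<union> ?W wp r) \<le> prob (?W wm r) + prob (?W wp r)"
      by (rule measure_Un_le) measurable
    also have "\<dots> \<le> 2 * exp (4 * real K * \<theta>\<^sup>2 / q\<^sup>2 - \<theta> * lam) + 2 * exp (4 * real K * \<theta>\<^sup>2 / q\<^sup>2 - \<theta> * lam)"
      by (intro add_mono W wm wp)
    finally show "prob (?W wm r \<union> ?W wp r) \<le> 4 * exp (4 * real K * \<theta>\<^sup>2 / q\<^sup>2 - \<theta> * lam)" by simp
  qed
  also have "\<dots> = real R * (4 * exp (4 * real K * \<theta>\<^sup>2 / q\<^sup>2 - \<theta> * lam))" by simp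
  finally show ?thesis using Eh Ev by linarith
qed

end

text \<open>Here \<open>t\<close> stands for \<open>n^(1/3)\<close> and \<open>\<kappa> / t\<close>
  for the distance to the critical parameter. The term \<open>9 * \<tau> / q ^ 4\<close> does not
  improve with \<open>\<kappa>\<close>, so \<open>\<tau>\<close> is fixed first.\<close>

lemma exit_parameters:
  assumes "0 < \<epsilon>" "0 < q"
  obtains \<tau> \<kappa> :: real where "0 < \<tau>" "\<tau> \<le> 1" "0 < \<kappa>"
    "\<And>s t. 0 < t \<Longrightarrow> t ^ 3 \<le> s \<Longrightarrow> exp (- s * (\<kappa> / t) ^ 3) + 4 / (\<tau> * s * (\<kappa> / t) ^ 3) + 9 * \<tau> / q ^ 4 \<le> \<epsilon>"
proof -
  define \<tau> where "\<tau> = min 1 (\<epsilon> * q ^ 4 / 27)"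
  have \<tau>: "0 < \<tau>" "\<tau> \<le> 1" using assms by (auto simp: \<tau>_def)
  have "9 * \<tau> \<le> \<epsilon> / 3 * q ^ 4" unfolding \<tau>_def by (simp add: min_le_iff_disj)
  then have t1: "9 * \<tau> / q ^ 4 \<le> \<epsilon> / 3" using assms by (simp add: divide_le_eq)
  have "((\<lambda>k. exp (- (k ^ 3)) + 4 / (\<tau> * k ^ 3)) \<longlongrightarrow> 0) at_top"
    using \<tau> by real_asymp
  then have "eventually (\<lambda>k::real. exp (- (k ^ 3)) + 4 / (\<tau> * k ^ 3) < \<epsilon> / 3) at_top"
    using assms by (intro order_tendstoD) auto
  moreover have "eventually (\<lambda>k::real. 0 < k) at_top" by (rule eventually_gt_at_top)
  ultimately have "eventually (\<lambda>k::real. exp (- (k ^ 3)) + 4 / (\<tau> * k ^ 3) < \<epsilon> / 3 \<and> 0 < k) at_top"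
    by eventually_elim simp
  then obtain \<kappa> :: real where \<kappa>: "exp (- (\<kappa> ^ 3)) + 4 / (\<tau> * \<kappa> ^ 3) < \<epsilon> / 3" "0 < \<kappa>"
    using eventually_happens trivial_limit_at_top_linorder by blast
  have "exp (- s * (\<kappa> / t) ^ 3) + 4 / (\<tau> * s * (\<kappa> / t) ^ 3) + 9 * \<tau> / q ^ 4 \<le> \<epsilon>" if t: "0 < t" "t ^ 3 \<le> s" for s t
  proof -
    have "t ^ 3 * (\<kappa> / t) ^ 3 \<le> s * (\<kappa> / t) ^ 3" using t \<kappa> by (intro mult_right_mono) auto
    also have "t ^ 3 * (\<kappa> / t) ^ 3 = \<kappa> ^ 3" using t by (simp add: power_divide)
    finally have le: "\<kappa> ^ 3 \<le> s * (\<kappa> / t) ^ 3" .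
    have "exp (- (s * (\<kappa> / t) ^ 3)) \<le> exp (- (\<kappa> ^ 3))" using le by simp
    moreover have "4 / (\<tau> * (s * (\<kappa> / t) ^ 3)) \<le> 4 / (\<tau> * \<kappa> ^ 3)"
      using le \<tau> \<kappa> t less_le_trans[OF zero_less_power[OF t(1)] t(2)] by (intro divide_left_mono mult_left_mono mult_pos_pos) auto
    ultimately have "exp (- (s * (\<kappa> / t) ^ 3)) + 4 / (\<tau> * (s * (\<kappa> / t) ^ 3)) + 9 * \<tau> / q ^ 4 \<le> \<epsilon>"
      using \<kappa>(1) t1 assms(1) by linarith
    then show ?thesis by (simp add: mult.assoc)
  qed
  with \<tau> \<kappa>(2) that show ?thesis by blast
qed


definition cbrt :: "nat \<Rightarrow> real" where
  "cbrt n = real n powr (1 / 3)"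

lemma cbrt_cube: "cbrt n ^ 3 = real n"
proof (cases "n = 0")
  case False
  have "(real n powr (1 / 3)) ^ 3 = real n powr (real 3 * (1 / 3))"
    using False by (intro powr_power) simp
  then show ?thesis using False by (simp add: cbrt_def)
qed (simp add: cbrt_def)

lemma cbrt_at_top: "filterlim cbrt at_top sequentially"
  unfolding cbrt_def by real_asymp

lemma lpp_mean_ge: "cbrt n ^ 3 \<le> lpp_mean m n"
proof -
  have "(sqrt (real n))\<^sup>2 \<le> (sqrt (real m) + sqrt (real n))\<^sup>2" by (intro power_mono) auto
  then show ?thesis by (simp add: lpp_mean_def cbrt_cube)
qed

context exp_field begin

text \<open>One large \<open>r\<close> governs everything, with \<open>t = cbrt n\<close>. Windows
  of about \<open>t\<^sup>2 / r\<^sup>2\<close> columns and \<open>\<theta> = r / t\<close> keep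
  \<open>real K * \<theta>\<^sup>2\<close> below 1, so a block fails with probability of order
  \<open>exp (- \<eta> * r / 4)\<close>, while there are only O(r^2) blocks. The drift gap
  contributes a multiple of \<open>t / r\<^sup>2\<close>.\<close>

lemma row_modulus_eventually:
  fixes m0 m1 :: "nat \<Rightarrow> nat" and A A' q \<epsilon> \<eta> :: real
  assumes pos: "0 < A" "0 < A'" "0 < q" "0 < \<epsilon>" "0 < \<eta>"
    and ev: "eventually (\<lambda>n. 1 \<le> m0 n \<and> m0 n \<le> m1 n \<and> real (m1 n) - real (m0 n) \<le> A * (cbrt n)\<^sup>2 \<and>
      crit (m1 n) n - crit (m0 n) n \<le> A' / cbrt n \<and> 2 * q \<le> crit (m0 n) n \<and> crit (m1 n) n \<le> 1 - 2 * q) sequentially"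
  shows "\<exists>\<delta>>0. eventually (\<lambda>n. prob {x \<in> space M. \<exists>k\<in>{m0 n..m1 n}. \<exists>k'\<in>{m0 n..m1 n}. k \<le> k' \<and>
      real k' \<le> real k + \<delta> * (cbrt n)\<^sup>2 \<and>
      \<eta> * cbrt n < \<bar>Lx 0 0 k' n x - Lx 0 0 k n x - (lpp_mean k' n - lpp_mean k n)\<bar>} \<le> \<epsilon>) sequentially"
proof -
  obtain \<tau> \<kappa> where \<tau>: "0 < \<tau>" "\<tau> \<le> 1" and \<kappa>: "0 < \<kappa>" and exit:
    "\<And>s t. 0 < t \<Longrightarrow> t ^ 3 \<le> s \<Longrightarrow> exp (- s * (\<kappa> / t) ^ 3) + 4 / (\<tau> * s * (\<kappa> / t) ^ 3) + 9 * \<tau> / q ^ 4 \<le> \<epsilon> / 4"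
    using exit_parameters[of "\<epsilon> / 4" q] pos by auto
  have "((\<lambda>r. (2 * A * r\<^sup>2 + 1) * (4 * exp (4 / q\<^sup>2 - \<eta> / 4 * r))) \<longlongrightarrow> 0) at_top"
    using pos by real_asymp
  then have "eventually (\<lambda>r. (2 * A * r\<^sup>2 + 1) * (4 * exp (4 / q\<^sup>2 - \<eta> / 4 * r)) < \<epsilon> / 2) at_top"
    using pos by (intro order_tendstoD) auto
  moreover have "((\<lambda>r::real. (2 * \<kappa> + A') / (r\<^sup>2 * q\<^sup>2)) \<longlongrightarrow> 0) at_top"
    using pos \<kappa> by real_asymp
  then have "eventually (\<lambda>r. (2 * \<kappa> + A') / (r\<^sup>2 * q\<^sup>2) < \<eta> / 2) at_top"
    using pos by (intro order_tendstoD) auto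
  moreover have "eventually (\<lambda>r::real. 0 < r) at_top" by (rule eventually_gt_at_top)
  ultimately have "eventually (\<lambda>r. (2 * A * r\<^sup>2 + 1) * (4 * exp (4 / q\<^sup>2 - \<eta> / 4 * r)) < \<epsilon> / 2 \<and>
    (2 * \<kappa> + A') / (r\<^sup>2 * q\<^sup>2) < \<eta> / 2 \<and> 0 < r) at_top"
    by eventually_elim simp
  then obtain r :: real where r: "(2 * A * r\<^sup>2 + 1) * (4 * exp (4 / q\<^sup>2 - \<eta> / 4 * r)) < \<epsilon> / 2"
    "(2 * \<kappa> + A') / (r\<^sup>2 * q\<^sup>2) < \<eta> / 2" "0 < r"
    using eventually_happens trivial_limit_at_top_linorder by blast
  define \<delta> where "\<delta> = 1 / r\<^sup>2"
  have \<delta>: "0 < \<delta>" using r by (simp add: \<delta>_def)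
  \<comment> \<open>These thresholds for \<open>cbrt n\<close> give \<open>2 * a \<le> q\<close> and
    \<open>\<theta> \<le> q / 2\<close>, and make the windows so long that rounding to
    \<open>K\<close> loses at most half.\<close>
  define T where "T = Max {1, 2 * \<kappa> / q, 2 * r / q, 2 * r}"
  have "eventually (\<lambda>n. T \<le> cbrt n) sequentially"
    using cbrt_at_top by (simp add: filterlim_at_top)
  with ev have "eventually (\<lambda>n. prob {x \<in> space M. \<exists>k\<in>{m0 n..m1 n}. \<exists>k'\<in>{m0 n..m1 n}. k \<le> k' \<and>
      real k' \<le> real k + \<delta> * (cbrt n)\<^sup>2 \<and>
      \<eta> * cbrt n < \<bar>Lx 0 0 k' n x - Lx 0 0 k n x - (lpp_mean k' n - lpp_mean k n)\<bar>} \<le> \<epsilon>) sequentially"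
  proof eventually_elim
    case (elim n)
    define t where "t = cbrt n"
    have t: "1 \<le> t" "2 * \<kappa> / q \<le> t" "2 * r / q \<le> t" "2 * r \<le> t" using elim by (auto simp: T_def t_def)
    have t0: "0 < t" using t by simp
    have n: "1 \<le> n" using cbrt_cube[of n] t by (cases n) (auto simp: t_def)
    have m: "1 \<le> m0 n" "m0 n \<le> m1 n" "real (m1 n) - real (m0 n) \<le> A * t\<^sup>2" "crit (m1 n) n - crit (m0 n) n \<le> A' / t"
      "2 * q \<le> crit (m0 n) n" "crit (m1 n) n \<le> 1 - 2 * q"
      using elim by (auto simp: t_def)
    define a where "a = \<kappa> / t"
    have a: "0 < a" "2 * a \<le> q" using \<kappa> t t0 pos by (auto simp: a_def field_simps)
    have \<tau>a: "\<tau> * a \<le> a" using \<tau> a by simp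
    define K where "K = nat \<lfloor>\<delta> * t\<^sup>2\<rfloor>"
    have "4 \<le> \<delta> * t\<^sup>2"
    proof -
      have "(2 * r)\<^sup>2 \<le> t\<^sup>2" using t r by (intro power_mono) auto
      then show ?thesis using r by (simp add: \<delta>_def field_simps power_mult_distrib)
    qed
    then have K: "1 \<le> K" "real K \<le> \<delta> * t\<^sup>2" "\<delta> * t\<^sup>2 / 2 \<le> real K"
      unfolding K_def by (simp_all add: le_nat_floor) linarith+
    define R where "R = nat \<lceil>A * t\<^sup>2 / real K\<rceil>"
    have Rle: "real R \<le> 2 * A * r\<^sup>2 + 1"
    proof -
      have "0 \<le> A * t\<^sup>2 / real K" using pos by simp
      then have "real R \<le> A * t\<^sup>2 / real K + 1" unfolding R_def by linarith
      also have "A * t\<^sup>2 / real K \<le> A * t\<^sup>2 / (\<delta> * t\<^sup>2 / 2)"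
        using K pos \<delta> t0 by (intro divide_left_mono) auto
      also have "\<dots> = 2 * A * r\<^sup>2" using t0 r by (simp add: \<delta>_def)
      finally show ?thesis by simp
    qed
    have RK: "m1 n \<le> m0 n + R * K"
    proof -
      have "A * t\<^sup>2 / real K \<le> real R" unfolding R_def by linarith
      then have "A * t\<^sup>2 \<le> real R * real K" using K by (simp add: divide_le_eq)
      then have "real (m1 n) \<le> real (m0 n + R * K)" using m by simp
      then show ?thesis by linarith
    qed
    define \<theta> where "\<theta> = r / t"
    have \<theta>: "0 < \<theta>" "\<theta> \<le> q / 2" using r t t0 pos by (auto simp: \<theta>_def field_simps)
    define lam where "lam = \<eta> * t / 4"
    let ?wp = "crit (m1 n) n + a" and ?wm = "crit (m0 n) n - a"
    let ?bad = "{x \<in> space M. \<exists>k\<in>{m0 n..m1 n}. \<exists>k'\<in>{m0 n..m1 n}. k \<le> k' \<and>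
      real k' \<le> real k + \<delta> * (cbrt n)\<^sup>2 \<and>
      \<eta> * cbrt n < \<bar>Lx 0 0 k' n x - Lx 0 0 k n x - (lpp_mean k' n - lpp_mean k n)\<bar>}"
    let ?bad' = "{x \<in> space M. \<exists>k\<in>{m0 n..m1 n}. \<exists>k'\<in>{m0 n..m1 n}. k \<le> k' \<and> k' \<le> k + K \<and>
      real K * (?wp - ?wm) / q\<^sup>2 + 2 * lam < \<bar>Lx 0 0 k' n x - Lx 0 0 k n x - (lpp_mean k' n - lpp_mean k n)\<bar>}"
    have small: "real K * (?wp - ?wm) / q\<^sup>2 + 2 * lam \<le> \<eta> * t"
    proof -
      have "?wp - ?wm \<le> (2 * \<kappa> + A') / t" using m by (simp add: a_def add_divide_distrib)
      then have "real K * (?wp - ?wm) \<le> (\<delta> * t\<^sup>2) * ((2 * \<kappa> + A') / t)"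
        using K pos \<kappa> t0 \<delta> a crit_mono[OF n m(2)] by (intro mult_mono) auto
      then have "real K * (?wp - ?wm) / q\<^sup>2 \<le> (\<delta> * t\<^sup>2) * ((2 * \<kappa> + A') / t) / q\<^sup>2"
        by (intro divide_right_mono) auto
      also have "\<dots> = (2 * \<kappa> + A') / (r\<^sup>2 * q\<^sup>2) * t" using t0 by (simp add: \<delta>_def power2_eq_square)
      also have "\<dots> \<le> \<eta> / 2 * t" using r t0 by (intro mult_right_mono) auto
      finally have "real K * (?wp - ?wm) / q\<^sup>2 + 2 * lam \<le> \<eta> / 2 * t + 2 * lam" by (rule add_right_mono)
      also have "\<dots> = \<eta> * t" by (simp add: lam_def)
      finally show ?thesis .
    qed
    have "prob ?bad \<le> prob ?bad'"
    proof (rule finite_measure_mono)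
      show "?bad \<subseteq> ?bad'"
      proof
        fix x assume "x \<in> ?bad"
        then obtain k k' where kk: "x \<in> space M" "k \<in> {m0 n..m1 n}" "k' \<in> {m0 n..m1 n}" "k \<le> k'" "real k' \<le> real k + \<delta> * t\<^sup>2"
          "\<eta> * t < \<bar>Lx 0 0 k' n x - Lx 0 0 k n x - (lpp_mean k' n - lpp_mean k n)\<bar>" by (auto simp: t_def)
        have "real (k' - k) \<le> \<delta> * t\<^sup>2" using kk by (simp add: of_nat_diff)
        then have "k' - k \<le> K" unfolding K_def by (rule le_nat_floor)
        then have "k' \<le> k + K" by simp
        moreover have "real K * (?wp - ?wm) / q\<^sup>2 + 2 * lam < \<bar>Lx 0 0 k' n x - Lx 0 0 k n x - (lpp_mean k' n - lpp_mean k n)\<bar>"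
          using small kk(6) by linarith
        ultimately show "x \<in> ?bad'" using kk(1-4) by blast
      qed
    qed measurable
    also have "\<dots> \<le>
      (exp (- lpp_mean (m0 n) n * a ^ 3) + 4 / (\<tau> * lpp_mean (m0 n) n * a ^ 3) + 9 * \<tau> / q ^ 4) +
      (exp (- lpp_mean (m1 n) n * a ^ 3) + 4 / (\<tau> * lpp_mean (m1 n) n * a ^ 3) + 9 * \<tau> / q ^ 4) +
      real R * (4 * exp (4 * real K * \<theta>\<^sup>2 / q\<^sup>2 - \<theta> * lam))"
    proof (rule row_modulus)
      show "q \<le> ?wm - \<tau> * a" "?wp + \<tau> * a \<le> 1 - q" using m a \<tau>a by linarith+
    qed (use n m a \<tau> pos K RK \<theta> t0 in \<open>auto simp: lam_def\<close>)
    also have "\<dots> \<le> \<epsilon> / 4 + \<epsilon> / 4 + (2 * A * r\<^sup>2 + 1) * (4 * exp (4 / q\<^sup>2 - \<eta> / 4 * r))"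
    proof (intro add_mono)
      show "exp (- lpp_mean (m0 n) n * a ^ 3) + 4 / (\<tau> * lpp_mean (m0 n) n * a ^ 3) + 9 * \<tau> / q ^ 4 \<le> \<epsilon> / 4"
        unfolding a_def by (rule exit[OF t0]) (simp add: t_def lpp_mean_ge)
      show "exp (- lpp_mean (m1 n) n * a ^ 3) + 4 / (\<tau> * lpp_mean (m1 n) n * a ^ 3) + 9 * \<tau> / q ^ 4 \<le> \<epsilon> / 4"
        unfolding a_def by (rule exit[OF t0]) (simp add: t_def lpp_mean_ge)
      have "real K * \<theta>\<^sup>2 \<le> (\<delta> * t\<^sup>2) * \<theta>\<^sup>2" using K by (intro mult_right_mono) auto
      also have "\<dots> = 1" using t0 r by (simp add: \<delta>_def \<theta>_def power_divide)
      finally have "4 * real K * \<theta>\<^sup>2 / q\<^sup>2 \<le> 4 / q\<^sup>2" by (intro divide_right_mono) auto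
      moreover have "\<theta> * lam = \<eta> / 4 * r" using t0 by (simp add: \<theta>_def lam_def)
      ultimately have "4 * exp (4 * real K * \<theta>\<^sup>2 / q\<^sup>2 - \<theta> * lam) \<le> 4 * exp (4 / q\<^sup>2 - \<eta> / 4 * r)" by simp
      then show "real R * (4 * exp (4 * real K * \<theta>\<^sup>2 / q\<^sup>2 - \<theta> * lam)) \<le> (2 * A * r\<^sup>2 + 1) * (4 * exp (4 / q\<^sup>2 - \<eta> / 4 * r))"
        using Rle pos by (intro mult_mono) auto
    qed
    also have "\<dots> \<le> \<epsilon>" using r by simp
    finally show ?case .
  qed
  with \<delta> show ?thesis by blast
qed

text \<open>The scales, with \<open>t = cbrt n\<close>, are \<open>k1\<close> near
  \<open>r ^ 4 * t\<^sup>2\<close>, \<open>lam = r ^ 3 * t\<close>,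
  \<open>\<theta> = 1 / (r\<^sup>2 * t)\<close> and \<open>b = 1 / t\<close>. A walk of
  \<open>k1\<close> steps fluctuates by about \<open>r\<^sup>2 * t\<close>, below
  \<open>lam\<close>, and the gain \<open>real k1 * b\<^sup>2 / 2\<close>, about
  \<open>r ^ 4 / 2\<close>, beats \<open>b * lam = r ^ 3\<close>; hence the powers 3 and 4.\<close>

lemma bulk_tight_eventually:
  fixes m :: "nat \<Rightarrow> nat" and q C \<epsilon> :: real
  assumes pos: "0 < q" "0 < C" "0 < \<epsilon>"
    and ev: "eventually (\<lambda>n. 1 \<le> m n \<and> 2 * q \<le> crit (m n) n \<and> crit (m n) n \<le> 1 - 2 * q \<and>
      lpp_mean (m n) n \<le> C * cbrt n ^ 3) sequentially"
  shows "\<exists>B. eventually (\<lambda>n. prob {x \<in> space M. B * cbrt n < \<bar>Lx 0 0 (m n) n x - lpp_mean (m n) n\<bar>} \<le> \<epsilon>) sequentially"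
proof -
  obtain \<tau> \<kappa> where \<tau>: "0 < \<tau>" "\<tau> \<le> 1" and \<kappa>: "0 < \<kappa>" and exit:
    "\<And>s t. 0 < t \<Longrightarrow> t ^ 3 \<le> s \<Longrightarrow> exp (- s * (\<kappa> / t) ^ 3) + 4 / (\<tau> * s * (\<kappa> / t) ^ 3) + 9 * \<tau> / q ^ 4 \<le> \<epsilon> / 8"
    using exit_parameters[of "\<epsilon> / 8" q] pos by auto
  \<comment> \<open>Chosen so that the bound on the Markov term at \<open>y = y0 * t\<close> is
    exactly \<open>\<epsilon> / 4\<close>.\<close>
  define y0 where "y0 = 4 * (2 * (2 + 3 / 2 * C / q ^ 4)) / \<epsilon>"
  have y0: "0 < y0" using pos by (auto simp: y0_def intro!: divide_pos_pos add_pos_pos)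
  have "((\<lambda>r. 4 * exp (2 / q\<^sup>2 - r)) \<longlongrightarrow> 0) at_top" by real_asymp
  then have "eventually (\<lambda>r. 4 * exp (2 / q\<^sup>2 - r) < \<epsilon> / 8) at_top"
    using pos by (intro order_tendstoD) auto
  \<comment> \<open>The summand \<open>1 / 2\<close> absorbs the rounding of
    \<open>k1\<close>.\<close>
  moreover have "((\<lambda>r. exp (3 / 2 * C / q ^ 4 + y0 + r ^ 3 - r ^ 4 / 2 + 1 / 2)) \<longlongrightarrow> 0) at_top" by real_asymp
  then have "eventually (\<lambda>r. exp (3 / 2 * C / q ^ 4 + y0 + r ^ 3 - r ^ 4 / 2 + 1 / 2) < \<epsilon> / 8) at_top"
    using pos by (intro order_tendstoD) auto
  moreover have "eventually (\<lambda>r::real. 1 < r) at_top" by (rule eventually_gt_at_top)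
  ultimately have "eventually (\<lambda>r. 4 * exp (2 / q\<^sup>2 - r) < \<epsilon> / 8 \<and>
    exp (3 / 2 * C / q ^ 4 + y0 + r ^ 3 - r ^ 4 / 2 + 1 / 2) < \<epsilon> / 8 \<and> 1 < r) at_top"
    by eventually_elim simp
  then obtain r :: real where r: "4 * exp (2 / q\<^sup>2 - r) < \<epsilon> / 8"
    "exp (3 / 2 * C / q ^ 4 + y0 + r ^ 3 - r ^ 4 / 2 + 1 / 2) < \<epsilon> / 8" "1 < r"
    using eventually_happens trivial_limit_at_top_linorder by blast
  define B where "B = y0 + (3 * r ^ 3 + r ^ 4 * \<kappa> / q\<^sup>2 + 1 / q)"
  \<comment> \<open>The last two entries ensure \<open>k1 < m n\<close> and \<open>k1 < n\<close>,
    the others that \<open>a\<close>, \<open>b\<close> and \<open>\<theta>\<close> are small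
    compared with \<open>q\<close>.\<close>
  define T where "T = Max {1, 2 * \<kappa> / q, 2 / q, r ^ 4 / (2 * q)\<^sup>2 + 1, r ^ 4 + 1}"
  have "eventually (\<lambda>n. T \<le> cbrt n) sequentially"
    using cbrt_at_top by (simp add: filterlim_at_top)
  with ev have "eventually (\<lambda>n. prob {x \<in> space M. B * cbrt n < \<bar>Lx 0 0 (m n) n x - lpp_mean (m n) n\<bar>} \<le> \<epsilon>) sequentially"
  proof eventually_elim
    case (elim n)
    define t where "t = cbrt n"
    define z s where "z = crit (m n) n" and "s = lpp_mean (m n) n"
    have t: "1 \<le> t" "2 * \<kappa> / q \<le> t" "2 / q \<le> t" "r ^ 4 / (2 * q)\<^sup>2 < t" "r ^ 4 < t" using elim by (auto simp: T_def t_def)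
    have t0: "0 < t" using t by simp
    have n: "1 \<le> n" using cbrt_cube[of n] t by (cases n) (auto simp: t_def)
    have m: "1 \<le> m n" "2 * q \<le> z" "z \<le> 1 - 2 * q" "s \<le> C * t ^ 3"
      using elim by (auto simp: t_def z_def s_def)
    have s: "t ^ 3 \<le> s" by (simp add: t_def s_def lpp_mean_ge)
    have r0: "0 < r" using r by simp
    define k1 where "k1 = nat \<lfloor>r ^ 4 * t\<^sup>2\<rfloor>"
    have rt: "1 \<le> r ^ 4 * t\<^sup>2"
      using mult_mono[of 1 "r ^ 4" 1 "t\<^sup>2"] r t by (simp add: one_le_power)
    then have k1: "1 \<le> k1" "real k1 \<le> r ^ 4 * t\<^sup>2" "r ^ 4 * t\<^sup>2 - 1 \<le> real k1"
      unfolding k1_def by (simp add: le_nat_floor, linarith, linarith)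
    have k1m: "k1 < m n"
    proof -
      have "r ^ 4 < (2 * q)\<^sup>2 * t" using t(4) pos by (simp add: divide_less_eq mult.commute)
      then have "r ^ 4 * t\<^sup>2 < (2 * q)\<^sup>2 * t * t\<^sup>2" using t0 by (intro mult_strict_right_mono) auto
      also have "\<dots> = t ^ 3 * (2 * q)\<^sup>2" by (simp add: power2_eq_square power3_eq_cube)
      also have "\<dots> \<le> s * z\<^sup>2" using s m pos t0 order_trans[OF zero_le_power s] by (intro mult_mono power_mono) auto
      also have "\<dots> = real (m n)" using crit_param(1)[OF m(1) n] by (simp add: s_def z_def)
      finally show ?thesis using k1 by linarith
    qed
    have k1n: "k1 < n"
    proof -
      have "r ^ 4 * t\<^sup>2 < t * t\<^sup>2" using t(5) t0 by (intro mult_strict_right_mono) auto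
      also have "\<dots> = real n" using cbrt_cube[of n] by (simp add: t_def power2_eq_square power3_eq_cube)
      finally show ?thesis using k1 by linarith
    qed
    define a where "a = \<kappa> / t"
    have a: "0 < a" "2 * a \<le> q" using \<kappa> t t0 pos by (auto simp: a_def field_simps)
    define b where "b = 1 / t"
    have b: "0 < b" "b \<le> q" using t t0 pos by (auto simp: b_def field_simps)
    define \<theta> where "\<theta> = 1 / (r\<^sup>2 * t)"
    have \<theta>: "0 < \<theta>" "\<theta> \<le> q / 2"
    proof -
      have "\<theta> \<le> 1 / t" unfolding \<theta>_def using r t0 by (intro divide_left_mono) (auto simp: one_le_power)
      also have "\<dots> \<le> q / 2" using t t0 pos by (simp add: field_simps)
      finally show "\<theta> \<le> q / 2" .
    qed (use r0 t0 in \<open>simp add: \<theta>_def\<close>)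
    define lam where "lam = r ^ 3 * t"
    define y where "y = y0 * t"
    have y: "0 < y" using y0 t0 by (simp add: y_def)
    have lam: "0 \<le> lam" using r0 t0 by (simp add: lam_def)
    have v: "y + (3 * lam + real k1 * a / q\<^sup>2 + 1 / q) \<le> B * t"
    proof -
      have "real k1 * a \<le> r ^ 4 * t\<^sup>2 * a" using k1 a by (intro mult_right_mono) auto
      also have "\<dots> = r ^ 4 * \<kappa> * t" using t0 by (simp add: a_def power2_eq_square)
      finally have "real k1 * a / q\<^sup>2 \<le> r ^ 4 * \<kappa> * t / q\<^sup>2" by (intro divide_right_mono) auto
      moreover have "1 / q \<le> 1 / q * t" using t pos by (simp add: divide_right_mono)
      ultimately have "y + (3 * lam + real k1 * a / q\<^sup>2 + 1 / q) \<le> y0 * t + (3 * (r ^ 3 * t) + r ^ 4 * \<kappa> * t / q\<^sup>2 + 1 / q * t)"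
        by (simp add: y_def lam_def)
      also have "\<dots> = B * t" by (simp add: B_def algebra_simps)
      finally show ?thesis .
    qed
    have "prob {x \<in> space M. B * cbrt n < \<bar>Lx 0 0 (m n) n x - lpp_mean (m n) n\<bar>} \<le>
      prob {x \<in> space M. y + (3 * lam + real k1 * a / q\<^sup>2 + 1 / q) < \<bar>Lx 0 0 (m n) n x - lpp_mean (m n) n\<bar>}"
      using v by (intro finite_measure_mono) (auto simp: t_def)
    also have "\<dots> \<le> 2 * (2 / b + 3 / 2 * lpp_mean (m n) n * b\<^sup>2 / q ^ 4) / y + 2 * (4 * exp (2 * real k1 * \<theta>\<^sup>2 / q\<^sup>2 - \<theta> * lam) +
      (exp (- lpp_mean (m n) n * a ^ 3) + 4 / (\<tau> * lpp_mean (m n) n * a ^ 3) + 9 * \<tau> / q ^ 4) +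
      exp (3 / 2 * lpp_mean (m n) n * b ^ 3 / q ^ 4 + b * (y + lam) - real k1 * b\<^sup>2 / 2))"
      by (rule bulk_deviation) (use m n k1 k1m k1n a \<tau> b pos \<theta> y lam in \<open>auto simp: z_def\<close>)
    also have "\<dots> \<le> \<epsilon> / 4 + 2 * (\<epsilon> / 8 + \<epsilon> / 8 + \<epsilon> / 8)"
      unfolding s_def[symmetric]
    proof (intro add_mono mult_left_mono)
      have sb: "s * b ^ 3 \<le> C" using m t0 by (simp add: b_def power_divide divide_le_eq)
      have "s * b\<^sup>2 = s * b ^ 3 * t" using t0 by (simp add: b_def power2_eq_square power3_eq_cube)
      also have "\<dots> \<le> C * t" using sb t0 by (intro mult_right_mono) auto
      finally have "3 / 2 * s * b\<^sup>2 / q ^ 4 \<le> 3 / 2 * (C * t) / q ^ 4" by (intro divide_right_mono) auto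
      moreover have "2 / b = 2 * t" by (simp add: b_def)
      ultimately have "2 * (2 / b + 3 / 2 * s * b\<^sup>2 / q ^ 4) \<le> 2 * (2 * t + 3 / 2 * (C * t) / q ^ 4)"
        by (simp only: mult_le_cancel_left_pos[OF zero_less_numeral] add_le_cancel_left)
      then have "2 * (2 / b + 3 / 2 * s * b\<^sup>2 / q ^ 4) / y \<le> 2 * (2 * t + 3 / 2 * (C * t) / q ^ 4) / y"
        using y by (intro divide_right_mono) auto
      also have "\<dots> = 2 * (2 + 3 / 2 * C / q ^ 4) / y0"
      proof -
        have "2 * (2 * t + 3 / 2 * (C * t) / q ^ 4) = 2 * (2 + 3 / 2 * C / q ^ 4) * t" by (simp add: algebra_simps)
        then show ?thesis unfolding y_def using t0 by (simp only: mult_divide_mult_cancel_right)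
      qed
      also have "\<dots> = \<epsilon> / 4"
      proof -
        have "2 * (2 + 3 / 2 * C / q ^ 4) > 0" using pos by (auto intro!: add_pos_pos mult_pos_pos)
        moreover have "D / (4 * D / \<epsilon>) = \<epsilon> / 4" if "0 < D" for D :: real
          using that pos by simp
        ultimately show ?thesis unfolding y0_def by blast
      qed
      finally show "2 * (2 / b + 3 / 2 * s * b\<^sup>2 / q ^ 4) / y \<le> \<epsilon> / 4" .
      have "real k1 * \<theta>\<^sup>2 \<le> r ^ 4 * t\<^sup>2 * \<theta>\<^sup>2" using k1 by (intro mult_right_mono) auto
      also have "\<dots> = 1" using t0 r0 by (simp add: \<theta>_def power_divide power_mult_distrib flip: power_mult)
      finally have "2 * real k1 * \<theta>\<^sup>2 / q\<^sup>2 \<le> 2 / q\<^sup>2" by (intro divide_right_mono) auto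
      moreover have "\<theta> * lam = r" using t0 r0 by (simp add: \<theta>_def lam_def power2_eq_square power3_eq_cube)
      ultimately have "4 * exp (2 * real k1 * \<theta>\<^sup>2 / q\<^sup>2 - \<theta> * lam) \<le> 4 * exp (2 / q\<^sup>2 - r)" by simp
      then show "4 * exp (2 * real k1 * \<theta>\<^sup>2 / q\<^sup>2 - \<theta> * lam) \<le> \<epsilon> / 8" using r by linarith
      show "exp (- s * a ^ 3) + 4 / (\<tau> * s * a ^ 3) + 9 * \<tau> / q ^ 4 \<le> \<epsilon> / 8"
        unfolding a_def by (rule exit[OF t0 s])
      have "3 / 2 * s * b ^ 3 / q ^ 4 \<le> 3 / 2 * C / q ^ 4" using sb by (intro divide_right_mono) auto
      moreover have "b * (y + lam) = y0 + r ^ 3" using t0 by (simp add: b_def y_def lam_def field_simps)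
      moreover have "(r ^ 4 - 1) / 2 \<le> real k1 * b\<^sup>2 / 2"
      proof -
        have "r ^ 4 - 1 \<le> r ^ 4 - b\<^sup>2" using t t0 by (simp add: b_def power_le_one)
        also have "\<dots> = (r ^ 4 * t\<^sup>2 - 1) * b\<^sup>2" using t0 by (simp add: b_def field_simps)
        also have "\<dots> \<le> real k1 * b\<^sup>2" using k1 by (intro mult_right_mono) auto
        finally show ?thesis by simp
      qed
      ultimately have "3 / 2 * s * b ^ 3 / q ^ 4 + b * (y + lam) - real k1 * b\<^sup>2 / 2 \<le> 3 / 2 * C / q ^ 4 + y0 + r ^ 3 - r ^ 4 / 2 + 1 / 2"
        by (simp add: diff_divide_distrib)
      then have "exp (3 / 2 * s * b ^ 3 / q ^ 4 + b * (y + lam) - real k1 * b\<^sup>2 / 2) \<le> exp (3 / 2 * C / q ^ 4 + y0 + r ^ 3 - r ^ 4 / 2 + 1 / 2)"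
        unfolding exp_le_cancel_iff .
      then show "exp (3 / 2 * s * b ^ 3 / q ^ 4 + b * (y + lam) - real k1 * b\<^sup>2 / 2) \<le> \<epsilon> / 8" using r by linarith
    qed simp
    also have "\<dots> = \<epsilon>" by simp
    finally show ?case .
  qed
  then show ?thesis by blast
qed

end


section \<open>Transfer to a field with weights on the axes\<close>

lemma expm_AE_nonneg: "AE x in expm 1. 0 \<le> x"
  unfolding expm_def by (subst AE_density) (auto simp: exponential_density_def)

text \<open>Absolute values make the coordinates nonnegative everywhere and change each of them only
  on a null set.\<close>

lemma exp_field_canonical:
  "exp_field (PiM UNIV (\<lambda>_::nat \<times> nat. expm 1)) (\<lambda>i j y. \<bar>y (i, j)\<bar>)"
proof -
  define P where "P = PiM UNIV (\<lambda>_::nat \<times> nat. expm 1)"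
  interpret P: prob_space P unfolding P_def by (intro prob_space_PiM prob_space_expm) simp
  have sets_P: "sets P = sets (PiM UNIV (\<lambda>_::nat \<times> nat. borel))"
    unfolding P_def by (intro sets_PiM_cong) auto
  have meas: "(\<lambda>y. y k) \<in> borel_measurable P" for k
    by (subst measurable_cong_sets[OF sets_P refl]) (rule measurable_component_singleton, simp)
  have comp: "distr P borel (\<lambda>y. y k) = expm 1" for k
  proof -
    have "distr P borel (\<lambda>y. y k) = distr P (expm 1) (\<lambda>y. y k)" by (intro distr_cong) auto
    also have "\<dots> = expm 1" unfolding P_def by (intro distr_PiM_component prob_space_expm) auto
    finally show ?thesis .
  qed
  have "distr P (PiM UNIV (\<lambda>_. borel)) (\<lambda>x. \<lambda>i\<in>UNIV. x i) = (PiM UNIV (\<lambda>i. distr P borel (\<lambda>x. x i)))"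
  proof -
    have "(\<lambda>x::nat \<times> nat \<Rightarrow> real. \<lambda>i\<in>UNIV. x i) = (\<lambda>x. x)" by (auto simp: restrict_def)
    moreover have "distr P (PiM UNIV (\<lambda>_. borel)) (\<lambda>x. x) = P" by (rule distr_id2) (rule sets_P[symmetric])
    moreover have "(PiM UNIV (\<lambda>i. distr P borel (\<lambda>x. x i))) = P" unfolding comp unfolding P_def ..
    ultimately show ?thesis by (simp only:)
  qed
  then have "P.indep_vars (\<lambda>_. borel) (\<lambda>k y. y k) UNIV"
    using P.indep_vars_iff_distr_eq_PiM'[of UNIV "\<lambda>k y. y k" "\<lambda>_. borel"] meas by blast
  then have "P.indep_vars (\<lambda>_. borel) (\<lambda>k y. \<bar>y k\<bar>) UNIV"
    by (rule P.indep_vars_compose2[where Y="\<lambda>_. abs"]) measurable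
  moreover have "distr P borel (\<lambda>y. \<bar>y k\<bar>) = expm 1" for k
  proof -
    have "distr P borel (\<lambda>y. \<bar>y k\<bar>) = distr (distr P borel (\<lambda>y. y k)) borel abs"
      using meas by (subst distr_distr) (auto simp: comp_def)
    also have "\<dots> = distr (expm 1) borel (\<lambda>x. x)"
      unfolding comp using expm_AE_nonneg by (intro distr_cong_AE) auto
    also have "\<dots> = expm 1" by (rule distr_id2) simp
    finally show ?thesis .
  qed
  moreover have eq: "(\<lambda>(i, j) y. \<bar>y (i, j)\<bar>) = (\<lambda>(k :: nat \<times> nat) (y :: nat \<times> nat \<Rightarrow> real). \<bar>y k\<bar>)"
    by (auto simp: fun_eq_iff)
  ultimately have "exp_field P (\<lambda>i j y. \<bar>y (i, j)\<bar>)"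
    by (intro exp_field.intro exp_field_axioms.intro P.prob_space_axioms) (simp_all only: eq abs_ge_zero)
  then show ?thesis by (simp add: P_def)
qed

text \<open>The given weights on the axes may be arbitrary, even nonmeasurable, functions; with
  zeros in their place every entry is measurable.\<close>

lemma bl_zero_axes: "bl 0 0 W i j = bl 0 0 (\<lambda>i j. if i = 0 \<or> j = 0 then 0 else W i j) i j"
  by (intro bl_cong) auto

definition exp_weights :: "'a measure \<Rightarrow> (nat \<Rightarrow> nat \<Rightarrow> 'a \<Rightarrow> real) \<Rightarrow> bool" where
  "exp_weights M X \<longleftrightarrow> prob_space M \<and>
     prob_space.indep_vars M (\<lambda>_. borel) (\<lambda>(i, j). X i j) ({1..} \<times> {1..}) \<and>
     (\<forall>i\<ge>1. \<forall>j\<ge>1. X i j \<in> borel_measurable M \<and> distr M borel (X i j) = expm 1)"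

lemma (in exp_field) exp_weights: "exp_weights M X"
  unfolding exp_weights_def using indep_vars_subset[OF indep] law by (auto intro: prob_space_axioms)

lemma exp_weights_bl_measurable:
  assumes "exp_weights M X"
  shows "(\<lambda>x. bl 0 0 (\<lambda>i j. X i j x) k n) \<in> borel_measurable M"
  unfolding bl_zero_axes[of "\<lambda>i j. X i j _"]
proof (rule bl_measurable)
  fix i j
  show "(\<lambda>x. if i = 0 \<or> j = 0 then 0 else X i j x) \<in> borel_measurable M"
    using assms by (cases "i = 0 \<or> j = 0") (auto simp: exp_weights_def Suc_le_eq)
qed

text \<open>The row of bulk passage times is a fixed function of the weights in a finite box, so its
  law does not depend on the space that carries them.\<close>

lemma bulk_row_law:
  assumes X: "exp_weights M X" and mn: "1 \<le> m" "1 \<le> n"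
  defines "\<Psi> \<equiv> \<lambda>f. \<lambda>k\<in>{..m}. bl 0 0 (\<lambda>i j. if i = 0 \<or> j = 0 then 0 else f (i, j)) k n"
  shows "distr M (PiM {..m} (\<lambda>_. borel)) (\<lambda>x. \<lambda>k\<in>{..m}. bl 0 0 (\<lambda>i j. X i j x) k n) =
    distr (PiM ({1..m} \<times> {1..n}) (\<lambda>_. expm 1)) (PiM {..m} (\<lambda>_. borel)) \<Psi>"
proof -
  define S where "S = {1..m} \<times> {1..n}"
  interpret prob_space M using X by (simp add: exp_weights_def)
  let ?V = "\<lambda>x. \<lambda>s\<in>S. (case s of (i, j) \<Rightarrow> X i j) x"
  have "indep_vars (\<lambda>_. borel) (\<lambda>(i, j). X i j) S"
    using X by (auto simp: exp_weights_def S_def intro: indep_vars_subset)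
  moreover have rv: "\<And>s. s \<in> S \<Longrightarrow> random_variable borel (case s of (i, j) \<Rightarrow> X i j)"
    using X by (auto simp: exp_weights_def S_def)
  moreover have "S \<noteq> {}" using mn by (auto simp: S_def)
  ultimately have "distr M (PiM S (\<lambda>_. borel)) ?V = PiM S (\<lambda>s. distr M borel (case s of (i, j) \<Rightarrow> X i j))"
    by (subst (asm) indep_vars_iff_distr_eq_PiM') auto
  also have "\<dots> = PiM S (\<lambda>_. expm 1)"
    using X by (intro PiM_cong) (auto simp: exp_weights_def S_def)
  finally have lawS: "distr M (PiM S (\<lambda>_. borel)) ?V = PiM S (\<lambda>_. expm 1)" .
  have V: "?V \<in> measurable M (PiM S (\<lambda>_. borel))"
    by (intro measurable_restrict rv)
  have \<Psi>: "\<Psi> \<in> measurable (PiM S (\<lambda>_. borel)) (PiM {..m} (\<lambda>_. borel))"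
    unfolding \<Psi>_def
  proof (intro measurable_restrict bl_measurable)
    fix k i j assume k: "k \<in> {..m}" "i \<le> k" "j \<le> n"
    show "(\<lambda>f. if i = 0 \<or> j = 0 then 0 else f (i, j)) \<in> borel_measurable (PiM S (\<lambda>_. borel))"
    proof (cases "i = 0 \<or> j = 0")
      case False
      then have "(i, j) \<in> S" using k by (auto simp: S_def)
      then show ?thesis using False by simp
    qed auto
  qed
  have "\<Psi> (?V x) = (\<lambda>k\<in>{..m}. bl 0 0 (\<lambda>i j. X i j x) k n)" for x
    unfolding \<Psi>_def
  proof (intro restrict_ext)
    fix k assume "k \<in> {..m}"
    then show "bl 0 0 (\<lambda>i j. if i = 0 \<or> j = 0 then 0 else ?V x (i, j)) k n = bl 0 0 (\<lambda>i j. X i j x) k n"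
      by (intro bl_cong) (auto simp: S_def)
  qed
  then have "distr M (PiM {..m} (\<lambda>_. borel)) (\<lambda>x. \<lambda>k\<in>{..m}. bl 0 0 (\<lambda>i j. X i j x) k n) =
    distr (distr M (PiM S (\<lambda>_. borel)) ?V) (PiM {..m} (\<lambda>_. borel)) \<Psi>"
    by (subst distr_distr[OF \<Psi> V]) (simp add: comp_def)
  then show ?thesis unfolding lawS unfolding S_def .
qed

text \<open>The estimates for \<open>exp_field\<close> rely on axis weights, yet their events
  concern a single row of bulk passage times; so they carry over to the given weights. Condition
  \<open>ext\<close> says that the event depends on columns up to \<open>m\<close> only.\<close>

lemma bulk_row_prob_eq:
  assumes X: "exp_weights M X" and Y: "exp_weights P Y" and mn: "1 \<le> m" "1 \<le> n"
    and Q: "Measurable.pred (PiM {..m} (\<lambda>_. borel)) Q" and ext: "\<And>g. Q (restrict g {..m}) = Q g"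
  shows "measure M {x \<in> space M. Q (\<lambda>k. bl 0 0 (\<lambda>i j. X i j x) k n)} =
    measure P {x \<in> space P. Q (\<lambda>k. bl 0 0 (\<lambda>i j. Y i j x) k n)}"
proof -
  define A where "A = {g \<in> space (PiM {..m} (\<lambda>_. borel)). Q g}"
  have A: "A \<in> sets (PiM {..m} (\<lambda>_. borel))" using Q by (simp add: A_def pred_def)
  have *: "measure N {x \<in> space N. Q (\<lambda>k. bl 0 0 (\<lambda>i j. Z i j x) k n)} =
    measure (distr N (PiM {..m} (\<lambda>_. borel)) (\<lambda>x. \<lambda>k\<in>{..m}. bl 0 0 (\<lambda>i j. Z i j x) k n)) A"
    if Z: "exp_weights N Z" for N :: "'z measure" and Z
  proof -
    have "(\<lambda>x. \<lambda>k\<in>{..m}. bl 0 0 (\<lambda>i j. Z i j x) k n) \<in> measurable N (PiM {..m} (\<lambda>_. borel))"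
      by (intro measurable_restrict exp_weights_bl_measurable Z)
    then have "measure (distr N (PiM {..m} (\<lambda>_. borel)) (\<lambda>x. \<lambda>k\<in>{..m}. bl 0 0 (\<lambda>i j. Z i j x) k n)) A =
      measure N ((\<lambda>x. \<lambda>k\<in>{..m}. bl 0 0 (\<lambda>i j. Z i j x) k n) -` A \<inter> space N)"
      using A by (simp add: measure_distr)
    also have "(\<lambda>x. \<lambda>k\<in>{..m}. bl 0 0 (\<lambda>i j. Z i j x) k n) -` A \<inter> space N = {x \<in> space N. Q (\<lambda>k. bl 0 0 (\<lambda>i j. Z i j x) k n)}"
      by (auto simp: A_def space_PiM ext)
    finally show ?thesis by (rule sym)
  qed
  show ?thesis unfolding *[OF X] *[OF Y] bulk_row_law[OF X mn] bulk_row_law[OF Y mn] ..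
qed

lemma crit_ge:
  assumes "1 \<le> n" "0 < \<alpha>" "\<alpha> * sqrt (real n) \<le> sqrt (real m)"
  shows "\<alpha> / (\<alpha> + 1) \<le> crit m n"
proof -
  have "0 < sqrt (real n)" "0 \<le> sqrt (real m)" using assms by auto
  then have "0 < sqrt (real m) + sqrt (real n)" by linarith
  then show ?thesis unfolding crit_def using assms by (simp add: divide_le_eq pos_le_divide_eq field_simps)
qed

lemma crit_le:
  assumes "1 \<le> n" "0 < \<alpha>" "sqrt (real m) \<le> \<alpha> * sqrt (real n)"
  shows "crit m n \<le> \<alpha> / (\<alpha> + 1)"
proof -
  have "0 < sqrt (real n)" "0 \<le> sqrt (real m)" using assms by auto
  then have "0 < sqrt (real m) + sqrt (real n)" by linarith
  then show ?thesis unfolding crit_def using assms by (simp add: divide_le_eq pos_le_divide_eq field_simps)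
qed

text \<open>For \<open>m\<close> between \<open>\<gamma>\<^sup>2 / 4 * n\<close> and
  \<open>4 * \<gamma>\<^sup>2 * n\<close> the critical parameter lies between
  \<open>\<gamma> / (\<gamma> + 2)\<close> and \<open>1 - 1 / (2 * \<gamma> + 1)\<close>. Half of
  the smaller margin leaves room for shifted parameters.\<close>

definition crit_margin :: "real \<Rightarrow> real" where
  "crit_margin \<gamma> = min (\<gamma> / (\<gamma> + 2)) (1 / (2 * \<gamma> + 1)) / 2"

lemma crit_margin_pos: "0 < \<gamma> \<Longrightarrow> 0 < crit_margin \<gamma>"
  by (simp add: crit_margin_def)

lemma window_bounds:
  assumes \<gamma>: "0 < \<gamma>" and n: "1 \<le> n" and m: "\<gamma>\<^sup>2 / 4 * real n \<le> real m" "real m \<le> 4 * \<gamma>\<^sup>2 * real n"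
  shows "1 \<le> m" "\<gamma> / 2 * sqrt (real n) \<le> sqrt (real m)" "2 * crit_margin \<gamma> \<le> crit m n" "crit m n \<le> 1 - 2 * crit_margin \<gamma>"
    "lpp_mean m n \<le> (2 * \<gamma> + 1)\<^sup>2 * cbrt n ^ 3"
proof -
  have "0 < \<gamma>\<^sup>2 / 4 * real n" using \<gamma> n by simp
  then have "0 < real m" using m by linarith
  then show "1 \<le> m" by simp
  have "sqrt (\<gamma>\<^sup>2 / 4 * real n) \<le> sqrt (real m)" using m by simp
  then show low: "\<gamma> / 2 * sqrt (real n) \<le> sqrt (real m)" using \<gamma> by (simp add: real_sqrt_mult real_sqrt_divide)
  have "sqrt (real m) \<le> sqrt (4 * \<gamma>\<^sup>2 * real n)" using m by simp
  then have up: "sqrt (real m) \<le> 2 * \<gamma> * sqrt (real n)" using \<gamma> by (simp add: real_sqrt_mult)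
  have "\<gamma> / 2 / (\<gamma> / 2 + 1) \<le> crit m n" using \<gamma> by (intro crit_ge n low) simp
  moreover have "\<gamma> / 2 / (\<gamma> / 2 + 1) = \<gamma> / (\<gamma> + 2)" using \<gamma> by (simp add: field_simps)
  ultimately show "2 * crit_margin \<gamma> \<le> crit m n" by (simp add: crit_margin_def min_le_iff_disj)
  have "crit m n \<le> 2 * \<gamma> / (2 * \<gamma> + 1)" using \<gamma> by (intro crit_le n up) simp
  also have "\<dots> = 1 - 1 / (2 * \<gamma> + 1)" using \<gamma> by (simp add: field_simps)
  finally show "crit m n \<le> 1 - 2 * crit_margin \<gamma>" by (simp add: crit_margin_def min_def split: if_splits)
  have "(sqrt (real m) + sqrt (real n))\<^sup>2 \<le> ((2 * \<gamma> + 1) * sqrt (real n))\<^sup>2"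
    using up by (intro power_mono) (auto simp: algebra_simps)
  then show "lpp_mean m n \<le> (2 * \<gamma> + 1)\<^sup>2 * cbrt n ^ 3"
    by (simp add: lpp_mean_def cbrt_cube power_mult_distrib)
qed

text \<open>Over O(n^(2/3)) columns the critical parameter moves by O(n^(-1/3)), the order of the
  shift \<open>a\<close> itself, so the parameters used at the two ends of a window stay that
  close.\<close>

lemma crit_difference:
  assumes n: "1 \<le> n" and \<alpha>: "0 < \<alpha>" and low: "\<alpha> * sqrt (real n) \<le> sqrt (real m)" and mm: "m \<le> m'"
  shows "crit m' n - crit m n \<le> (real m' - real m) / (\<alpha> * real n)"
proof -
  define A B N where "A = sqrt (real m)" and "B = sqrt (real m')" and "N = sqrt (real n)"
  have N: "0 < N" using n by (simp add: N_def)
  have A: "\<alpha> * N \<le> A" "0 < A" using low \<alpha> N less_le_trans[of 0 "\<alpha> * N" A] by (auto simp: A_def N_def)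
  have AB: "A \<le> B" using mm by (simp add: A_def B_def)
  have "crit m' n - crit m n = N * (B - A) / ((B + N) * (A + N))"
    unfolding crit_def A_def[symmetric] B_def[symmetric] N_def[symmetric] using A AB N by (simp add: diff_frac_eq field_simps)
  also have "\<dots> \<le> N * (B - A) / (N * N)"
    using A AB N by (intro divide_left_mono mult_mono) auto
  also have "\<dots> = (B - A) / N" using N by simp
  also have "\<dots> \<le> (B\<^sup>2 - A\<^sup>2) / (\<alpha> * (N * N))"
  proof -
    have "(B - A) * (\<alpha> * N) \<le> (B - A) * (B + A)" using A AB by (intro mult_left_mono) auto
    then have "(B - A) * (\<alpha> * N) \<le> B\<^sup>2 - A\<^sup>2" by (simp add: power2_eq_square algebra_simps)
    then have "(B - A) * (\<alpha> * N) / (\<alpha> * (N * N)) \<le> (B\<^sup>2 - A\<^sup>2) / (\<alpha> * (N * N))"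
      using N \<alpha> by (intro divide_right_mono) auto
    moreover have "(B - A) * (\<alpha> * N) / (\<alpha> * (N * N)) = (B - A) / N" using N \<alpha> by simp
    ultimately show ?thesis by simp
  qed
  also have "\<dots> = (real m' - real m) / (\<alpha> * real n)" by (simp add: A_def B_def N_def)
  finally show ?thesis .
qed

lemma cbrt_sq: "(cbrt n)\<^sup>2 = real n powr (2 / 3)"
proof (cases "n = 0")
  case False
  then have "(real n powr (1 / 3)) ^ 2 = real n powr (real 2 * (1 / 3))"
    by (intro powr_power) simp
  then show ?thesis by (simp add: cbrt_def)
qed (simp add: cbrt_def)

lemma beta1_pos: "0 < \<gamma> \<Longrightarrow> 0 < beta1 \<gamma>"
  by (simp add: beta1_def)

lemma beta2_pos: "0 < \<gamma> \<Longrightarrow> 0 < beta2 \<gamma>"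
  by (simp add: beta2_def)

lemma xcoord_cbrt: "xcoord \<gamma> n u = \<gamma>\<^sup>2 * real n + beta1 \<gamma> * u * (cbrt n)\<^sup>2"
  by (simp add: xcoord_def cbrt_sq)

text \<open>The summands 1 leave room for the floor and for the right neighbour used by the
  interpolation.\<close>

lemma xcoord_window_eventually:
  assumes \<gamma>: "0 < \<gamma>" and b: "0 < b"
  shows "eventually (\<lambda>n. 1 \<le> n \<and> 1 \<le> cbrt n \<and> (\<forall>u\<in>{-b..b}. \<gamma>\<^sup>2 / 4 * real n + 1 \<le> xcoord \<gamma> n u \<and>
    xcoord \<gamma> n u + 1 \<le> 4 * \<gamma>\<^sup>2 * real n)) sequentially"
proof -
  define g c where "g = \<gamma>\<^sup>2" and "c = beta1 \<gamma> * b"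
  have g: "0 < g" and c: "0 < c" using \<gamma> b beta1_pos[OF \<gamma>] by (auto simp: g_def c_def)
  have "eventually (\<lambda>n::nat. g / 4 * real n + 1 \<le> g * real n - c * real n powr (2 / 3)) sequentially"
    using g c by real_asymp
  moreover have "eventually (\<lambda>n::nat. g * real n + c * real n powr (2 / 3) + 1 \<le> 4 * g * real n) sequentially"
    using g c by real_asymp
  moreover have "eventually (\<lambda>n. 1 \<le> cbrt n) sequentially"
    using cbrt_at_top by (simp add: filterlim_at_top)
  moreover have "eventually (\<lambda>n::nat. 1 \<le> n) sequentially" by (rule eventually_ge_at_top)
  ultimately show ?thesis
  proof eventually_elim
    case (elim n)
    have "\<gamma>\<^sup>2 / 4 * real n + 1 \<le> xcoord \<gamma> n u \<and> xcoord \<gamma> n u + 1 \<le> 4 * \<gamma>\<^sup>2 * real n" if u: "u \<in> {-b..b}" for u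
    proof -
      have "\<bar>beta1 \<gamma> * u * real n powr (2 / 3)\<bar> \<le> c * real n powr (2 / 3)"
        unfolding c_def abs_mult using u beta1_pos[OF \<gamma>] by (intro mult_mono) auto
      then show ?thesis using elim unfolding xcoord_def g_def abs_le_iff by (intro conjI; linarith)
    qed
    then show ?case using elim by blast
  qed
qed


section \<open>The rescaled process\<close>

lemma lpp_measurable:
  assumes X: "exp_weights M X"
  shows "(\<lambda>x. lpp (\<lambda>i j. X i j x) (0, 0) (k, int n)) \<in> borel_measurable M"
proof (cases "0 \<le> k")
  case True
  then have "lpp (\<lambda>i j. X i j x) (0, 0) (k, int n) = bl 0 0 (\<lambda>i j. X i j x) (nat k) n" for x
    using lpp_eq_bl[of "\<lambda>i j. X i j x" "nat k" n] by simp
  then show ?thesis using exp_weights_bl_measurable[OF X] by simp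
next
  case False
  \<comment> \<open>For small \<open>n\<close> the first coordinate may be negative; then no path
    exists and \<open>lpp\<close> is the constant \<open>Sup {}\<close>.\<close>
  have "\<not> up_right_path p l (0, 0) (k, int n)" for p l
  proof
    assume path: "up_right_path p l (0, 0) (k, int n)"
    then have "p l = (k, int n)" by (simp add: up_right_path_def)
    with up_right_path_prefix_le_bl[OF path, of l] False show False by auto
  qed
  then have "lpp (\<lambda>i j. X i j x) (0, 0) (k, int n) = Sup {}" for x by (simp add: lpp_def)
  then show ?thesis by simp
qed

definition grid_value :: "real \<Rightarrow> (nat \<Rightarrow> nat \<Rightarrow> real) \<Rightarrow> nat \<Rightarrow> int \<Rightarrow> real" where
  "grid_value \<gamma> w n k = Lresc_raw \<gamma> w n (ugrid \<gamma> n k)"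

definition interpolate :: "(int \<Rightarrow> real) \<Rightarrow> real \<Rightarrow> real" where
  "interpolate D x = (1 - (x - of_int \<lfloor>x\<rfloor>)) * D \<lfloor>x\<rfloor> + (x - of_int \<lfloor>x\<rfloor>) * D (\<lfloor>x\<rfloor> + 1)"

lemma Lresc_interpolate: "Lresc \<gamma> w n u = interpolate (grid_value \<gamma> w n) (xcoord \<gamma> n u)"
  by (simp add: Lresc_def interpolate_def grid_value_def Let_def)

text \<open>Adjacent linear pieces agree at the integer between them, and every point is interior to
  the union of two closed pieces.\<close>

lemma continuous_on_interpolate: "continuous_on UNIV (interpolate D)"
proof -
  have piece: "continuous_on {of_int k..of_int (k + 1)} (interpolate D)" for k
  proof -
    have 1: "continuous_on {of_int k..of_int (k + 1)} (\<lambda>x. (1 - (x - of_int k)) * D k + (x - of_int k) * D (k + 1))"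
      by (intro continuous_intros)
    have 2: "interpolate D x = (1 - (x - of_int k)) * D k + (x - of_int k) * D (k + 1)"
      if "x \<in> {of_int k..of_int (k + 1)}" for x
    proof (cases "x = of_int (k + 1)")
      case True
      then have "\<lfloor>x\<rfloor> = k + 1" by (metis floor_of_int)
      then show ?thesis unfolding interpolate_def using True by simp
    next
      case False
      then have "\<lfloor>x\<rfloor> = k" using that by (intro floor_unique) auto
      then show ?thesis unfolding interpolate_def by simp
    qed
    show ?thesis by (rule continuous_on_eq[OF 1]) (rule 2[symmetric])
  qed
  have "isCont (interpolate D) x" for x
  proof -
    define k where "k = \<lfloor>x\<rfloor>"
    have "continuous_on ({of_int (k - 1)..of_int k} \<union> {of_int k..of_int (k + 1)}) (interpolate D)"
      using piece[of "k - 1"] piece[of k] by (intro continuous_on_closed_Un) auto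
    moreover have "{of_int (k - 1)..of_int k} \<union> {of_int k..of_int (k + 1)} = {of_int (k - 1)..of_int (k + 1) :: real}"
      by auto
    ultimately have "continuous_on {of_int (k - 1)<..<of_int (k + 1)} (interpolate D)"
      by (auto elim!: continuous_on_subset)
    moreover have "x \<in> {of_int (k - 1)<..<of_int (k + 1)}"
      unfolding k_def by (simp, linarith)
    ultimately show ?thesis by (simp add: continuous_on_eq_continuous_at)
  qed
  then show ?thesis by (simp add: continuous_at_imp_continuous_on)
qed

lemma continuous_on_Lresc: "continuous_on S (Lresc \<gamma> w n)"
proof -
  have "continuous_on UNIV (\<lambda>u. interpolate (grid_value \<gamma> w n) (xcoord \<gamma> n u))"
    by (rule continuous_on_compose2[OF continuous_on_interpolate]) (auto simp: xcoord_def intro!: continuous_intros)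
  then show ?thesis by (auto simp: Lresc_interpolate[abs_def] elim: continuous_on_subset)
qed

lemma Lresc_measurable [measurable]:
  assumes X: "exp_weights M X"
  shows "(\<lambda>x. Lresc \<gamma> (\<lambda>i j. X i j x) n u) \<in> borel_measurable M"
proof -
  have [measurable]: "(\<lambda>x. lpp (\<lambda>i j. X i j x) (0, 0) (k, int n)) \<in> borel_measurable M" for k
    by (rule lpp_measurable[OF X])
  show ?thesis unfolding Lresc_interpolate interpolate_def grid_value_def Lresc_raw_def by measurable
qed

lemma xcoord_ugrid:
  assumes "0 < \<gamma>" "1 \<le> n"
  shows "xcoord \<gamma> n (ugrid \<gamma> n k) = of_int k"
  using assms beta1_pos[OF assms(1)] by (simp add: xcoord_def ugrid_def)

text \<open>At a grid point the centring of the process is exactly \<open>lpp_mean k n\<close>,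
  because \<open>ugrid\<close> solves \<open>xcoord = k\<close>; interpolating between grid values
  therefore creates no rounding error.\<close>

lemma grid_value_nat:
  assumes \<gamma>: "0 < \<gamma>" and n: "1 \<le> n"
  shows "grid_value \<gamma> w n (int k) = (bl 0 0 w k n - lpp_mean k n) / (beta2 \<gamma> * cbrt n)"
proof -
  have n0: "0 < real n" using n by simp
  have "real n powr (- 1 / 3 + 1) = real n powr (- 1 / 3) * real n powr 1" by (rule powr_add)
  then have "real n powr (2 / 3) = real n powr (- 1 / 3) * real n" using n0 by simp
  moreover have "0 < real n powr (- 1 / 3)" using n0 by simp
  ultimately have "beta1 \<gamma> * ugrid \<gamma> n (int k) * real n powr (- 1 / 3) = (real k - \<gamma>\<^sup>2 * real n) / real n"
    using beta1_pos[OF \<gamma>] n0 by (simp add: ugrid_def)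
  then have "\<gamma>\<^sup>2 + beta1 \<gamma> * ugrid \<gamma> n (int k) * real n powr (- 1 / 3) = real k / real n"
    using n0 by (simp add: field_simps)
  then have "real n * (1 + sqrt (\<gamma>\<^sup>2 + beta1 \<gamma> * ugrid \<gamma> n (int k) * real n powr (- 1 / 3)))\<^sup>2 = real n * (1 + sqrt (real k) / sqrt (real n))\<^sup>2"
    by (simp add: real_sqrt_divide)
  also have "\<dots> = (sqrt (real n) * (1 + sqrt (real k) / sqrt (real n)))\<^sup>2"
    by (simp add: power_mult_distrib)
  also have "\<dots> = lpp_mean k n" using n0 by (simp add: lpp_mean_def distrib_left add.commute)
  finally show ?thesis
    unfolding grid_value_def Lresc_raw_def xcoord_ugrid[OF \<gamma> n] by (simp add: lpp_eq_bl cbrt_def)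
qed

text \<open>Interpolated values are convex combinations of two grid values each; the bound passes to
  one argument at a time.\<close>

lemma interpolate_dist_le:
  assumes "\<And>a b. a \<in> {\<lfloor>x\<rfloor>, \<lfloor>x\<rfloor> + 1} \<Longrightarrow> b \<in> {\<lfloor>y\<rfloor>, \<lfloor>y\<rfloor> + 1} \<Longrightarrow> \<bar>D a - D b\<bar> \<le> h"
  shows "\<bar>interpolate D x - interpolate D y\<bar> \<le> h"
proof -
  have conv: "\<bar>((1 - s) * p + s * p') - r\<bar> \<le> h" if "0 \<le> s" "s \<le> 1" "\<bar>p - r\<bar> \<le> h" "\<bar>p' - r\<bar> \<le> h" for s p p' r :: real
  proof -
    have "((1 - s) * p + s * p') - r = (1 - s) * (p - r) + s * (p' - r)" by (simp add: algebra_simps)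
    also have "\<bar>\<dots>\<bar> \<le> (1 - s) * \<bar>p - r\<bar> + s * \<bar>p' - r\<bar>"
      using that(1,2) abs_triangle_ineq[of "(1 - s) * (p - r)" "s * (p' - r)"] by (simp add: abs_mult)
    also have "\<dots> \<le> (1 - s) * h + s * h" using that by (intro add_mono mult_left_mono) auto
    finally show ?thesis by (simp add: algebra_simps)
  qed
  have s: "0 \<le> x - of_int \<lfloor>x\<rfloor>" "x - of_int \<lfloor>x\<rfloor> \<le> 1" for x :: real by linarith+
  have 1: "\<bar>interpolate D x - D b\<bar> \<le> h" if "b \<in> {\<lfloor>y\<rfloor>, \<lfloor>y\<rfloor> + 1}" for b
    unfolding interpolate_def using assms that by (intro conv s) auto
  have 2: "\<bar>D b - interpolate D x\<bar> \<le> h" if "b \<in> {\<lfloor>y\<rfloor>, \<lfloor>y\<rfloor> + 1}" for b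
    using 1[OF that] by (simp add: abs_minus_commute)
  have "\<bar>interpolate D y - interpolate D x\<bar> \<le> h"
    unfolding interpolate_def[of D y] by (intro conv s 2) auto
  then show ?thesis by (simp add: abs_minus_commute)
qed

definition modulus_event :: "real \<Rightarrow> real \<Rightarrow> 'a measure \<Rightarrow> (nat \<Rightarrow> nat \<Rightarrow> 'a \<Rightarrow> real) \<Rightarrow> nat \<Rightarrow> real \<Rightarrow> real \<Rightarrow> 'a set" where
  "modulus_event \<gamma> b M X n \<delta> \<eta> = {x \<in> space M. \<forall>u\<in>{-b..b}. \<forall>v\<in>{-b..b}. \<bar>u - v\<bar> \<le> \<delta> \<longrightarrow>
     \<bar>Lresc \<gamma> (\<lambda>i j. X i j x) n u - Lresc \<gamma> (\<lambda>i j. X i j x) n v\<bar> \<le> \<eta>}"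

text \<open>Continuity of the paths reduces the uncountable quantifier to a countable set of pairs.
  That set is dense in the admissible set \<open>S\<close> and contained in it; rational pairs of
  the plane could miss \<open>S\<close>.\<close>

lemma modulus_event_measurable:
  assumes X: "exp_weights M X"
  shows "modulus_event \<gamma> b M X n \<delta> \<eta> \<in> sets M"
proof -
  note [measurable] = Lresc_measurable[OF X]
  define S where "S = {p :: real \<times> real. fst p \<in> {-b..b} \<and> snd p \<in> {-b..b} \<and> \<bar>fst p - snd p\<bar> \<le> \<delta>}"
  obtain T where T: "countable T" "T \<subseteq> S" "S \<subseteq> closure T" using separable[of S] by blast
  let ?h = "\<lambda>x p. \<bar>Lresc \<gamma> (\<lambda>i j. X i j x) n (fst p) - Lresc \<gamma> (\<lambda>i j. X i j x) n (snd p)\<bar>"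
  have "(\<forall>p\<in>S. ?h x p \<le> \<eta>) \<longleftrightarrow> (\<forall>p\<in>T. ?h x p \<le> \<eta>)" for x
  proof
    assume le: "\<forall>p\<in>T. ?h x p \<le> \<eta>"
    have "continuous_on UNIV (?h x)"
      by (intro continuous_intros continuous_on_compose2[OF continuous_on_Lresc[of UNIV]]) auto
    then have "closed {p. ?h x p \<le> \<eta>}"
      by (intro closed_Collect_le) auto
    then have "closure T \<subseteq> {p. ?h x p \<le> \<eta>}" using le by (intro closure_minimal) auto
    then show "\<forall>p\<in>S. ?h x p \<le> \<eta>" using T by auto
  qed (use T in auto)
  moreover have "modulus_event \<gamma> b M X n \<delta> \<eta> = {x \<in> space M. \<forall>p\<in>S. ?h x p \<le> \<eta>}"
    by (auto simp: modulus_event_def S_def)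
  ultimately have "modulus_event \<gamma> b M X n \<delta> \<eta> = {x \<in> space M. \<forall>p\<in>T. ?h x p \<le> \<eta>}" by simp
  also have "\<dots> = space M - (\<Union>p\<in>T. {x \<in> space M. \<not> ?h x p \<le> \<eta>})" by blast
  also have "\<dots> \<in> sets M"
    using T(1) by (intro sets.Diff sets.top sets.countable_UN'') measurable
  finally show ?thesis .
qed

lemma modulus_event_mono: "\<delta>' \<le> \<delta> \<Longrightarrow> modulus_event \<gamma> b M X n \<delta> \<eta> \<subseteq> modulus_event \<gamma> b M X n \<delta>' \<eta>"
  unfolding modulus_event_def by force

text \<open>Each single path is uniformly continuous on the compact interval.\<close>

lemma modulus_event_exhausts:
  assumes "0 < \<eta>"
  shows "(\<Union>j. modulus_event \<gamma> b M X n (1 / real (Suc j)) \<eta>) = space M"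
proof -
  have "\<exists>j. x \<in> modulus_event \<gamma> b M X n (1 / real (Suc j)) \<eta>" if x: "x \<in> space M" for x
  proof -
    let ?f = "Lresc \<gamma> (\<lambda>i j. X i j x) n"
    have "uniformly_continuous_on {-b..b} ?f"
      by (intro compact_uniformly_continuous continuous_on_Lresc) auto
    then obtain d where d: "0 < d" "\<And>u v. u \<in> {-b..b} \<Longrightarrow> v \<in> {-b..b} \<Longrightarrow> dist v u < d \<Longrightarrow> dist (?f v) (?f u) < \<eta>"
      unfolding uniformly_continuous_on_def using assms by meson
    obtain j where j: "1 / real (Suc j) < d" using reals_Archimedean[OF d(1)] by (auto simp: inverse_eq_divide)
    have "\<bar>?f u - ?f v\<bar> \<le> \<eta>" if "u \<in> {-b..b}" "v \<in> {-b..b}" "\<bar>u - v\<bar> \<le> 1 / real (Suc j)" for u v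
      using d(2)[of v u] that j by (auto simp: dist_real_def)
    then show ?thesis using x unfolding modulus_event_def by blast
  qed
  then show ?thesis by (auto simp: modulus_event_def)
qed

text \<open>Upgrades an estimate for large n to all n: for each of the finitely many others,
  continuity from below along the exhaustion supplies an index, and the maximum of all indices works
  throughout.\<close>

lemma (in prob_space) exhaustion_uniform:
  fixes S :: "nat \<Rightarrow> nat \<Rightarrow> 'a set"
  assumes sets: "\<And>n j. S n j \<in> events" and inc: "\<And>n. incseq (S n)" and un: "\<And>n. (\<Union>j. S n j) = space M"
    and \<epsilon>: "0 < \<epsilon>" and ev: "eventually (\<lambda>n. 1 - \<epsilon> \<le> prob (S n j0)) sequentially"
  shows "\<exists>j. \<forall>n. 1 - \<epsilon> \<le> prob (S n j)"
proof -
  obtain N where N: "\<And>n. N \<le> n \<Longrightarrow> 1 - \<epsilon> \<le> prob (S n j0)" using ev by (auto simp: eventually_sequentially)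
  have "\<exists>j. 1 - \<epsilon> \<le> prob (S n j)" for n
  proof -
    have "(\<lambda>j. prob (S n j)) \<longlonglongrightarrow> prob (\<Union>j. S n j)"
      using sets inc by (intro finite_Lim_measure_incseq) auto
    then have "(\<lambda>j. prob (S n j)) \<longlonglongrightarrow> 1" by (simp add: un prob_space)
    then have "eventually (\<lambda>j. 1 - \<epsilon> < prob (S n j)) sequentially" using \<epsilon> by (intro order_tendstoD) auto
    then show ?thesis using eventually_happens[of _ sequentially] by (metis less_imp_le sequentially_bot)
  qed
  then obtain J where J: "\<And>n. 1 - \<epsilon> \<le> prob (S n (J n))" by metis
  define j where "j = Max (insert j0 (J ` {..<N}))"
  have "1 - \<epsilon> \<le> prob (S n j)" for n
  proof -
    obtain i where i: "i \<le> j" "1 - \<epsilon> \<le> prob (S n i)"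
    proof (cases "n < N")
      case True
      then show ?thesis using J[of n] that[of "J n"] by (simp add: j_def)
    next
      case False
      then show ?thesis using N[of n] that[of j0] by (simp add: j_def)
    qed
    have "prob (S n i) \<le> prob (S n j)" using inc[of n] i(1) sets by (intro finite_measure_mono) (auto simp: incseq_def)
    then show ?thesis using i by simp
  qed
  then show ?thesis by blast
qed

section \<open>A compact class of continuous functions\<close>

text \<open>The retraction of the line onto [-b, b]. Compact sets are taken among bounded continuous
  functions on the whole line, so functions on the interval are extended by constants.\<close>

definition clip :: "real \<Rightarrow> real \<Rightarrow> real" where
  "clip b u = max (- b) (min b u)"

text \<open>The first condition pins the functions down outside the interval; values left free there
  would destroy compactness in the supremum norm.\<close>

definition modulus_class :: "real \<Rightarrow> real \<Rightarrow> (nat \<Rightarrow> real) \<Rightarrow> (real \<Rightarrow>\<^sub>C real) set" where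
  "modulus_class b B \<delta> = {f :: real \<Rightarrow>\<^sub>C real. (\<forall>u. f u = f (clip b u)) \<and> \<bar>f 0\<bar> \<le> B \<and>
     (\<forall>j. \<forall>u\<in>{-b..b}. \<forall>v\<in>{-b..b}. \<bar>u - v\<bar> \<le> \<delta> j \<longrightarrow> \<bar>f u - f v\<bar> \<le> 1 / real (Suc j))}"

lemma clip_bounds: "0 < b \<Longrightarrow> clip b u \<in> {-b..b}"
  by (auto simp: clip_def)

lemma clip_id: "u \<in> {-b..b} \<Longrightarrow> clip b u = u"
  by (auto simp: clip_def)

lemma continuous_on_clip: "0 < b \<Longrightarrow> continuous_on {-b..b} g \<Longrightarrow> continuous_on UNIV (\<lambda>u. g (clip b u))"
  by (rule continuous_on_compose2[of "{-b..b}" g]) (auto simp: clip_def intro!: continuous_intros)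

lemma clip_bcontfun:
  assumes b: "0 < b" and g: "continuous_on {-b..b} g"
  shows "(\<lambda>u. g (clip b u)) \<in> bcontfun"
proof -
  have "bounded (g ` {-b..b})" using g by (intro compact_imp_bounded compact_continuous_image) auto
  then have "bounded (range (\<lambda>u. g (clip b u)))"
    by (rule bounded_subset) (use clip_bounds[OF b] in auto)
  then show ?thesis using continuous_on_clip[OF b g] by (simp add: bcontfun_def)
qed

text \<open>The way from 0 to \<open>u\<close> is covered in \<open>N\<close> steps of length at
  most \<open>\<delta> 0\<close>, each of which changes the function by at most 1.\<close>

lemma modulus_class_bounded:
  assumes b: "0 < b" and \<delta>: "\<And>j. 0 < \<delta> j"
  obtains C where "\<And>f u. f \<in> modulus_class b B \<delta> \<Longrightarrow> u \<in> {-b..b} \<Longrightarrow> \<bar>f u\<bar> \<le> C"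
proof -
  obtain N where N: "b / \<delta> 0 < real N" using reals_Archimedean2 by blast
  then have N0: "0 < real N" by (rule less_trans[OF divide_pos_pos[OF b \<delta>]])
  have "\<bar>f u\<bar> \<le> B + real N" if f: "f \<in> modulus_class b B \<delta>" and u: "u \<in> {-b..b}" for f u
  proof -
    have "\<bar>f (real i * u / real N) - f 0\<bar> \<le> real i" if "i \<le> N" for i
      using that
    proof (induction i)
      case (Suc i)
      have mem: "real k * u / real N \<in> {-b..b}" if "k \<le> N" for k
      proof -
        have "\<bar>real k * u / real N\<bar> = real k / real N * \<bar>u\<bar>" by (simp add: abs_mult)
        also have "\<dots> \<le> 1 * b" using that N0 u b by (intro mult_mono) (auto simp: divide_le_eq)
        finally show ?thesis unfolding abs_le_iff atLeastAtMost_iff by linarith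
      qed
      have "real (Suc i) * u / real N - real i * u / real N = u / real N"
        by (simp add: diff_divide_distrib[symmetric] algebra_simps)
      moreover have "\<bar>u / real N\<bar> \<le> \<delta> 0"
      proof -
        have "\<bar>u / real N\<bar> \<le> b / real N" using u N0 by (auto simp: abs_le_iff divide_right_mono)
        also have "\<dots> \<le> \<delta> 0" using N N0 \<delta>[of 0] by (simp add: field_simps)
        finally show ?thesis .
      qed
      ultimately have "\<bar>real (Suc i) * u / real N - real i * u / real N\<bar> \<le> \<delta> 0" by simp
      then have "\<bar>f (real (Suc i) * u / real N) - f (real i * u / real N)\<bar> \<le> 1 / real (Suc 0)"
        using f mem[OF Suc.prems] mem[OF Suc_leD[OF Suc.prems]] unfolding modulus_class_def by blast
      then show ?case using Suc by auto
    qed simp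
    from this[of N] have "\<bar>f u - f 0\<bar> \<le> real N" using N0 by simp
    moreover have "\<bar>f 0\<bar> \<le> B" using f by (simp add: modulus_class_def)
    ultimately show ?thesis by linarith
  qed
  then show ?thesis using that by blast
qed

text \<open>Arzela-Ascoli gives a uniform limit on the interval; it is extended through
  \<open>clip\<close>, and the bounds that define the class pass to pointwise limits.\<close>

lemma compact_modulus_class:
  assumes b: "0 < b" and \<delta>: "\<And>j. 0 < \<delta> j"
  shows "compact (modulus_class b B \<delta>)"
  unfolding compact_eq_seq_compact_metric seq_compact_def
proof (intro allI impI)
  fix F :: "nat \<Rightarrow> real \<Rightarrow>\<^sub>C real" assume F: "\<forall>n. F n \<in> modulus_class b B \<delta>"
  obtain C where C: "\<And>f u. f \<in> modulus_class b B \<delta> \<Longrightarrow> u \<in> {-b..b} \<Longrightarrow> \<bar>f u\<bar> \<le> C"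
    using modulus_class_bounded[of b \<delta> B] b \<delta> by blast
  have eq: "\<exists>d. 0 < d \<and> (\<forall>n v. v \<in> {-b..b} \<and> norm (u - v) < d \<longrightarrow> norm (F n u - F n v) < e)"
    if u: "u \<in> {-b..b}" and e: "0 < e" for u e
  proof -
    obtain j where j: "1 / real (Suc j) < e" using reals_Archimedean[OF e] by (auto simp: inverse_eq_divide)
    have "norm (F n u - F n v) < e" if "v \<in> {-b..b}" "norm (u - v) < \<delta> j" for n v
    proof -
      have "\<bar>F n u - F n v\<bar> \<le> 1 / real (Suc j)" using F that u unfolding modulus_class_def by auto
      then show ?thesis using j by simp
    qed
    then show ?thesis using \<delta> by blast
  qed
  have bd: "norm (F n u) \<le> C" if "u \<in> {-b..b}" for n u
    using C[OF _ that] F by simp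
  obtain g r where g: "continuous_on {-b..b} g" and r: "strict_mono (r :: nat \<Rightarrow> nat)"
    and lim: "\<And>e. 0 < e \<Longrightarrow> \<exists>N. \<forall>n u. n \<ge> N \<and> u \<in> {-b..b} \<longrightarrow> norm (F (r n) u - g u) < e"
    using Arzela_Ascoli[of "{-b..b}" "\<lambda>n. apply_bcontfun (F n)" C, OF compact_Icc bd eq] by blast
  define G where "G = Bcontfun (\<lambda>u. g (clip b u))"
  have G: "apply_bcontfun G u = g (clip b u)" for u
    unfolding G_def by (simp add: Bcontfun_inverse[OF clip_bcontfun[OF b g]])
  have conv: "(F \<circ> r) \<longlonglongrightarrow> G"
  proof (rule metric_LIMSEQ_I)
    fix e :: real assume e: "0 < e"
    then obtain N where N: "\<And>n u. N \<le> n \<Longrightarrow> u \<in> {-b..b} \<Longrightarrow> norm (F (r n) u - g u) < e / 2"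
      using lim[of "e / 2"] by auto
    have "dist ((F \<circ> r) n) G < e" if "N \<le> n" for n
    proof -
      have "dist ((F \<circ> r) n) G \<le> e / 2"
      proof (rule dist_bound)
        fix u
        have "F (r n) u = F (r n) (clip b u)" using F by (auto simp: modulus_class_def)
        then show "dist (apply_bcontfun ((F \<circ> r) n) u) (apply_bcontfun G u) \<le> e / 2"
          using N[OF that clip_bounds[OF b], of u] by (simp add: G dist_norm)
      qed
      then show ?thesis using e by simp
    qed
    then show "\<exists>no. \<forall>n\<ge>no. dist ((F \<circ> r) n) G < e" by blast
  qed
  have pt: "(\<lambda>n. F (r n) u) \<longlonglongrightarrow> G u" for u
  proof -
    have lim0: "(\<lambda>n. dist ((F \<circ> r) n) G) \<longlonglongrightarrow> 0" using conv by (rule tendsto_dist_iff[THEN iffD1])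
    have "(\<lambda>n. dist (F (r n) u) (G u)) \<longlonglongrightarrow> 0"
      by (rule tendsto_sandwich[OF _ _ tendsto_const lim0]) (auto intro!: always_eventually dist_bounded)
    then show ?thesis by (rule tendsto_dist_iff[THEN iffD2])
  qed
  have "G \<in> modulus_class b B \<delta>"
    unfolding modulus_class_def mem_Collect_eq
  proof (intro conjI allI ballI impI)
    show "G u = G (clip b u)" for u using clip_id[OF clip_bounds[OF b, of u]] by (simp add: G)
    show "\<bar>G 0\<bar> \<le> B"
      by (rule tendsto_upperbound[OF tendsto_rabs[OF pt]]) (use F in \<open>auto simp: modulus_class_def\<close>)
    fix j u v assume uv: "u \<in> {-b..b}" "v \<in> {-b..b}" "\<bar>u - v\<bar> \<le> \<delta> j"
    have "\<bar>F (r n) u - F (r n) v\<bar> \<le> 1 / real (Suc j)" for n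
      using F uv unfolding modulus_class_def by blast
    then show "\<bar>G u - G v\<bar> \<le> 1 / real (Suc j)"
      by (intro tendsto_upperbound[OF tendsto_rabs[OF tendsto_diff[OF pt pt]]]) auto
  qed
  then show "\<exists>l\<in>modulus_class b B \<delta>. \<exists>r. strict_mono r \<and> (F \<circ> r) \<longlonglongrightarrow> l" using r conv by blast
qed


section \<open>Tightness of the rescaled process\<close>

lemma nat_floor_bounds:
  fixes x :: real
  assumes "0 \<le> x"
  shows "int (nat \<lfloor>x\<rfloor>) = \<lfloor>x\<rfloor>" "real (nat \<lfloor>x\<rfloor>) \<le> x" "x < real (nat \<lfloor>x\<rfloor>) + 1"
  using assms by (auto simp: of_nat_nat)

text \<open>The right end carries an extra 1 because the interpolation at \<open>b\<close> uses the
  grid point to the right of the floor.\<close>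

lemma floor_window_eventually:
  assumes pos: "0 < \<gamma>" "0 < b"
  defines "m0 \<equiv> \<lambda>n. nat \<lfloor>xcoord \<gamma> n (- b)\<rfloor>" and "m1 \<equiv> \<lambda>n. nat \<lfloor>xcoord \<gamma> n b\<rfloor> + 1"
    and "A \<equiv> 2 * beta1 \<gamma> * b + 2"
  shows "eventually (\<lambda>n. 1 \<le> n \<and> 1 \<le> cbrt n \<and> 0 \<le> xcoord \<gamma> n (- b) \<and>
      1 \<le> m0 n \<and> m0 n \<le> m1 n \<and> real (m1 n) - real (m0 n) \<le> A * (cbrt n)\<^sup>2 \<and>
      crit (m1 n) n - crit (m0 n) n \<le> (A / (\<gamma> / 2)) / cbrt n \<and>
      2 * crit_margin \<gamma> \<le> crit (m0 n) n \<and> crit (m1 n) n \<le> 1 - 2 * crit_margin \<gamma>) sequentially"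
  using xcoord_window_eventually[OF pos]
proof eventually_elim
  case (elim n)
  define t where "t = cbrt n"
  define x0 x1 where "x0 = xcoord \<gamma> n (- b)" and "x1 = xcoord \<gamma> n b"
  have b1: "0 < beta1 \<gamma>" using pos by (intro beta1_pos)
  have n: "1 \<le> n" and t: "1 \<le> t" using elim by (auto simp: t_def)
  have x0: "\<gamma>\<^sup>2 / 4 * real n + 1 \<le> x0" "x0 + 1 \<le> 4 * \<gamma>\<^sup>2 * real n" using elim pos by (auto simp: x0_def)
  have x1: "\<gamma>\<^sup>2 / 4 * real n + 1 \<le> x1" "x1 + 1 \<le> 4 * \<gamma>\<^sup>2 * real n" using elim pos by (auto simp: x1_def)
  have nn: "0 \<le> \<gamma>\<^sup>2 / 4 * real n" by simp
  have x01: "x1 - x0 = 2 * beta1 \<gamma> * b * t\<^sup>2" by (simp add: x0_def x1_def xcoord_cbrt t_def)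
  have "0 \<le> 2 * beta1 \<gamma> * b * t\<^sup>2" using b1 pos by simp
  then have xx: "x0 \<le> x1" using x01 by linarith
  have p0: "0 \<le> x0" and p1: "0 \<le> x1" using x0 x1 nn by linarith+
  have r0: "real (m0 n) \<le> x0" "x0 - 1 < real (m0 n)"
    using nat_floor_bounds(2,3)[OF p0] unfolding m0_def x0_def[symmetric] by linarith+
  have r1: "real (m1 n) \<le> x1 + 1" "x1 < real (m1 n)"
    using nat_floor_bounds(2,3)[OF p1] unfolding m1_def x1_def[symmetric] of_nat_add of_nat_1 by linarith+
  have "\<gamma>\<^sup>2 / 4 * real n \<le> real (m0 n)" "real (m0 n) \<le> 4 * \<gamma>\<^sup>2 * real n" using r0 x0 by linarith+
  note w0 = window_bounds[OF pos(1) n this]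
  have "\<gamma>\<^sup>2 / 4 * real n \<le> real (m1 n)" "real (m1 n) \<le> 4 * \<gamma>\<^sup>2 * real n" using r1 x1 by linarith+
  note w1 = window_bounds[OF pos(1) n this]
  have m01: "m0 n \<le> m1 n" using r0 r1 xx by linarith
  have diff: "real (m1 n) - real (m0 n) \<le> A * t\<^sup>2"
  proof -
    have "real (m1 n) - real (m0 n) \<le> 2 * beta1 \<gamma> * b * t\<^sup>2 + 2" using r0 r1 x01 by linarith
    also have "\<dots> \<le> 2 * beta1 \<gamma> * b * t\<^sup>2 + 2 * t\<^sup>2" using t by (simp add: one_le_power)
    finally show ?thesis by (simp add: A_def distrib_right)
  qed
  have "crit (m1 n) n - crit (m0 n) n \<le> (real (m1 n) - real (m0 n)) / (\<gamma> / 2 * real n)"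
    using pos by (intro crit_difference n w0 m01) auto
  also have "\<dots> \<le> A * t\<^sup>2 / (\<gamma> / 2 * real n)"
    using pos n diff by (intro divide_right_mono) auto
  also have "\<dots> = (A / (\<gamma> / 2)) / t"
  proof -
    have "real n = t * t\<^sup>2" using cbrt_cube[of n] by (simp add: t_def power2_eq_square power3_eq_cube)
    then show ?thesis using t by simp
  qed
  finally show ?case using n t p0 w0 w1 m01 diff by (auto simp: t_def x0_def)
qed

text \<open>The row estimate speaks of grid columns; convexity of the interpolation carries it to
  all \<open>u\<close> and \<open>v\<close> in the interval.\<close>

lemma modulus_event_eventually:
  assumes X: "exp_weights M X" and pos: "0 < \<gamma>" "0 < b" "0 < \<eta>" "0 < \<epsilon>"
  shows "\<exists>\<delta>>0. eventually (\<lambda>n. 1 - \<epsilon> \<le> measure M (modulus_event \<gamma> b M X n \<delta> \<eta>)) sequentially"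
proof -
  interpret M: prob_space M using X by (simp add: exp_weights_def)
  define P Y where "P = PiM UNIV (\<lambda>_::nat \<times> nat. expm 1)" and "Y = (\<lambda>i j (y :: nat \<times> nat \<Rightarrow> real). \<bar>y (i, j)\<bar>)"
  interpret P: exp_field P Y unfolding P_def Y_def by (rule exp_field_canonical)
  have b1: "0 < beta1 \<gamma>" and b2: "0 < beta2 \<gamma>" using pos by (auto intro: beta1_pos beta2_pos)
  define m0 m1 where "m0 n = nat \<lfloor>xcoord \<gamma> n (- b)\<rfloor>" and "m1 n = nat \<lfloor>xcoord \<gamma> n b\<rfloor> + 1" for n
  define A where "A = 2 * beta1 \<gamma> * b + 2"
  have A: "0 < A" using pos b1 by (auto simp: A_def intro: add_pos_pos)
  note window = floor_window_eventually[OF pos(1,2), folded m0_def m1_def A_def]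
  have A': "0 < A / (\<gamma> / 2)" using A pos by simp
  have "eventually (\<lambda>n. 1 \<le> m0 n \<and> m0 n \<le> m1 n \<and> real (m1 n) - real (m0 n) \<le> A * (cbrt n)\<^sup>2 \<and>
      crit (m1 n) n - crit (m0 n) n \<le> (A / (\<gamma> / 2)) / cbrt n \<and>
      2 * crit_margin \<gamma> \<le> crit (m0 n) n \<and> crit (m1 n) n \<le> 1 - 2 * crit_margin \<gamma>) sequentially"
    using window by eventually_elim blast
  from P.row_modulus_eventually[OF A A' crit_margin_pos[OF pos(1)] pos(4) mult_pos_pos[OF pos(3) b2] this]
  obtain \<delta>0 where \<delta>0: "0 < \<delta>0" and evP: "eventually (\<lambda>n. P.prob {x \<in> space P. \<exists>k\<in>{m0 n..m1 n}. \<exists>k'\<in>{m0 n..m1 n}. k \<le> k' \<and>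
      real k' \<le> real k + \<delta>0 * (cbrt n)\<^sup>2 \<and>
      \<eta> * beta2 \<gamma> * cbrt n < \<bar>P.Lx 0 0 k' n x - P.Lx 0 0 k n x - (lpp_mean k' n - lpp_mean k n)\<bar>} \<le> \<epsilon>) sequentially"
    by blast
  \<comment> \<open>Half of \<open>\<delta>0\<close> is reserved for the grid: passing from
    \<open>xcoord\<close> to neighbouring integers changes a distance by at most 2, which is below
    \<open>\<delta>0 * t\<^sup>2 / 2\<close> for large n.\<close>
  define \<delta> where "\<delta> = \<delta>0 / (2 * beta1 \<gamma>)"
  have \<delta>: "0 < \<delta>" using \<delta>0 b1 by (simp add: \<delta>_def)
  have "eventually (\<lambda>n. 4 / \<delta>0 \<le> cbrt n) sequentially"
    using cbrt_at_top by (simp add: filterlim_at_top)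
  with window evP have "eventually (\<lambda>n. 1 - \<epsilon> \<le> measure M (modulus_event \<gamma> b M X n \<delta> \<eta>)) sequentially"
  proof eventually_elim
    case (elim n)
    define t where "t = cbrt n"
    have n: "1 \<le> n" and t: "1 \<le> t" "4 / \<delta>0 \<le> t" using elim by (auto simp: t_def)
    have m: "1 \<le> m1 n" using elim by auto
    have x0: "0 \<le> xcoord \<gamma> n (- b)" using elim by auto
    have \<delta>t: "4 \<le> \<delta>0 * t\<^sup>2"
    proof -
      have "4 \<le> \<delta>0 * t" using t \<delta>0 by (simp add: divide_le_eq mult.commute)
      also have "\<dots> \<le> \<delta>0 * t\<^sup>2" using t \<delta>0 by (simp add: power2_eq_square)
      finally show ?thesis .
    qed
    define Q where "Q g \<longleftrightarrow> (\<exists>k\<in>{m0 n..m1 n}. \<exists>k'\<in>{m0 n..m1 n}. k \<le> k' \<and>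
      real k' \<le> real k + \<delta>0 * t\<^sup>2 \<and> \<eta> * beta2 \<gamma> * t < \<bar>g k' - g k - (lpp_mean k' n - lpp_mean k n)\<bar>)" for g :: "nat \<Rightarrow> real"
    let ?bad = "{x \<in> space M. Q (\<lambda>k. bl 0 0 (\<lambda>i j. X i j x) k n)}"
    \<comment> \<open>The bad event is a condition on one row of bulk passage times, so its
      probability may be computed in the canonical field.\<close>
    have "measure M ?bad = P.prob {x \<in> space P. Q (\<lambda>k. P.Lx 0 0 k n x)}"
    proof (rule bulk_row_prob_eq[OF X P.exp_weights m n])
      have comp: "(\<lambda>g. g k) \<in> borel_measurable (PiM {..m1 n} (\<lambda>_. borel))" if "k \<in> {m0 n..m1 n}" for k
        using that by (intro measurable_component_singleton) auto
      show "Measurable.pred (PiM {..m1 n} (\<lambda>_. borel)) Q"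
        unfolding Q_def
        by (intro pred_intros_finite pred_intros_logic finite_atLeastAtMost borel_measurable_pred_less
          borel_measurable_const borel_measurable_abs borel_measurable_diff comp) simp_all
      show "Q (restrict g {..m1 n}) = Q g" for g
        unfolding Q_def by (intro bex_cong refl conj_cong) auto
    qed
    also have "\<dots> \<le> \<epsilon>" using elim by (simp add: Q_def t_def)
    finally have bad: "measure M ?bad \<le> \<epsilon>" .
    have [measurable]: "?bad \<in> sets M"
    proof -
      note [measurable] = exp_weights_bl_measurable[OF X]
      show ?thesis unfolding Q_def by measurable
    qed
    have "space M - ?bad \<subseteq> modulus_event \<gamma> b M X n \<delta> \<eta>"
    proof
      fix x assume x: "x \<in> space M - ?bad"
      define w where "w = (\<lambda>i j. X i j x)"
      define D where "D = grid_value \<gamma> w n"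
      have grid: "\<bar>D (int k') - D (int k)\<bar> \<le> \<eta>"
        if "k \<in> {m0 n..m1 n}" "k' \<in> {m0 n..m1 n}" "k \<le> k'" "real k' - real k \<le> \<delta>0 * t\<^sup>2" for k k'
      proof -
        have "\<not> \<eta> * beta2 \<gamma> * t < \<bar>bl 0 0 w k' n - bl 0 0 w k n - (lpp_mean k' n - lpp_mean k n)\<bar>"
        proof
          assume "\<eta> * beta2 \<gamma> * t < \<bar>bl 0 0 w k' n - bl 0 0 w k n - (lpp_mean k' n - lpp_mean k n)\<bar>"
          moreover have "real k' \<le> real k + \<delta>0 * t\<^sup>2" using that(4) by linarith
          ultimately have "Q (\<lambda>k. bl 0 0 w k n)" unfolding Q_def using that(1-3) by blast
          then show False using x unfolding w_def by blast
        qed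
        then have le: "\<bar>bl 0 0 w k' n - bl 0 0 w k n - (lpp_mean k' n - lpp_mean k n)\<bar> \<le> \<eta> * (beta2 \<gamma> * t)" by (simp add: mult.assoc)
        have bt: "0 < beta2 \<gamma> * t" using b2 t by simp
        have "D (int k') - D (int k) = (bl 0 0 w k' n - bl 0 0 w k n - (lpp_mean k' n - lpp_mean k n)) / (beta2 \<gamma> * t)"
          unfolding D_def grid_value_nat[OF pos(1) n] t_def by (simp add: diff_divide_distrib)
        then have "\<bar>D (int k') - D (int k)\<bar> = \<bar>bl 0 0 w k' n - bl 0 0 w k n - (lpp_mean k' n - lpp_mean k n)\<bar> / (beta2 \<gamma> * t)"
          using bt by simp
        also have "\<dots> \<le> \<eta>" using le bt by (simp add: pos_divide_le_eq)
        finally show ?thesis .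
      qed
      have gridz: "\<bar>D a - D c\<bar> \<le> \<eta>"
        if "a \<in> {int (m0 n)..int (m1 n)}" "c \<in> {int (m0 n)..int (m1 n)}" "\<bar>of_int a - of_int c\<bar> \<le> \<delta>0 * t\<^sup>2" for a c
      proof -
        have "0 \<le> a" "0 \<le> c" using that(1,2) by auto
        then obtain k k' where k: "a = int k" "c = int k'" by (metis nonneg_int_cases)
        have kr: "k \<in> {m0 n..m1 n}" "k' \<in> {m0 n..m1 n}" "\<bar>real k - real k'\<bar> \<le> \<delta>0 * t\<^sup>2"
          using that unfolding k by simp_all
        show ?thesis
        proof (cases "k \<le> k'")
          case True
          have "\<bar>D (int k') - D (int k)\<bar> \<le> \<eta>" using kr True by (intro grid) auto
          then show ?thesis unfolding k by (simp only: abs_minus_commute)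
        next
          case False
          show ?thesis unfolding k using kr False by (intro grid) auto
        qed
      qed
      have "\<bar>Lresc \<gamma> w n u - Lresc \<gamma> w n v\<bar> \<le> \<eta>" if uv: "u \<in> {-b..b}" "v \<in> {-b..b}" "\<bar>u - v\<bar> \<le> \<delta>" for u v
        unfolding Lresc_interpolate D_def[symmetric]
      proof (rule interpolate_dist_le)
        have mono: "xcoord \<gamma> n u' \<le> xcoord \<gamma> n v'" if "u' \<le> v'" for u' v'
          unfolding xcoord_cbrt using that b1 by (intro add_left_mono mult_right_mono mult_left_mono) auto
        have rng: "a \<in> {int (m0 n)..int (m1 n)}" if "a \<in> {\<lfloor>xcoord \<gamma> n u'\<rfloor>, \<lfloor>xcoord \<gamma> n u'\<rfloor> + 1}" "u' \<in> {-b..b}" for a u'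
        proof -
          have "int (m0 n) \<le> \<lfloor>xcoord \<gamma> n u'\<rfloor>"
            using nat_floor_bounds(1)[OF x0] mono[of "- b" u'] that by (simp add: m0_def floor_mono)
          moreover have "0 \<le> xcoord \<gamma> n b" using x0 mono[of "- b" b] pos by simp
          then have "\<lfloor>xcoord \<gamma> n u'\<rfloor> + 1 \<le> int (m1 n)"
            using nat_floor_bounds(1)[of "xcoord \<gamma> n b"] mono[of u' b] that by (simp add: m1_def floor_mono)
          ultimately show ?thesis using that by auto
        qed
        fix a c assume a: "a \<in> {\<lfloor>xcoord \<gamma> n u\<rfloor>, \<lfloor>xcoord \<gamma> n u\<rfloor> + 1}" and c: "c \<in> {\<lfloor>xcoord \<gamma> n v\<rfloor>, \<lfloor>xcoord \<gamma> n v\<rfloor> + 1}"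
        have "\<bar>xcoord \<gamma> n u - xcoord \<gamma> n v\<bar> = beta1 \<gamma> * \<bar>u - v\<bar> * t\<^sup>2"
        proof -
          have "xcoord \<gamma> n u - xcoord \<gamma> n v = beta1 \<gamma> * (u - v) * t\<^sup>2" by (simp add: xcoord_cbrt t_def algebra_simps)
          then show ?thesis using b1 by (simp add: abs_mult)
        qed
        also have "\<dots> \<le> beta1 \<gamma> * \<delta> * t\<^sup>2" using uv b1 by (intro mult_right_mono mult_left_mono) auto
        also have "\<dots> = \<delta>0 * t\<^sup>2 / 2" using b1 by (simp add: \<delta>_def)
        finally have "\<bar>xcoord \<gamma> n u - xcoord \<gamma> n v\<bar> \<le> \<delta>0 * t\<^sup>2 / 2" .
        moreover have "\<bar>of_int a - of_int c\<bar> \<le> \<bar>xcoord \<gamma> n u - xcoord \<gamma> n v\<bar> + 2"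
          using a c by (auto simp: abs_le_iff) linarith+
        ultimately have "\<bar>of_int a - of_int c\<bar> \<le> \<delta>0 * t\<^sup>2" using \<delta>t by linarith
        then show "\<bar>D a - D c\<bar> \<le> \<eta>" using rng[OF a uv(1)] rng[OF c uv(2)] by (intro gridz)
      qed
      then show "x \<in> modulus_event \<gamma> b M X n \<delta> \<eta>" using x unfolding modulus_event_def w_def by blast
    qed
    then have "measure M (space M - ?bad) \<le> measure M (modulus_event \<gamma> b M X n \<delta> \<eta>)"
      by (intro M.finite_measure_mono modulus_event_measurable X)
    moreover have "measure M (space M - ?bad) = 1 - measure M ?bad" by (rule M.prob_compl) measurable
    ultimately show ?case using bad by simp
  qed
  with \<delta> show ?thesis by blast
qed

lemma interpolate_abs_le:
  assumes "\<bar>D \<lfloor>x\<rfloor>\<bar> \<le> h" "\<bar>D (\<lfloor>x\<rfloor> + 1)\<bar> \<le> h"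
  shows "\<bar>interpolate D x\<bar> \<le> h"
proof -
  define s where "s = x - of_int \<lfloor>x\<rfloor>"
  have s: "0 \<le> s" "s \<le> 1" unfolding s_def by linarith+
  have "\<bar>interpolate D x\<bar> \<le> (1 - s) * \<bar>D \<lfloor>x\<rfloor>\<bar> + s * \<bar>D (\<lfloor>x\<rfloor> + 1)\<bar>"
    unfolding interpolate_def s_def[symmetric]
    using s abs_triangle_ineq[of "(1 - s) * D \<lfloor>x\<rfloor>" "s * D (\<lfloor>x\<rfloor> + 1)"] by (simp add: abs_mult)
  also have "\<dots> \<le> (1 - s) * h + s * h" using s assms by (intro add_mono mult_left_mono) auto
  finally show ?thesis by (simp add: algebra_simps)
qed

lemma grid_value_tight_eventually:
  assumes X: "exp_weights M X" and pos: "0 < \<gamma>" "0 < \<epsilon>"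
    and m: "eventually (\<lambda>n. 1 \<le> n \<and> \<gamma>\<^sup>2 / 4 * real n \<le> real (m n) \<and> real (m n) \<le> 4 * \<gamma>\<^sup>2 * real n) sequentially"
  shows "\<exists>B. eventually (\<lambda>n. measure M {x \<in> space M. B < \<bar>grid_value \<gamma> (\<lambda>i j. X i j x) n (int (m n))\<bar>} \<le> \<epsilon>) sequentially"
proof -
  define P Y where "P = PiM UNIV (\<lambda>_::nat \<times> nat. expm 1)" and "Y = (\<lambda>i j (y :: nat \<times> nat \<Rightarrow> real). \<bar>y (i, j)\<bar>)"
  interpret P: exp_field P Y unfolding P_def Y_def by (rule exp_field_canonical)
  have b2: "0 < beta2 \<gamma>" using pos by (intro beta2_pos)
  have "0 < (2 * \<gamma> + 1)\<^sup>2" using pos by simp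
  moreover have "eventually (\<lambda>n. 1 \<le> m n \<and> 2 * crit_margin \<gamma> \<le> crit (m n) n \<and> crit (m n) n \<le> 1 - 2 * crit_margin \<gamma> \<and>
      lpp_mean (m n) n \<le> (2 * \<gamma> + 1)\<^sup>2 * cbrt n ^ 3) sequentially"
    using m by eventually_elim (use window_bounds[OF pos(1)] in blast)
  ultimately obtain B where evP: "eventually (\<lambda>n. P.prob {x \<in> space P. B * cbrt n < \<bar>P.Lx 0 0 (m n) n x - lpp_mean (m n) n\<bar>} \<le> \<epsilon>) sequentially"
    using P.bulk_tight_eventually[OF crit_margin_pos[OF pos(1)] _ pos(2)] by blast
  from m evP have "eventually (\<lambda>n. measure M {x \<in> space M. B / beta2 \<gamma> < \<bar>grid_value \<gamma> (\<lambda>i j. X i j x) n (int (m n))\<bar>} \<le> \<epsilon>) sequentially"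
  proof eventually_elim
    case (elim n)
    define t where "t = cbrt n"
    have n: "1 \<le> n" using elim by blast
    have m1: "1 \<le> m n" using window_bounds(1)[OF pos(1) n, of "m n"] elim by blast
    have t0: "0 < t" using n by (simp add: t_def cbrt_def)
    have "B / beta2 \<gamma> < \<bar>grid_value \<gamma> w n (int (m n))\<bar> \<longleftrightarrow> B * t < \<bar>bl 0 0 w (m n) n - lpp_mean (m n) n\<bar>" for w
    proof -
      have bt: "0 < beta2 \<gamma> * t" using b2 t0 by simp
      have "\<bar>grid_value \<gamma> w n (int (m n))\<bar> = \<bar>bl 0 0 w (m n) n - lpp_mean (m n) n\<bar> / (beta2 \<gamma> * t)"
        unfolding grid_value_nat[OF pos(1) n] t_def[symmetric] using bt by simp
      moreover have "B / beta2 \<gamma> = B * t / (beta2 \<gamma> * t)" using t0 by simp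
      ultimately show ?thesis using bt by (simp only: divide_less_cancel) auto
    qed
    then have "measure M {x \<in> space M. B / beta2 \<gamma> < \<bar>grid_value \<gamma> (\<lambda>i j. X i j x) n (int (m n))\<bar>} =
      measure M {x \<in> space M. (\<lambda>g. B * t < \<bar>g (m n) - lpp_mean (m n) n\<bar>) (\<lambda>k. bl 0 0 (\<lambda>i j. X i j x) k n)}" by simp
    also have "\<dots> = P.prob {x \<in> space P. (\<lambda>g. B * t < \<bar>g (m n) - lpp_mean (m n) n\<bar>) (\<lambda>k. P.Lx 0 0 k n x)}"
    proof (rule bulk_row_prob_eq[OF X P.exp_weights m1 n])
      have [measurable]: "(\<lambda>g. g (m n)) \<in> borel_measurable (PiM {..m n} (\<lambda>_. borel))"
        by (intro measurable_component_singleton) auto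
      show "Measurable.pred (PiM {..m n} (\<lambda>_. borel)) (\<lambda>g. B * t < \<bar>g (m n) - lpp_mean (m n) n\<bar>)" by measurable
    qed simp
    also have "\<dots> \<le> \<epsilon>" using elim by (simp add: t_def)
    finally show ?case .
  qed
  then show ?thesis by blast
qed

text \<open>The value at 0 interpolates two adjacent grid values, and each of them is controlled by
  the estimate at a single point.\<close>

lemma origin_tight_eventually:
  assumes X: "exp_weights M X" and pos: "0 < \<gamma>" "0 < \<epsilon>"
  shows "\<exists>B. eventually (\<lambda>n. 1 - \<epsilon> \<le> measure M {x \<in> space M. \<bar>Lresc \<gamma> (\<lambda>i j. X i j x) n 0\<bar> \<le> B}) sequentially"
proof -
  interpret M: prob_space M using X by (simp add: exp_weights_def)
  define m where "m n = nat \<lfloor>xcoord \<gamma> n 0\<rfloor>" for n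
  have win: "eventually (\<lambda>n. 1 \<le> n \<and> 0 \<le> xcoord \<gamma> n 0 \<and> \<gamma>\<^sup>2 / 4 * real n \<le> real (m n) \<and> real (m n) + 1 \<le> 4 * \<gamma>\<^sup>2 * real n) sequentially"
    using xcoord_window_eventually[OF pos(1) zero_less_one]
  proof eventually_elim
    case (elim n)
    have x: "\<gamma>\<^sup>2 / 4 * real n + 1 \<le> xcoord \<gamma> n 0" "xcoord \<gamma> n 0 + 1 \<le> 4 * \<gamma>\<^sup>2 * real n" using elim by auto
    have "0 \<le> \<gamma>\<^sup>2 / 4 * real n" by simp
    then have x0: "0 \<le> xcoord \<gamma> n 0" using x by linarith
    show ?case using x x0 nat_floor_bounds(2,3)[OF x0] elim unfolding m_def by linarith
  qed
  have "eventually (\<lambda>n. 1 \<le> n \<and> \<gamma>\<^sup>2 / 4 * real n \<le> real (m n) \<and> real (m n) \<le> 4 * \<gamma>\<^sup>2 * real n) sequentially"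
    using win by eventually_elim linarith
  from grid_value_tight_eventually[OF X pos(1) half_gt_zero[OF pos(2)] this]
  obtain B1 where B1: "eventually (\<lambda>n. measure M {x \<in> space M. B1 < \<bar>grid_value \<gamma> (\<lambda>i j. X i j x) n (int (m n))\<bar>} \<le> \<epsilon> / 2) sequentially"
    by blast
  have "eventually (\<lambda>n. 1 \<le> n \<and> \<gamma>\<^sup>2 / 4 * real n \<le> real (m n + 1) \<and> real (m n + 1) \<le> 4 * \<gamma>\<^sup>2 * real n) sequentially"
    using win by eventually_elim auto
  from grid_value_tight_eventually[OF X pos(1) half_gt_zero[OF pos(2)] this]
  obtain B2 where B2: "eventually (\<lambda>n. measure M {x \<in> space M. B2 < \<bar>grid_value \<gamma> (\<lambda>i j. X i j x) n (int (m n + 1))\<bar>} \<le> \<epsilon> / 2) sequentially"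
    by blast
  define B where "B = max B1 B2"
  from win B1 B2 have "eventually (\<lambda>n. 1 - \<epsilon> \<le> measure M {x \<in> space M. \<bar>Lresc \<gamma> (\<lambda>i j. X i j x) n 0\<bar> \<le> B}) sequentially"
  proof eventually_elim
    case (elim n)
    note [measurable] = Lresc_measurable[OF X] lpp_measurable[OF X]
    let ?E1 = "{x \<in> space M. B1 < \<bar>grid_value \<gamma> (\<lambda>i j. X i j x) n (int (m n))\<bar>}"
    let ?E2 = "{x \<in> space M. B2 < \<bar>grid_value \<gamma> (\<lambda>i j. X i j x) n (int (m n + 1))\<bar>}"
    let ?G = "{x \<in> space M. \<bar>Lresc \<gamma> (\<lambda>i j. X i j x) n 0\<bar> \<le> B}"
    have E[measurable]: "?E1 \<in> sets M" "?E2 \<in> sets M" unfolding grid_value_def Lresc_raw_def by measurable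
    have fl: "\<lfloor>xcoord \<gamma> n 0\<rfloor> = int (m n)" using nat_floor_bounds(1) elim unfolding m_def by metis
    have "space M - (?E1 \<union> ?E2) \<subseteq> ?G"
    proof
      fix x assume x: "x \<in> space M - (?E1 \<union> ?E2)"
      have "\<bar>Lresc \<gamma> (\<lambda>i j. X i j x) n 0\<bar> \<le> B"
        unfolding Lresc_interpolate using x by (intro interpolate_abs_le) (auto simp: fl B_def add.commute)
      then show "x \<in> ?G" using x by blast
    qed
    then have "M.prob (space M - (?E1 \<union> ?E2)) \<le> M.prob ?G"
      by (rule M.finite_measure_mono) measurable
    moreover have "M.prob (space M - (?E1 \<union> ?E2)) = 1 - M.prob (?E1 \<union> ?E2)" by (rule M.prob_compl) measurable
    moreover have "M.prob (?E1 \<union> ?E2) \<le> M.prob ?E1 + M.prob ?E2" by (rule measure_Un_le) measurable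
    ultimately show ?case using elim by linarith
  qed
  then show ?thesis by blast
qed

theorem theorem2p2:
  fixes M :: "'a measure" and \<omega> :: "nat \<Rightarrow> nat \<Rightarrow> 'a \<Rightarrow> real"
    and \<gamma> Mb :: real
  assumes "prob_space M"
    and "prob_space.indep_vars M (\<lambda>_. borel) (\<lambda>(i, j). \<omega> i j) ({1..} \<times> {1..})"
    and "\<And>i j. i \<ge> 1 \<Longrightarrow> j \<ge> 1 \<Longrightarrow> distributed M lborel (\<omega> i j) (exponential_density 1)"
    and "\<gamma> > 0" and "Mb > 0"
  shows "\<forall>\<epsilon>>0. \<exists>K :: (real \<Rightarrow>\<^sub>C real) set. compact K \<and>
           (\<forall>n\<ge>1. measure M {x \<in> space M. \<exists>f\<in>K. \<forall>u\<in>{-Mb..Mb}.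
                      apply_bcontfun f u = Lresc \<gamma> (\<lambda>i j. \<omega> i j x) n u} \<ge> 1 - \<epsilon>)"
proof (intro allI impI)
  fix \<epsilon> :: real assume \<epsilon>: "0 < \<epsilon>"
  interpret prob_space M by fact
  have X: "exp_weights M \<omega>"
    unfolding exp_weights_def
  proof (intro conjI allI impI)
    fix i j :: nat assume ij: "1 \<le> i" "1 \<le> j"
    have "\<omega> i j \<in> measurable M lborel" using assms(3)[OF ij] by (rule distributed_measurable)
    then show "\<omega> i j \<in> borel_measurable M" by simp
    have "distr M borel (\<omega> i j) = distr M lborel (\<omega> i j)" by (intro distr_cong) auto
    also have "\<dots> = expm 1" unfolding expm_def using assms(3)[OF ij] by (rule distributed_distr_eq_density)
    finally show "distr M borel (\<omega> i j) = expm 1" .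
  qed (fact assms(1), fact assms(2))
  \<comment> \<open>The budget is split geometrically: \<open>\<epsilon> / 2\<close> for the value
    at 0 and \<open>\<epsilon> / 2 ^ (j + 2)\<close> for the modulus at accuracy
    \<open>1 / real (Suc j)\<close>.\<close>
  have \<epsilon>_pos: "0 < \<epsilon> * (1 / 2) ^ i" for i :: nat using \<epsilon> by simp
  let ?O = "\<lambda>n B. {x \<in> space M. \<bar>Lresc \<gamma> (\<lambda>i j. \<omega> i j x) n 0\<bar> \<le> B}"
  have O_sets: "?O n B \<in> events" for n B
  proof -
    note [measurable] = Lresc_measurable[OF X]
    show ?thesis by measurable
  qed
  have "\<exists>j. \<forall>n. 1 - \<epsilon> * (1 / 2) ^ Suc 0 \<le> prob (?O n (real j))"
  proof -
    obtain B where B: "eventually (\<lambda>n. 1 - \<epsilon> * (1 / 2) ^ Suc 0 \<le> prob (?O n B)) sequentially"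
      using origin_tight_eventually[OF X assms(4) \<epsilon>_pos] by blast
    obtain j0 where j0: "B \<le> real j0" using real_arch_simple by blast
    show ?thesis
    proof (rule exhaustion_uniform[where ?j0.0=j0])
      show "incseq (\<lambda>j. ?O n (real j))" for n
        unfolding incseq_def using order_trans of_nat_mono by blast
      show "(\<Union>j. ?O n (real j)) = space M" for n
      proof
        show "space M \<subseteq> (\<Union>j. ?O n (real j))"
        proof
          fix x assume x: "x \<in> space M"
          obtain j :: nat where "\<bar>Lresc \<gamma> (\<lambda>i j. \<omega> i j x) n 0\<bar> \<le> real j" using real_arch_simple by blast
          then show "x \<in> (\<Union>j. ?O n (real j))" using x by blast
        qed
      qed blast
      show "eventually (\<lambda>n. 1 - \<epsilon> * (1 / 2) ^ Suc 0 \<le> prob (?O n (real j0))) sequentially"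
        using B
      proof eventually_elim
        case (elim n)
        have "prob (?O n B) \<le> prob (?O n (real j0))" using j0 by (intro finite_measure_mono O_sets) auto
        then show ?case using elim by linarith
      qed
      show "?O n (real j) \<in> events" for n j by (rule O_sets)
      show "0 < \<epsilon> * (1 / 2) ^ Suc 0" by (rule \<epsilon>_pos)
    qed
  qed
  then obtain B where B: "\<And>n. 1 - \<epsilon> * (1 / 2) ^ Suc 0 \<le> prob (?O n B)" by blast
  have ex: "\<exists>\<delta>. 0 < \<delta> \<and> (\<forall>n. 1 - \<epsilon> * (1 / 2) ^ Suc (Suc j) \<le> prob (modulus_event \<gamma> Mb M \<omega> n \<delta> (1 / real (Suc j))))" for j
  proof -
    let ?S = "\<lambda>n i. modulus_event \<gamma> Mb M \<omega> n (1 / real (Suc i)) (1 / real (Suc j))"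
    have j_pos: "0 < 1 / real (Suc j)" by simp
    obtain \<delta> where \<delta>: "0 < \<delta>"
      and ev: "eventually (\<lambda>n. 1 - \<epsilon> * (1 / 2) ^ Suc (Suc j) \<le> prob (modulus_event \<gamma> Mb M \<omega> n \<delta> (1 / real (Suc j)))) sequentially"
      using modulus_event_eventually[OF X assms(4,5) j_pos \<epsilon>_pos] by blast
    obtain i0 where i0: "1 / real (Suc i0) < \<delta>" using reals_Archimedean[OF \<delta>] by (auto simp: inverse_eq_divide)
    have "\<exists>i. \<forall>n. 1 - \<epsilon> * (1 / 2) ^ Suc (Suc j) \<le> prob (?S n i)"
    proof (rule exhaustion_uniform[where ?j0.0=i0])
      show "?S n i \<in> events" for n i by (rule modulus_event_measurable[OF X])
      show "incseq (?S n)" for n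
        unfolding incseq_def by (intro allI impI modulus_event_mono) (simp add: frac_le)
      show "(\<Union>i. ?S n i) = space M" for n by (rule modulus_event_exhausts) simp
      show "eventually (\<lambda>n. 1 - \<epsilon> * (1 / 2) ^ Suc (Suc j) \<le> prob (?S n i0)) sequentially"
        using ev
      proof eventually_elim
        case (elim n)
        have "prob (modulus_event \<gamma> Mb M \<omega> n \<delta> (1 / real (Suc j))) \<le> prob (?S n i0)"
          using i0 by (intro finite_measure_mono modulus_event_measurable X modulus_event_mono) simp
        then show ?case using elim by linarith
      qed
      show "0 < \<epsilon> * (1 / 2) ^ Suc (Suc j)" by (rule \<epsilon>_pos)
    qed
    then obtain i where "\<forall>n. 1 - \<epsilon> * (1 / 2) ^ Suc (Suc j) \<le> prob (?S n i)" by blast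
    then show ?thesis by (intro exI[of _ "1 / real (Suc i)"] conjI) simp_all
  qed
  define \<delta> where "\<delta> j = (SOME d. 0 < d \<and> (\<forall>n. 1 - \<epsilon> * (1 / 2) ^ Suc (Suc j) \<le>
    prob (modulus_event \<gamma> Mb M \<omega> n d (1 / real (Suc j)))))" for j
  have \<delta>_spec: "0 < \<delta> j \<and> (\<forall>n. 1 - \<epsilon> * (1 / 2) ^ Suc (Suc j) \<le> prob (modulus_event \<gamma> Mb M \<omega> n (\<delta> j) (1 / real (Suc j))))" for j
    unfolding \<delta>_def by (rule someI_ex[OF ex])
  have \<delta>: "0 < \<delta> j" for j using \<delta>_spec by blast
  have mod: "1 - \<epsilon> * (1 / 2) ^ Suc (Suc j) \<le> prob (modulus_event \<gamma> Mb M \<omega> n (\<delta> j) (1 / real (Suc j)))" for j n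
    using \<delta>_spec by blast
  let ?K = "modulus_class Mb B \<delta>"
  have main: "1 - \<epsilon> \<le> prob {x \<in> space M. \<exists>f\<in>?K. \<forall>u\<in>{-Mb..Mb}. apply_bcontfun f u = Lresc \<gamma> (\<lambda>i j. \<omega> i j x) n u}" for n
  proof -
    let ?mod = "\<lambda>j. modulus_event \<gamma> Mb M \<omega> n (\<delta> j) (1 / real (Suc j))"
    let ?E = "{x \<in> space M. \<exists>f\<in>?K. \<forall>u\<in>{-Mb..Mb}. apply_bcontfun f u = Lresc \<gamma> (\<lambda>i j. \<omega> i j x) n u}"
    define bad where "bad i = (case i of 0 \<Rightarrow> space M - ?O n B | Suc j \<Rightarrow> space M - ?mod j)" for i :: nat
    have bad_0: "bad 0 = space M - ?O n B" and bad_Suc: "bad (Suc j) = space M - ?mod j" for j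
      by (simp_all add: bad_def)
    have bad_sets: "bad i \<in> events" for i
    proof (cases i)
      case 0
      show ?thesis unfolding 0 bad_0 by (intro sets.Diff sets.top O_sets)
    next
      case (Suc j)
      show ?thesis unfolding Suc bad_Suc by (intro sets.Diff sets.top modulus_event_measurable X)
    qed
    have bad_le: "prob (bad i) \<le> \<epsilon> * (1 / 2) ^ Suc i" for i
    proof (cases i)
      case 0
      have "prob (bad 0) = 1 - prob (?O n B)" unfolding bad_0 by (intro prob_compl O_sets)
      then show ?thesis using B[of n] unfolding 0 by linarith
    next
      case (Suc j)
      have "prob (bad (Suc j)) = 1 - prob (?mod j)" unfolding bad_Suc by (intro prob_compl modulus_event_measurable X)
      then show ?thesis using mod[of j n] unfolding Suc by linarith
    qed
    \<comment> \<open>Equality, and not just an inclusion, because it also makes the event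
      measurable: it is the complement of countably many measurable bad events.\<close>
    have E_eq: "?E = space M - (\<Union>i. bad i)"
    proof
      show "?E \<subseteq> space M - (\<Union>i. bad i)"
      proof
        fix x assume "x \<in> ?E"
        then obtain f where x: "x \<in> space M" and f: "f \<in> ?K"
          and eq: "\<And>u. u \<in> {-Mb..Mb} \<Longrightarrow> Lresc \<gamma> (\<lambda>i j. \<omega> i j x) n u = apply_bcontfun f u" by auto
        have "x \<in> ?O n B" using f x eq[of 0] assms(5) by (simp add: modulus_class_def)
        moreover have "x \<in> ?mod j" for j
          using f x eq unfolding modulus_event_def modulus_class_def by simp
        ultimately show "x \<in> space M - (\<Union>i. bad i)" using x by (auto simp: bad_def split: nat.splits)
      qed
      show "space M - (\<Union>i. bad i) \<subseteq> ?E"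
      proof
        fix x assume x: "x \<in> space M - (\<Union>i. bad i)"
        define g where "g = Lresc \<gamma> (\<lambda>i j. \<omega> i j x) n"
        have "x \<notin> bad 0" "\<And>j. x \<notin> bad (Suc j)" using x by blast+
        then have xO: "x \<in> ?O n B" and xm: "\<And>j. x \<in> ?mod j" using x by (auto simp: bad_def)
        have bc: "(\<lambda>u. g (clip Mb u)) \<in> bcontfun"
          unfolding g_def by (rule clip_bcontfun[OF assms(5) continuous_on_Lresc])
        \<comment> \<open>The witness is the path itself, continued by constants outside the
          interval.\<close>
        define f where "f = Bcontfun (\<lambda>u. g (clip Mb u))"
        have f: "apply_bcontfun f u = g (clip Mb u)" for u unfolding f_def by (simp add: Bcontfun_inverse[OF bc])
        have fI: "apply_bcontfun f u = g u" if "u \<in> {-Mb..Mb}" for u using clip_id[OF that] by (simp add: f)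
        have "f \<in> ?K"
          unfolding modulus_class_def mem_Collect_eq
        proof (intro conjI allI ballI impI)
          show "f u = f (clip Mb u)" for u using clip_id[OF clip_bounds[OF assms(5), of u]] by (simp add: f)
          show "\<bar>f 0\<bar> \<le> B" using xO fI[of 0] assms(5) by (simp add: g_def)
          fix j u v assume uv: "u \<in> {-Mb..Mb}" "v \<in> {-Mb..Mb}" "\<bar>u - v\<bar> \<le> \<delta> j"
          then show "\<bar>f u - f v\<bar> \<le> 1 / real (Suc j)"
            using xm[of j] unfolding fI[OF uv(1)] fI[OF uv(2)] g_def modulus_event_def by blast
        qed
        then show "x \<in> ?E" using x fI unfolding g_def by blast
      qed
    qed
    have sums: "(\<lambda>i. \<epsilon> * (1 / 2) ^ Suc i) sums (\<epsilon> * 1)"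
      by (intro sums_mult power_half_series)
    have summ: "summable (\<lambda>i. prob (bad i))"
      by (rule summable_comparison_test'[OF sums_summable[OF sums], of 0])
        (simp only: real_norm_def abs_of_nonneg[OF measure_nonneg] bad_le)
    have "prob (\<Union>i. bad i) \<le> (\<Sum>i. prob (bad i))"
      using bad_sets by (intro finite_measure_subadditive_countably summ) blast
    also have "\<dots> \<le> (\<Sum>i. \<epsilon> * (1 / 2) ^ Suc i)"
      by (intro suminf_le bad_le summ sums_summable[OF sums])
    also have "\<dots> = \<epsilon>" using sums_unique[OF sums] by simp
    finally have "prob (\<Union>i. bad i) \<le> \<epsilon>" .
    moreover have "prob (space M - (\<Union>i. bad i)) = 1 - prob (\<Union>i. bad i)"
      using bad_sets by (intro prob_compl sets.countable_UN) blast
    ultimately show ?thesis unfolding E_eq by linarith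
  qed
  show "\<exists>K :: (real \<Rightarrow>\<^sub>C real) set. compact K \<and>
    (\<forall>n\<ge>1. measure M {x \<in> space M. \<exists>f\<in>K. \<forall>u\<in>{-Mb..Mb}. apply_bcontfun f u = Lresc \<gamma> (\<lambda>i j. \<omega> i j x) n u} \<ge> 1 - \<epsilon>)"
  proof (intro exI[of _ ?K] conjI allI impI)
    show "compact ?K" by (rule compact_modulus_class[OF assms(5) \<delta>])
  qed (rule main)
qed

end
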